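(* Suppose the SCC fails. Then there exists $\varepsilon>0$ such that, for all $\sigma,\delta\ge 1$, there is an algorithm that solves every $n$-vertex instance of Triangle Packing given with a $(\sigma,\delta)$-hub of size $p$ in time $(2-\varepsilon)^p\cdot n^{\mathcal{O}(1)}$.
   Context: For a graph $G$, a set $Q\subseteq V(G)$ is a $(\sigma,\delta)$-hub if every connected component of $G-Q$ has at most $\sigma$ vertices and is adjacent to at most $\delta$ vertices of $Q$. Triangle Packing: given a graph $G$ and an integer $t$, decide whether $G$ contains at least $t$ pairwise vertex-disjoint triangles. $\le d$-Set Cover: given a universe $U$, a family $\mathcal{F}$ of subsets of $U$ of size at most $d$ with $\bigcup\mathcal{F}=U$, and an integer $t$, decide whether at most $t$ sets of $\mathcal{F}$ cover $U$. SCC: for all $\epsilon>0$ there is $d\ge1$ such that no algorithm solves every $\le d$-Set Cover instance in time $(2-\epsilon)^{|U|}|U|^{\mathcal{O}(1)}$. *)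

theory Defs
  imports Complex_Main
begin

section \<open>Model of computation\<close>

text \<open>
  Algorithms are programs of a strict untyped functional language over cons cells, in de Bruijn
  notation.  Inside the body of a function, index 0 is the argument and index 1 is the function
  itself, which provides recursion; inside the second branch of a \<^verbatim>\<open>Case\<close>, index 0 is the head and
  index 1 the tail of the cell.  Every evaluation step has unit cost, and for a fixed program each
  step is a constant number of pointer operations, so a random access machine simulates the
  language with constant overhead (in memory cell operations).  Conversely the language simulates
  \<open>T\<close> steps of such a machine with overhead polylogarithmic in \<open>T\<close>, by storing the memory as a
  balanced tree.  For running times of the form \<open>c\<^sup>k \<cdot> n\<^bsup>O(1)\<^esup>\<close> with \<open>k \<le> n\<close> these factors
  are absorbed by \<open>n\<^bsup>O(1)\<^esup>\<close>.
\<close>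

datatype expr =
    Var nat
  | Fun expr
  | App expr expr
  | Empty
  | Cell expr expr
  | Case expr expr expr

datatype val =
    VEmpty
  | VCell val val
  | VClos "val list" expr

text \<open>\<open>eval env e v k\<close>: in environment \<open>env\<close>, \<open>e\<close> terminates with value \<open>v\<close> after \<open>k\<close> steps.\<close>

inductive eval :: "val list \<Rightarrow> expr \<Rightarrow> val \<Rightarrow> nat \<Rightarrow> bool" where
  eval_Var: "i < length env \<Longrightarrow> eval env (Var i) (env ! i) 1"
| eval_Fun: "eval env (Fun e) (VClos env e) 1"
| eval_App: "\<lbrakk>eval env e1 (VClos env' e) k1; eval env e2 u k2;
              eval (u # VClos env' e # env') e v k3\<rbrakk>
             \<Longrightarrow> eval env (App e1 e2) v (k1 + k2 + k3 + 1)"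
| eval_Empty: "eval env Empty VEmpty 1"
| eval_Cell: "\<lbrakk>eval env e1 v1 k1; eval env e2 v2 k2\<rbrakk>
              \<Longrightarrow> eval env (Cell e1 e2) (VCell v1 v2) (k1 + k2 + 1)"
| eval_Case_Empty: "\<lbrakk>eval env e VEmpty k1; eval env e1 v k2\<rbrakk>
              \<Longrightarrow> eval env (Case e e1 e2) v (k1 + k2 + 1)"
| eval_Case_Cell: "\<lbrakk>eval env e (VCell x y) k1; eval (x # y # env) e2 v k2\<rbrakk>
              \<Longrightarrow> eval env (Case e e1 e2) v (k1 + k2 + 1)"

lemma eval_deterministic:
  "eval env e v k \<Longrightarrow> eval env e v' k' \<Longrightarrow> v' = v \<and> k' = k"
proof (induction arbitrary: v' k' rule: eval.induct)
  case (eval_App env e1 env' e k1 e2 u k2 v k3)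
  from eval_App.prems show ?case
    by (cases rule: eval.cases) (use eval_App.IH in \<open>(blast | fastforce)+\<close>)
next
  case (eval_Cell env e1 v1 k1 e2 v2 k2)
  from eval_Cell.prems show ?case
    by (cases rule: eval.cases) (use eval_Cell.IH in \<open>(blast | fastforce)+\<close>)
next
  case (eval_Case_Empty env e k1 e1 v k2 e2)
  from eval_Case_Empty.prems show ?case
    by (cases rule: eval.cases) (use eval_Case_Empty.IH in \<open>(blast | fastforce)+\<close>)
next
  case (eval_Case_Cell env e x y k1 e2 v k2 e1)
  from eval_Case_Cell.prems show ?case
    by (cases rule: eval.cases) (use eval_Case_Cell.IH in \<open>(blast | fastforce)+\<close>)
qed (auto elim: eval.cases)

section \<open>Encoding of inputs\<close>

text \<open>
  Numbers are encoded in unary.  All elements of a universe or vertex set \<open>{..<n}\<close> are smaller than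
  \<open>n\<close>, and running times are measured in \<open>n\<close> up to factors \<open>n\<^bsup>O(1)\<^esup>\<close>, so this costs only a
  polynomial factor; a threshold exceeding \<open>n\<close> can be recognised without reading it completely.
\<close>

fun enc_list :: "val list \<Rightarrow> val" where
  "enc_list [] = VEmpty"
| "enc_list (v # vs) = VCell v (enc_list vs)"

definition enc_nat :: "nat \<Rightarrow> val" where
  "enc_nat n = enc_list (replicate n VEmpty)"

definition enc_bool :: "bool \<Rightarrow> val" where
  "enc_bool b = (if b then VCell VEmpty VEmpty else VEmpty)"

definition enc_int :: "int \<Rightarrow> val" where
  "enc_int i = VCell (enc_bool (i < 0)) (enc_nat (nat \<bar>i\<bar>))"

definition enc_nats :: "nat list \<Rightarrow> val" where
  "enc_nats xs = enc_list (map enc_nat xs)"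

definition enc_natss :: "nat list list \<Rightarrow> val" where
  "enc_natss xss = enc_list (map enc_nats xss)"

text \<open>
  A finite set is presented by listing its elements, and a finite family of sets by listing its
  members, in arbitrary order but without repetition.
\<close>

definition lists_set :: "'a list \<Rightarrow> 'a set \<Rightarrow> bool" where
  "lists_set xs A \<longleftrightarrow> distinct xs \<and> set xs = A"

definition lists_family :: "'a list list \<Rightarrow> 'a set set \<Rightarrow> bool" where
  "lists_family xss F \<longleftrightarrow> (\<forall>xs \<in> set xss. distinct xs) \<and> lists_set (map set xss) F"

text \<open>A program is an expression whose only free index, 0, is bound to the input.\<close>

definition decides_within :: "expr \<Rightarrow> val \<Rightarrow> bool \<Rightarrow> real \<Rightarrow> bool" where
  "decides_within A x b T \<longleftrightarrow> (\<exists>k. eval [x] A (enc_bool b) k \<and> real k \<le> T)"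

section \<open>Set Cover with sets of bounded size\<close>

definition set_cover_instance :: "nat \<Rightarrow> 'a set \<Rightarrow> 'a set set \<Rightarrow> bool" where
  "set_cover_instance d U F \<longleftrightarrow>
     finite U \<and> (\<forall>S \<in> F. S \<subseteq> U \<and> card S \<le> d) \<and> \<Union>F = U"

definition has_set_cover :: "'a set \<Rightarrow> 'a set set \<Rightarrow> int \<Rightarrow> bool" where
  "has_set_cover U F t \<longleftrightarrow> (\<exists>S \<subseteq> F. \<Union>S = U \<and> int (card S) \<le> t)"

definition solves_set_cover :: "nat \<Rightarrow> expr \<Rightarrow> (nat \<Rightarrow> real) \<Rightarrow> bool" where
  "solves_set_cover d A T \<longleftrightarrow>
     (\<forall>m F t Fs. set_cover_instance d {..<m} F \<longrightarrow> lists_family Fs F \<longrightarrow>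
        decides_within A (enc_list [enc_nat m, enc_natss Fs, enc_int t])
          (has_set_cover {..<m} F t) (T m))"

text \<open>
  A factor \<open>n\<^bsup>O(1)\<^esup>\<close> is rendered as \<open>C \<cdot> (n + 1)\<^sup>c\<close>, so that the bound does not collapse to 0
  for \<open>n = 0\<close>.
\<close>

definition SCC :: bool where
  "SCC \<longleftrightarrow>
     (\<forall>\<epsilon>::real > 0. \<exists>d \<ge> 1.
        \<not> (\<exists>A (C::real) (c::nat). solves_set_cover d A (\<lambda>m. (2 - \<epsilon>) ^ m * (C * (real m + 1) ^ c))))"

section \<open>Graphs, hubs and Triangle Packing\<close>

text \<open>Finite simple undirected graphs, with edges as two-element vertex sets.\<close>

definition simple_graph :: "'a set \<Rightarrow> 'a set set \<Rightarrow> bool" where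
  "simple_graph V E \<longleftrightarrow> finite V \<and> (\<forall>e \<in> E. e \<subseteq> V \<and> card e = 2)"

definition connected_in :: "'a set \<Rightarrow> 'a set set \<Rightarrow> ('a \<times> 'a) set" where
  "connected_in V E = {(u, v). u \<in> V \<and> v \<in> V \<and> (u, v) \<in> {(x, y). {x, y} \<in> E}\<^sup>*}"

definition components :: "'a set \<Rightarrow> 'a set set \<Rightarrow> 'a set set" where
  "components V E = V // connected_in V E"

definition hub :: "nat \<Rightarrow> nat \<Rightarrow> 'a set \<Rightarrow> 'a set set \<Rightarrow> 'a set \<Rightarrow> bool" where
  "hub \<sigma> \<delta> V E Q \<longleftrightarrow> Q \<subseteq> V \<and>
     (\<forall>K \<in> components (V - Q) {e \<in> E. e \<inter> Q = {}}.
        card K \<le> \<sigma> \<and> card {q \<in> Q. \<exists>x \<in> K. {q, x} \<in> E} \<le> \<delta>)"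

definition triangles :: "'a set \<Rightarrow> 'a set set \<Rightarrow> 'a set set" where
  "triangles V E = {T. T \<subseteq> V \<and> card T = 3 \<and> (\<forall>x \<in> T. \<forall>y \<in> T. x \<noteq> y \<longrightarrow> {x, y} \<in> E)}"

definition has_triangle_packing :: "'a set \<Rightarrow> 'a set set \<Rightarrow> int \<Rightarrow> bool" where
  "has_triangle_packing V E t \<longleftrightarrow>
     (\<exists>P \<subseteq> triangles V E. pairwise disjnt P \<and> t \<le> int (card P))"

text \<open>
  The time bound depends on the number of vertices and the size of the hub, and the hub is part of
  the input.
\<close>

definition solves_triangle_packing_hub ::
    "nat \<Rightarrow> nat \<Rightarrow> expr \<Rightarrow> (nat \<Rightarrow> nat \<Rightarrow> real) \<Rightarrow> bool" where
  "solves_triangle_packing_hub \<sigma> \<delta> A T \<longleftrightarrow>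
     (\<forall>n E t Q Es Qs. simple_graph {..<n} E \<longrightarrow> hub \<sigma> \<delta> {..<n} E Q \<longrightarrow>
        lists_family Es E \<longrightarrow> lists_set Qs Q \<longrightarrow>
        decides_within A (enc_list [enc_nat n, enc_natss Es, enc_int t, enc_nats Qs])
          (has_triangle_packing {..<n} E t) (T n (card Q)))"

end

theory Submission
  imports Defs "HOL-Library.Disjoint_Sets"
begin

text \<open>
  Group the triangles into classes by the component of the graph without the hub that they meet; the
  triangles inside of the hub form further classes.  Different classes share hub vertices only, and
  the triangles of a class meet the hub inside of a key of at most \<open>\<mu> = \<delta> + 3\<close> vertices.  A packing
  uses hub vertices in at most \<open>p\<close> classes, the active ones, so for every \<open>h\<close> the set \<open>H\<close> of hub
  vertices in more than \<open>\<mu> h\<close> keys of active classes has at most \<open>p / h\<close> elements and can be guessed.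

  Classes with a key inside of \<open>H\<close> are solved by dynamic programming over the subsets of \<open>H\<close>.  Every
  other class is put into a bucket according to the position in the hub of the first vertex of its key
  outside of \<open>H\<close>, with \<open>g\<close> consecutive positions sharing a bucket.  A bucket has at most \<open>g \<mu> h\<close> active
  classes, hence its triangles use a bounded number of hub vertices.  Now guess, for each bucket, how
  many hub vertices it receives and how many triangles it gains from them.  It remains to split the
  remaining hub vertices into one suitable block per bucket, which is Set Cover with blocks of bounded
  size once a pair of tokens per bucket forces a cover within the budget to use one block of each
  bucket.  With \<open>h\<close> and then \<open>g\<close> large enough, the guesses and the tokens cost a factor of \<open>\<rho>\<^sup>p\<close> with
  \<open>\<rho>\<close> arbitrarily close to 1.
\<close>

section \<open>Evaluation within a time bound\<close>

definition runs :: "val list \<Rightarrow> expr \<Rightarrow> val \<Rightarrow> nat \<Rightarrow> bool" where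
  "runs env e v T \<longleftrightarrow> (\<exists>k\<le>T. eval env e v k)"

lemma runs_mono: "runs env e v T \<Longrightarrow> T \<le> T' \<Longrightarrow> runs env e v T'"
  unfolding runs_def using le_trans by blast

lemma runs_Var: "i < length env \<Longrightarrow> env ! i = v \<Longrightarrow> runs env (Var i) v 1"
  unfolding runs_def using eval_Var by blast

lemma runs_Var_0: "runs (x # env) (Var 0) x 1"
  and runs_Var_1: "runs (x # y # env) (Var (Suc 0)) y 1"
  and runs_Var_2: "runs (x # y # z # env) (Var 2) z 1"
  by (rule runs_Var; simp)+

lemma runs_Empty: "runs env Empty VEmpty 1"
  unfolding runs_def using eval_Empty by blast

lemma runs_Cell:
  assumes "runs env e1 v1 T1" "runs env e2 v2 T2"
  shows "runs env (Cell e1 e2) (VCell v1 v2) (T1 + T2 + 1)"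
proof -
  obtain k1 k2 where "k1 \<le> T1" "eval env e1 v1 k1" "k2 \<le> T2" "eval env e2 v2 k2"
    using assms unfolding runs_def by blast
  then show ?thesis
    unfolding runs_def using eval_Cell[of env e1 v1 k1 e2 v2 k2]
    by (intro exI[of _ "k1 + k2 + 1"]) auto
qed

lemma runs_App:
  assumes "runs env e1 (VClos env' b) T1" "runs env e2 u T2" "runs (u # VClos env' b # env') b v T3"
  shows "runs env (App e1 e2) v (T1 + T2 + T3 + 1)"
proof -
  obtain k1 k2 k3 where "k1 \<le> T1" "eval env e1 (VClos env' b) k1" "k2 \<le> T2" "eval env e2 u k2"
    "k3 \<le> T3" "eval (u # VClos env' b # env') b v k3"
    using assms unfolding runs_def by blast
  then show ?thesis
    unfolding runs_def using eval_App[of env e1 env' b k1 e2 u k2 v k3]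
    by (intro exI[of _ "k1 + k2 + k3 + 1"]) auto
qed

lemma runs_let:
  assumes "runs env a u T1" "runs (u # VClos env b # env) b v T2"
  shows "runs env (App (Fun b) a) v (T1 + T2 + 2)"
proof -
  have "runs env (Fun b) (VClos env b) 1"
    unfolding runs_def using eval_Fun by blast
  from runs_App[OF this assms] show ?thesis by (rule runs_mono) simp
qed

lemma runs_Case_Empty:
  assumes "runs env e VEmpty T1" "runs env e1 v T2"
  shows "runs env (Case e e1 e2) v (T1 + T2 + 1)"
proof -
  obtain k1 k2 where "k1 \<le> T1" "eval env e VEmpty k1" "k2 \<le> T2" "eval env e1 v k2"
    using assms unfolding runs_def by blast
  then show ?thesis
    unfolding runs_def using eval_Case_Empty[of env e k1 e1 v k2 e2]
    by (intro exI[of _ "k1 + k2 + 1"]) auto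
qed

lemma runs_Case_Cell:
  assumes "runs env e (VCell x y) T1" "runs (x # y # env) e2 v T2"
  shows "runs env (Case e e1 e2) v (T1 + T2 + 1)"
proof -
  obtain k1 k2 where "k1 \<le> T1" "eval env e (VCell x y) k1" "k2 \<le> T2" "eval (x # y # env) e2 v k2"
    using assms unfolding runs_def by blast
  then show ?thesis
    unfolding runs_def using eval_Case_Cell[of env e x y k1 e2 v k2 e1]
    by (intro exI[of _ "k1 + k2 + 1"]) auto
qed

text \<open>
  A program given for a one-element environment also runs when further entries follow, although the
  closures it builds then capture longer environments.
\<close>

inductive extends :: "val \<Rightarrow> val \<Rightarrow> bool" where
  extends_Empty: "extends VEmpty VEmpty"
| extends_Cell: "extends a a' \<Longrightarrow> extends b b' \<Longrightarrow> extends (VCell a b) (VCell a' b')"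
| extends_Clos: "length env \<le> length env' \<Longrightarrow> (\<forall>i<length env. extends (env ! i) (env' ! i))
    \<Longrightarrow> extends (VClos env e) (VClos env' e)"

inductive_cases extends_EmptyE: "extends VEmpty v"
inductive_cases extends_CellE: "extends (VCell a b) v"
inductive_cases extends_ClosE: "extends (VClos env e) v"

lemma eval_extends:
  "eval env e v k \<Longrightarrow> length env \<le> length env' \<Longrightarrow> \<forall>i<length env. extends (env ! i) (env' ! i)
    \<Longrightarrow> \<exists>v'. eval env' e v' k \<and> extends v v'"
proof (induction arbitrary: env' rule: eval.induct)
  case (eval_Var i env)
  then show ?case using eval.eval_Var[of i env'] by auto
next
  case (eval_Fun env e)
  then show ?case using eval.eval_Fun[of env' e] extends_Clos by blast
next
  case (eval_App env e1 env0 e k1 e2 u k2 v k3)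
  obtain f where f: "eval env' e1 f k1" "extends (VClos env0 e) f"
    using eval_App.IH(1)[OF eval_App.prems] by blast
  obtain env1 where f1: "f = VClos env1 e" "length env0 \<le> length env1"
      "\<forall>i<length env0. extends (env0 ! i) (env1 ! i)"
    using f(2) by (auto elim: extends_ClosE)
  obtain u' where u: "eval env' e2 u' k2" "extends u u'"
    using eval_App.IH(2)[OF eval_App.prems] by blast
  have "\<exists>v'. eval (u' # f # env1) e v' k3 \<and> extends v v'"
    using eval_App.IH(3)[of "u' # f # env1"] f u f1 by (auto simp: nth_Cons split: nat.splits)
  then show ?case using f u f1 eval.eval_App by blast
next
  case (eval_Empty env)
  then show ?case using eval.eval_Empty extends_Empty by blast
next
  case (eval_Cell env e1 v1 k1 e2 v2 k2)
  then show ?case by (meson eval.eval_Cell extends_Cell)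
next
  case (eval_Case_Empty env e k1 e1 v k2 e2)
  then show ?case by (metis eval.eval_Case_Empty extends_EmptyE)
next
  case (eval_Case_Cell env e x y k1 e2 v k2 e1)
  obtain x' y' where f: "eval env' e (VCell x' y') k1" "extends x x'" "extends y y'"
    using eval_Case_Cell.IH(1)[OF eval_Case_Cell.prems] by (auto elim: extends_CellE)
  have "\<exists>v'. eval (x' # y' # env') e2 v' k2 \<and> extends v v'"
    using eval_Case_Cell.IH(2)[of "x' # y' # env'"] f eval_Case_Cell.prems
    by (auto simp: nth_Cons split: nat.splits)
  then show ?case using f eval.eval_Case_Cell by blast
qed

primrec is_data :: "val \<Rightarrow> bool" where
  "is_data VEmpty \<longleftrightarrow> True"
| "is_data (VCell a b) \<longleftrightarrow> is_data a \<and> is_data b"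
| "is_data (VClos env e) \<longleftrightarrow> False"

lemma extends_data: "extends v v' \<Longrightarrow> is_data v \<Longrightarrow> v' = v"
  by (induction rule: extends.induct) auto

lemma extends_refl_data: "is_data v \<Longrightarrow> extends v v"
  by (induction v) (auto intro: extends.intros)

lemma eval_weaken:
  assumes "eval [x] e v k" "is_data x" "is_data v"
  shows "eval (x # env) e v k"
  using eval_extends[OF assms(1), of "x # env"] assms extends_data extends_refl_data by fastforce

section \<open>Encodable types\<close>

text \<open>Sizes are at least 2, so that powers of the size dominate all constants.\<close>

primrec val_size :: "val \<Rightarrow> nat" where
  "val_size VEmpty = 2"
| "val_size (VCell a b) = val_size a + val_size b"
| "val_size (VClos env e) = 2"

lemma val_size_ge_2: "2 \<le> val_size v"
  by (induction v) auto

class encodable =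
  fixes enc :: "'a \<Rightarrow> val"
  assumes enc_inj: "enc x = enc y \<Longrightarrow> x = y"
    and enc_data: "is_data (enc x)"

definition enc_size :: "'a::encodable \<Rightarrow> nat" where
  "enc_size x = val_size (enc x)"

lemma enc_size_ge_2: "2 \<le> enc_size x"
  unfolding enc_size_def by (rule val_size_ge_2)

lemma enc_eq_iff: "enc x = enc y \<longleftrightarrow> x = y"
  using enc_inj by blast

instantiation unit :: encodable
begin
definition enc_unit :: "unit \<Rightarrow> val" where "enc_unit u = VEmpty"
instance by standard (auto simp: enc_unit_def)
end

instantiation bool :: encodable
begin
definition enc_bool_conv : "enc (b::bool) = enc_bool b"
instance by standard (auto simp: enc_bool_conv enc_bool_def split: if_splits)
end

instantiation prod :: (encodable, encodable) encodable
begin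
definition enc_prod_conv: "enc p = VCell (enc (fst p)) (enc (snd p))"
instance by standard (auto simp: enc_prod_conv enc_eq_iff enc_data prod_eq_iff)
end

lemma enc_list_inj:
  "(\<And>x y. f x = f y \<Longrightarrow> x = y) \<Longrightarrow> enc_list (map f xs) = enc_list (map f ys) \<Longrightarrow> xs = ys"
proof (induction xs arbitrary: ys)
  case Nil
  then show ?case by (cases ys) auto
next
  case (Cons x xs ys)
  obtain y zs where ys: "ys = y # zs" using Cons.prems(2) by (cases ys) auto
  have "f x = f y" "enc_list (map f xs) = enc_list (map f zs)" using Cons.prems(2)
    unfolding ys by simp_all
  then show ?case using Cons.prems(1) Cons.IH[OF Cons.prems(1)] ys by blast
qed

instantiation list :: (encodable) encodable
begin
definition enc_list_conv: "enc xs = enc_list (map enc xs)"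
instance
proof
  fix xs ys :: "'a list"
  show "enc xs = enc ys \<Longrightarrow> xs = ys"
    unfolding enc_list_conv by (rule enc_list_inj[OF enc_inj])
  show "is_data (enc xs)"
    unfolding enc_list_conv by (induction xs) (auto simp: enc_data)
qed
end

lemma enc_nat_eq: "enc_nat n = enc (replicate n ())"
  unfolding enc_nat_def enc_list_conv by (simp add: enc_unit_def)

instantiation nat :: encodable
begin
definition enc_nat_conv: "enc (n::nat) = enc_nat n"
instance
proof
  fix m n :: nat
  show "enc m = enc n \<Longrightarrow> m = n"
    unfolding enc_nat_conv enc_nat_eq enc_eq_iff by (metis length_replicate)
  show "is_data (enc n)" unfolding enc_nat_conv enc_nat_eq by (rule enc_data)
qed
end

lemma enc_Nil: "enc [] = VEmpty" and enc_Cons: "enc (x # xs) = VCell (enc x) (enc xs)"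
  by (auto simp: enc_list_conv)

lemma enc_Pair: "enc (a, b) = VCell (enc a) (enc b)"
  by (simp add: enc_prod_conv)

lemma enc_0: "enc (0::nat) = VEmpty" and enc_Suc: "enc (Suc n) = VCell VEmpty (enc n)"
  by (auto simp: enc_nat_conv enc_nat_def)

lemma enc_True: "enc True = VCell VEmpty VEmpty" and enc_False: "enc False = VEmpty"
  by (auto simp: enc_bool_conv enc_bool_def)

lemma enc_replicate_unit: "enc (replicate n ()) = enc n"
  by (simp add: enc_nat_conv enc_nat_eq)

lemma enc_size_Nil[simp]: "enc_size [] = 2"
  and enc_size_Cons[simp]: "enc_size (x # xs) = enc_size x + enc_size xs"
  and enc_size_Pair[simp]: "enc_size (a, b) = enc_size a + enc_size b"
  and enc_size_unit[simp]: "enc_size () = 2"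
  and enc_size_nat[simp]: "enc_size (n::nat) = 2 * n + 2"
  and enc_size_True[simp]: "enc_size True = 4" and enc_size_False[simp]: "enc_size False = 2"
proof -
  show "enc_size n = 2 * n + 2" by (induction n) (auto simp: enc_size_def enc_0 enc_Suc)
qed (auto simp: enc_size_def enc_Nil enc_Cons enc_Pair enc_unit_def enc_True enc_False)

lemma enc_size_prod: "enc_size p = enc_size (fst p) + enc_size (snd p)"
  by (cases p) simp

lemma enc_size_bool_le: "enc_size (b::bool) \<le> 4"
  by (cases b) auto

lemma enc_size_append: "enc_size (xs @ ys) + 2 = enc_size xs + enc_size ys"
  by (induction xs) auto

lemma enc_size_list: "enc_size xs = 2 + (\<Sum>x\<leftarrow>xs. enc_size x)"
  by (induction xs) auto

lemma enc_size_member: "x \<in> set xs \<Longrightarrow> enc_size x + 2 \<le> enc_size xs"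
  by (induction xs) (auto simp: enc_size_ge_2 le_SucI
    intro: le_trans[OF _ add_le_mono[OF enc_size_ge_2 order_refl]])

lemma length_le_enc_size: "2 * length xs + 2 \<le> enc_size xs"
proof (induction xs)
  case (Cons a xs)
  then show ?case using enc_size_ge_2[of a] by simp
qed simp

lemma enc_size_list_le: "(\<And>x. x \<in> set xs \<Longrightarrow> enc_size x \<le> B) \<Longrightarrow> enc_size xs \<le> 2 + length xs * B"
proof (induction xs)
  case (Cons a xs)
  then show ?case using Cons.prems[of a] by fastforce
qed simp

section \<open>Computable functions and their running time\<close>

definition computes :: "'a::encodable set \<Rightarrow> ('a \<Rightarrow> 'b::encodable) \<Rightarrow> ('a \<Rightarrow> nat) \<Rightarrow> bool" where
  "computes D f T \<longleftrightarrow> (\<exists>e. \<forall>c\<in>D. \<forall>env. runs (enc c # env) e (enc (f c)) (T c))"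

lemma computes_mono:
  assumes "computes D f T" "D' \<subseteq> D" "\<And>c. c \<in> D' \<Longrightarrow> T c \<le> T' c" "\<And>c. c \<in> D' \<Longrightarrow> f' c = f c"
  shows "computes D' f' T'"
  using assms unfolding computes_def by (metis in_mono runs_mono)

lemma computes_recode:
  assumes "computes D f T" "\<And>c. c \<in> D \<Longrightarrow> enc (f' c) = enc (f c)"
  shows "computes D f' T"
  using assms unfolding computes_def by auto

lemma computes_id: "computes D (\<lambda>c. c) (\<lambda>_. 1)"
  unfolding computes_def using runs_Var_0 by blast

lemma runs_literal: "is_data v \<Longrightarrow> \<exists>e. \<forall>env. runs env e v (val_size v - 1)"
proof (induction v)
  case VEmpty
  then show ?case using runs_Empty by auto
next
  case (VCell a b)
  then obtain e1 e2 where "\<And>env. runs env e1 a (val_size a - 1)" "\<And>env. runs env e2 b (val_size b - 1)"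
    by auto
  then have "runs env (Cell e1 e2) (VCell a b) (val_size (VCell a b) - 1)" for env
    using runs_mono[OF runs_Cell, of env e1 a "val_size a - 1" e2 b "val_size b - 1"
      "val_size (VCell a b) - 1"]
      val_size_ge_2[of a] val_size_ge_2[of b] by auto
  then show ?case by blast
qed auto

lemma computes_const: "computes D (\<lambda>_. k) (\<lambda>_. enc_size k)"
  using runs_literal[OF enc_data[of k]] unfolding computes_def enc_size_def
  by (meson diff_le_self runs_mono)

lemma computes_comp:
  assumes "computes D f Tf" "computes D' g Tg" "\<And>c. c \<in> D \<Longrightarrow> f c \<in> D'"
  shows "computes D (\<lambda>c. g (f c)) (\<lambda>c. Tf c + Tg (f c) + 2)"
proof -
  obtain e1 e2 where e1: "\<And>c env. c \<in> D \<Longrightarrow> runs (enc c # env) e1 (enc (f c)) (Tf c)"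
    and e2: "\<And>c env. c \<in> D' \<Longrightarrow> runs (enc c # env) e2 (enc (g c)) (Tg c)"
    using assms unfolding computes_def by blast
  have "\<forall>c\<in>D. \<forall>env. runs (enc c # env) (App (Fun e2) e1) (enc (g (f c))) (Tf c + Tg (f c) + 2)"
    using runs_let[OF e1 e2] assms(3) by blast
  then show ?thesis unfolding computes_def by blast
qed

lemma computes_Pair:
  assumes "computes D f Tf" "computes D g Tg"
  shows "computes D (\<lambda>c. (f c, g c)) (\<lambda>c. Tf c + Tg c + 1)"
proof -
  obtain e1 e2 where e1: "\<And>c env. c \<in> D \<Longrightarrow> runs (enc c # env) e1 (enc (f c)) (Tf c)"
    and e2: "\<And>c env. c \<in> D \<Longrightarrow> runs (enc c # env) e2 (enc (g c)) (Tg c)"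
    using assms unfolding computes_def by blast
  have "\<forall>c\<in>D. \<forall>env. runs (enc c # env) (Cell e1 e2) (enc (f c, g c)) (Tf c + Tg c + 1)"
    unfolding enc_Pair using runs_Cell[OF e1 e2] by blast
  then show ?thesis unfolding computes_def by blast
qed

lemma computes_fst: "computes UNIV fst (\<lambda>_. 3)"
  unfolding computes_def
  by (auto intro!: exI[of _ "Case (Var 0) Empty (Var 0)"] runs_mono[OF runs_Case_Cell] runs_Var_0
    simp: enc_prod_conv)

lemma computes_snd: "computes UNIV snd (\<lambda>_. 3)"
  unfolding computes_def
  by (auto intro!: exI[of _ "Case (Var 0) Empty (Var (Suc 0))"] runs_mono[OF runs_Case_Cell]
    runs_Var_0 runs_Var_1
      simp: enc_prod_conv)

lemma computes_tl: "computes UNIV tl (\<lambda>_. 3)"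
proof -
  have "runs (enc c # env) (Case (Var 0) Empty (Var (Suc 0))) (enc (tl c)) 3"
      for c :: "'a::encodable list" and env
  proof (cases c)
    case Nil
    then show ?thesis
      using runs_Case_Empty[OF runs_Var_0 runs_Empty, of env "Var (Suc 0)"]
      by (simp add: numeral_eq_Suc enc_Nil)
  next
    case (Cons x xs)
    then show ?thesis
      using runs_Case_Cell[OF runs_Var_0 runs_Var_1, of "enc x" "enc xs" env Empty]
      by (simp add: numeral_eq_Suc enc_Cons)
  qed
  then show ?thesis unfolding computes_def by blast
qed

lemma computes_null: "computes UNIV (\<lambda>xs. xs = []) (\<lambda>_. 5)"
proof -
  have "runs (enc c # env) (Case (Var 0) (Cell Empty Empty) Empty) (enc (c = [])) 5"
      for c :: "'a::encodable list" and env
  proof (cases c)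
    case Nil
    then show ?thesis
      using runs_Case_Empty[OF runs_Var_0 runs_Cell[OF runs_Empty runs_Empty], of env Empty]
      by (simp add: numeral_eq_Suc enc_Nil enc_True)
  next
    case (Cons x xs)
    then show ?thesis
      using runs_mono[OF runs_Case_Cell[OF runs_Var_0 runs_Empty, of "enc x" "enc xs" env
        "Cell Empty Empty"], of 5]
      by (simp add: numeral_eq_Suc enc_Cons enc_False)
  qed
  then show ?thesis unfolding computes_def by blast
qed

lemma computes_if:
  assumes "computes D b Tb" "computes {c\<in>D. b c} f Tf" "computes {c\<in>D. \<not> b c} g Tg"
  shows "computes D (\<lambda>c. if b c then f c else g c) (\<lambda>c. Tb c + (if b c then Tf c else Tg c) + 5)"
proof -
  obtain e1 e2 e3 where e1: "\<And>c env. c \<in> D \<Longrightarrow> runs (enc c # env) e1 (enc (b c)) (Tb c)"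
    and e2: "\<And>c env. c \<in> D \<Longrightarrow> b c \<Longrightarrow> runs (enc c # env) e2 (enc (f c)) (Tf c)"
    and e3: "\<And>c env. c \<in> D \<Longrightarrow> \<not> b c \<Longrightarrow> runs (enc c # env) e3 (enc (g c)) (Tg c)"
    using assms unfolding computes_def by (metis (mono_tags, lifting) mem_Collect_eq)
  have "runs (enc c # env) (Case e1 e3 (App (Fun e2) (Var 2))) (enc (if b c then f c else g c))
      (Tb c + (if b c then Tf c else Tg c) + 5)" if "c \<in> D" for c env
  proof (cases "b c")
    case True
    then have "runs (enc c # env) e1 (VCell VEmpty VEmpty) (Tb c)" using e1[OF that, of env]
      by (simp add: enc_True)
    from runs_Case_Cell[OF this runs_let[OF runs_Var_2 e2[OF that True]], of e3] show ?thesis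
      using True by (auto elim!: runs_mono)
  next
    case False
    then have "runs (enc c # env) e1 VEmpty (Tb c)" using e1[OF that, of env] by (simp add: enc_False)
    then show ?thesis
      using runs_mono[OF runs_Case_Empty[OF _ e3[OF that False]]] False by fastforce
  qed
  then show ?thesis unfolding computes_def by blast
qed

text \<open>
  The argument of the loop is the pair of the remaining list and the pair of state and context;
  \<open>step\<close> maps \<open>(element, (state, context))\<close> to the next state.
\<close>

definition fold_loop :: "expr \<Rightarrow> expr" where
  "fold_loop step =
    Case (Var 0) Empty
      (Case (Var 0)
         (Case (Var 1) Empty (Var 0))
         (Case (Var 3) Empty
            (App (Var 7) (Cell (Var 3) (Cell (App (Fun step) (Cell (Var 2) (Cell (Var 0) (Var 1))))
                (Var 1))))))"

lemma runs_fold_loop_Empty: "runs (VCell VEmpty (VCell s c) # env) (fold_loop e) s 7"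
  unfolding fold_loop_def
  by (rule runs_mono[OF runs_Case_Cell[OF runs_Var
    runs_Case_Empty[OF runs_Var runs_Case_Cell[OF runs_Var runs_Var]]]])
    simp_all

lemma runs_fold_loop_Cell:
  assumes clo: "clo = VClos env (fold_loop e)"
    and step: "\<And>env'. runs (VCell y (VCell s c) # env') e s' T"
    and rest: "runs (VCell ys (VCell s' c) # clo # env) (fold_loop e) v T'"
  shows "runs (VCell (VCell y ys) (VCell s c) # clo # env) (fold_loop e) v (T + T' + 20)"
proof -
  let ?env = "s # c # y # ys # VCell y ys # VCell s c # VCell (VCell y ys) (VCell s c) # clo # env"
  let ?next = "App (Fun e) (Cell (Var 2) (Cell (Var 0) (Var 1)))"
  have "runs ?env (Cell (Var 2) (Cell (Var 0) (Var 1))) (VCell y (VCell s c)) (1 + (1 + 1 + 1) + 1)"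
    by (intro runs_Cell runs_Var) simp_all
  from runs_let[OF this step] have "runs ?env ?next s' (T + 7)" by (rule runs_mono) simp
  then have arg: "runs ?env (Cell (Var 3) (Cell ?next (Var 1))) (VCell ys (VCell s' c))
      (1 + (T + 7 + 1 + 1) + 1)"
    by (intro runs_Cell runs_Var) simp_all
  have loop: "runs ?env (Var 7) (VClos env (fold_loop e)) 1" by (rule runs_Var) (simp_all add: clo)
  from runs_App[OF loop arg rest[unfolded clo]]
  have recurse: "runs ?env (App (Var 7) (Cell (Var 3) (Cell ?next (Var 1)))) v (T + T' + 13)"
    by (rule runs_mono) simp
  show ?thesis
    unfolding fold_loop_def
    by (rule runs_mono[OF runs_Case_Cell[OF runs_Var
      runs_Case_Cell[OF runs_Var runs_Case_Cell[OF runs_Var recurse]]]])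
      simp_all
qed

lemma runs_fold_loop:
  fixes f :: "'x::encodable \<times> 's::encodable \<times> 'c::encodable \<Rightarrow> 's"
  assumes e: "\<And>p env. p \<in> E \<Longrightarrow> runs (enc p # env) e (enc (f p)) (Tf p)"
    and step: "\<And>ys y zs. xs = ys @ y # zs \<Longrightarrow>
      (y, fold (\<lambda>x s. f (x, s, c)) ys s, c) \<in> E \<and> Tf (y, fold (\<lambda>x s. f (x, s, c)) ys s, c) \<le> b"
  shows "runs (enc (xs, s, c) # VClos env (fold_loop e) # env) (fold_loop e)
    (enc (fold (\<lambda>x s. f (x, s, c)) xs s)) ((length xs + 1) * (b + 20))"
  using step
proof (induction xs arbitrary: s)
  case Nil
  show ?case unfolding enc_Pair enc_Nil fold_Nil id_apply
    by (rule runs_mono[OF runs_fold_loop_Empty]) simp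
next
  case (Cons y ys)
  have y: "(y, s, c) \<in> E" "Tf (y, s, c) \<le> b" using Cons.prems[of "[]"] by auto
  have "runs (enc (ys, f (y, s, c), c) # VClos env (fold_loop e) # env) (fold_loop e)
      (enc (fold (\<lambda>x s. f (x, s, c)) ys (f (y, s, c)))) ((length ys + 1) * (b + 20))"
    by (rule Cons.IH) (use Cons.prems[of "y # _"] in simp)
  from runs_fold_loop_Cell[OF refl e[OF y(1), unfolded enc_Pair] this[unfolded enc_Pair]] show ?case
    unfolding enc_Pair enc_Cons using y(2) by (auto elim!: runs_mono)
qed

lemma computes_fold:
  fixes f :: "'x::encodable \<times> 's::encodable \<times> 'c::encodable \<Rightarrow> 's"
  assumes xs: "computes D xs Tx" and s: "computes D s0 Ts" and f: "computes E f Tf"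
    and step: "\<And>c ys y zs. c \<in> D \<Longrightarrow> xs c = ys @ y # zs \<Longrightarrow>
      (y, fold (\<lambda>x s. f (x, s, c)) ys (s0 c), c) \<in> E \<and>
      Tf (y, fold (\<lambda>x s. f (x, s, c)) ys (s0 c), c) \<le> B c"
  shows "computes D (\<lambda>c. fold (\<lambda>x s. f (x, s, c)) (xs c) (s0 c))
    (\<lambda>c. Tx c + Ts c + (length (xs c) + 1) * (B c + 30))"
proof -
  obtain e1 e2 e3 where e1: "\<And>c env. c \<in> D \<Longrightarrow> runs (enc c # env) e1 (enc (xs c)) (Tx c)"
    and e2: "\<And>c env. c \<in> D \<Longrightarrow> runs (enc c # env) e2 (enc (s0 c)) (Ts c)"
    and e3: "\<And>p env. p \<in> E \<Longrightarrow> runs (enc p # env) e3 (enc (f p)) (Tf p)"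
    using assms(1-3) unfolding computes_def by meson
  have "runs (enc c # env) (App (Fun (fold_loop e3)) (Cell e1 (Cell e2 (Var 0))))
      (enc (fold (\<lambda>x s. f (x, s, c)) (xs c) (s0 c))) (Tx c + Ts c + (length (xs c) + 1) * (B c + 30))"
    if c: "c \<in> D" for c env
  proof -
    have "runs (enc c # env) (Cell e1 (Cell e2 (Var 0))) (enc (xs c, s0 c, c))
        (Tx c + (Ts c + 1 + 1) + 1)"
      unfolding enc_Pair by (intro runs_Cell e1 e2 c runs_Var_0)
    moreover have "runs (enc (xs c, s0 c, c) # VClos (enc c # env) (fold_loop e3) # enc c # env)
        (fold_loop e3)
        (enc (fold (\<lambda>x s. f (x, s, c)) (xs c) (s0 c))) ((length (xs c) + 1) * (B c + 20))"
      using e3 step[OF c] by (intro runs_fold_loop)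
    ultimately show ?thesis by (rule runs_mono[OF runs_let]) (simp add: algebra_simps)
  qed
  then show ?thesis unfolding computes_def by blast
qed

definition equality_loop :: expr where
  "equality_loop =
    Case (Var 0) Empty
      (Case (Var 0)
         (Case (Var 1) (Cell Empty Empty) Empty)
         (Case (Var 3) Empty
            (Case (App (Var 7) (Cell (Var 2) (Var 0))) Empty (App (Var 9) (Cell (Var 5) (Var 3))))))"

lemma runs_equality_loop_Empty:
  assumes "is_data v"
  shows "runs (VCell VEmpty v # env) equality_loop (enc (VEmpty = v)) 9"
proof -
  let ?env = "VEmpty # v # VCell VEmpty v # env"
  have "runs ?env (Case (Var 1) (Cell Empty Empty) Empty) (enc (VEmpty = v)) 5"
  proof (cases v)
    case VEmpty
    have "runs ?env (Cell Empty Empty) (enc True) (1 + 1 + 1)"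
      unfolding enc_True by (intro runs_Cell runs_Empty)
    from runs_mono[OF runs_Case_Empty[OF runs_Var this]] VEmpty show ?thesis by simp
  next
    case (VCell a b)
    from runs_mono[OF runs_Case_Cell[OF runs_Var runs_Empty]] VCell show ?thesis by (simp add: enc_False)
  qed (use assms in simp)
  from runs_mono[OF runs_Case_Cell[OF runs_Var runs_Case_Empty[OF runs_Var this]]] show ?thesis
    unfolding equality_loop_def by simp
qed

lemma runs_equality_loop_Cell_Empty: "runs (VCell (VCell a b) VEmpty # env) equality_loop (enc False) 9"
  unfolding equality_loop_def enc_False
  by (rule runs_mono[OF runs_Case_Cell[OF runs_Var
    runs_Case_Cell[OF runs_Var runs_Case_Empty[OF runs_Var runs_Empty]]]])
    simp_all

lemma runs_equality_loop_Cell_Cell: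
  assumes clo: "clo = VClos env equality_loop"
    and heads: "runs (VCell a c # clo # env) equality_loop (enc (a = c)) T"
    and tails: "runs (VCell b d # clo # env) equality_loop (enc (b = d)) T'"
  shows "runs (VCell (VCell a b) (VCell c d) # clo # env) equality_loop
      (enc (a = c \<and> b = d)) (T + T' + 20)"
proof -
  let ?env = "c # d # a # b # VCell a b # VCell c d # VCell (VCell a b) (VCell c d) # clo # env"
  let ?heads = "App (Var 7) (Cell (Var 2) (Var 0))" and ?tails = "App (Var 9) (Cell (Var 5) (Var 3))"
  have call: "runs env' (App (Var i) (Cell (Var j) (Var l))) (enc (u = v)) (t + 5)"
    if "i < length env'" "j < length env'" "l < length env'" "env' ! i = clo" "env' ! j = u"
        "env' ! l = v"
      and "runs (VCell u v # clo # env) equality_loop (enc (u = v)) t" for env' i j l u v t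
  proof -
    have "runs env' (Var i) (VClos env equality_loop) 1" using that clo by (intro runs_Var) simp_all
    moreover have "runs env' (Cell (Var j) (Var l)) (VCell u v) (1 + 1 + 1)"
      using that by (intro runs_Cell runs_Var)
    ultimately show ?thesis using runs_mono[OF runs_App[OF _ _ that(7)[unfolded clo]]] by simp
  qed
  have first: "runs ?env ?heads (enc (a = c)) (T + 5)" by (rule call[OF _ _ _ _ _ _ heads]) simp_all
  have "runs ?env (Case ?heads Empty ?tails) (enc (a = c \<and> b = d)) (T + T' + 11)"
  proof (cases "a = c")
    case False
    then have "runs ?env ?heads VEmpty (T + 5)" using first by (simp add: enc_False)
    from runs_mono[OF runs_Case_Empty[OF this runs_Empty]] False show ?thesis by (simp add: enc_False)
  next
    case True
    then have "runs ?env ?heads (VCell VEmpty VEmpty) (T + 5)" using first by (simp add: enc_True)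
    moreover have "runs (VEmpty # VEmpty # ?env) ?tails (enc (b = d)) (T' + 5)"
      by (rule call[OF _ _ _ _ _ _ tails]) simp_all
    ultimately show ?thesis using True runs_mono[OF runs_Case_Cell] by simp
  qed
  from runs_mono[OF runs_Case_Cell[OF runs_Var
      runs_Case_Cell[OF runs_Var runs_Case_Cell[OF runs_Var this]]]]
  show ?thesis unfolding equality_loop_def by simp
qed

lemma runs_equality_loop:
  "is_data u \<Longrightarrow> is_data v \<Longrightarrow>
    runs (VCell u v # VClos env equality_loop # env) equality_loop (enc (u = v)) (20 * val_size u - 20)"
proof (induction u arbitrary: v)
  case VEmpty
  then show ?case using runs_mono[OF runs_equality_loop_Empty] by simp
next
  case (VCell a b)
  note sizes = val_size_ge_2[of a] val_size_ge_2[of b]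
  show ?case
  proof (cases v)
    case VEmpty
    then show ?thesis using runs_mono[OF runs_equality_loop_Cell_Empty] sizes by simp
  next
    case v: (VCell c d)
    have "runs (VCell (VCell a b) v # VClos env equality_loop # env) equality_loop (enc (VCell a b = v))
        ((20 * val_size a - 20) + (20 * val_size b - 20) + 20)"
      using VCell.prems runs_equality_loop_Cell_Cell[OF refl VCell.IH(1)[of c] VCell.IH(2)[of d]]
      unfolding v by simp
    then show ?thesis using sizes by (auto elim!: runs_mono)
  qed (use \<open>is_data v\<close> in simp)
qed simp

lemma computes_eq: "computes UNIV (\<lambda>p. fst p = snd p) (\<lambda>p. 20 * enc_size (fst p))"
  unfolding computes_def
proof (intro exI[of _ "App (Fun equality_loop) (Var 0)"] ballI allI)
  fix p :: "'a \<times> 'a" and env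
  have "runs (enc p # env) (App (Fun equality_loop) (Var 0)) (enc (enc (fst p) = enc (snd p)))
      (1 + (20 * enc_size (fst p) - 20) + 2)"
    unfolding enc_size_def enc_prod_conv
    by (intro runs_let[OF runs_Var_0] runs_equality_loop enc_data)
  then show "runs (enc p # env) (App (Fun equality_loop) (Var 0)) (enc (fst p = snd p))
      (20 * enc_size (fst p))"
    using enc_size_ge_2[of "fst p"] unfolding enc_eq_iff by (auto elim!: runs_mono)
qed

section \<open>Polynomial time\<close>

definition poly_bounded :: "'a::encodable set \<Rightarrow> ('a \<Rightarrow> nat) \<Rightarrow> bool" where
  "poly_bounded D t \<longleftrightarrow> (\<exists>a. \<forall>c\<in>D. t c \<le> enc_size c ^ a)"

lemma enc_size_power_mono: "a \<le> b \<Longrightarrow> enc_size c ^ a \<le> enc_size c ^ b"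
  using enc_size_ge_2[of c] by (intro power_increasing) auto

lemma poly_bounded_mono:
  "poly_bounded D t \<Longrightarrow> D' \<subseteq> D \<Longrightarrow> (\<And>c. c \<in> D' \<Longrightarrow> t' c \<le> t c) \<Longrightarrow> poly_bounded D' t'"
  unfolding poly_bounded_def by (meson in_mono le_trans)

lemma poly_bounded_const: "poly_bounded D (\<lambda>_. k)"
proof -
  have "k \<le> enc_size c ^ k" for c :: 'a
  proof -
    have "k \<le> 2 ^ k" by (simp add: less_imp_le)
    also have "\<dots> \<le> enc_size c ^ k" using enc_size_ge_2[of c] by (intro power_mono) auto
    finally show ?thesis .
  qed
  then show ?thesis unfolding poly_bounded_def by blast
qed

lemma poly_bounded_mult: "poly_bounded D s \<Longrightarrow> poly_bounded D t \<Longrightarrow> poly_bounded D (\<lambda>c. s c * t c)"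
  unfolding poly_bounded_def by (metis mult_le_mono power_add)

lemma poly_bounded_add:
  assumes "poly_bounded D s" "poly_bounded D t"
  shows "poly_bounded D (\<lambda>c. s c + t c)"
proof -
  obtain a b where ab: "\<And>c. c \<in> D \<Longrightarrow> s c \<le> enc_size c ^ a" "\<And>c. c \<in> D \<Longrightarrow> t c \<le> enc_size c ^ b"
    using assms unfolding poly_bounded_def by blast
  have "s c + t c \<le> enc_size c ^ (a + b + 1)" if "c \<in> D" for c
  proof -
    have "s c + t c \<le> enc_size c ^ a + enc_size c ^ b" using ab that add_mono by blast
    also have "\<dots> \<le> enc_size c ^ (a + b) + enc_size c ^ (a + b)"
      by (intro add_mono enc_size_power_mono) auto
    also have "\<dots> \<le> enc_size c * enc_size c ^ (a + b)" using enc_size_ge_2[of c]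
      by (metis mult_2 mult_le_mono1)
    finally show ?thesis by simp
  qed
  then show ?thesis unfolding poly_bounded_def by blast
qed

lemma poly_bounded_power: "poly_bounded D t \<Longrightarrow> poly_bounded D (\<lambda>c. t c ^ k)"
  unfolding poly_bounded_def by (metis power_mono power_mult zero_le)

lemma poly_bounded_enc_size: "poly_bounded D enc_size"
  unfolding poly_bounded_def by (intro exI[of _ 1]) auto

lemma poly_bounded_comp:
  assumes "poly_bounded D' t" "poly_bounded D (\<lambda>c. enc_size (f c))" "\<And>c. c \<in> D \<Longrightarrow> f c \<in> D'"
  shows "poly_bounded D (\<lambda>c. t (f c))"
proof -
  obtain a where a: "\<And>c. c \<in> D' \<Longrightarrow> t c \<le> enc_size c ^ a" using assms unfolding poly_bounded_def by blast
  show ?thesis by (rule poly_bounded_mono[OF poly_bounded_power[OF assms(2), of a]])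
      (use a assms(3) in auto)
qed

lemmas poly_bounded_intros =
  poly_bounded_const poly_bounded_mult poly_bounded_add poly_bounded_power poly_bounded_enc_size

text \<open>
  \<open>computes_ostar\<close> renders running times of the form \<open>O\<^sup>*(W)\<close>, in which polynomial factors are
  suppressed.
\<close>

definition computes_ostar :: "'a::encodable set \<Rightarrow> ('a \<Rightarrow> 'b::encodable) \<Rightarrow> ('a \<Rightarrow> nat) \<Rightarrow> bool" where
  "computes_ostar D f W \<longleftrightarrow> (\<exists>e. computes D f (\<lambda>c. enc_size c ^ e * W c))"

definition polytime_on :: "'a::encodable set \<Rightarrow> ('a \<Rightarrow> 'b::encodable) \<Rightarrow> bool" where
  "polytime_on D f \<longleftrightarrow> computes_ostar D f (\<lambda>_. 1) \<and> poly_bounded D (\<lambda>c. enc_size (f c))"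

lemma computes_ostarI:
  assumes "computes D f T" "poly_bounded D S" "\<And>c. c \<in> D \<Longrightarrow> T c \<le> S c * W c"
  shows "computes_ostar D f W"
proof -
  obtain e where "\<And>c. c \<in> D \<Longrightarrow> S c \<le> enc_size c ^ e" using assms(2) unfolding poly_bounded_def by blast
  then have "T c \<le> enc_size c ^ e * W c" if "c \<in> D" for c
    using assms(3)[OF that] that by (blast intro: le_trans mult_le_mono1)
  then show ?thesis unfolding computes_ostar_def by (intro exI[of _ e] computes_mono[OF assms(1)]) auto
qed

lemma computes_ostar_mono:
  "computes_ostar D f W \<Longrightarrow> D' \<subseteq> D \<Longrightarrow> (\<And>c. c \<in> D' \<Longrightarrow> W c \<le> W' c) \<Longrightarrow> (\<And>c. c \<in> D' \<Longrightarrow> f' c = f c) \<Longrightarrow>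
    computes_ostar D' f' W'"
  unfolding computes_ostar_def by (elim exE, intro exI) (rule computes_mono, auto intro: mult_le_mono2)

lemma polytime_onI:
  "computes D f T \<Longrightarrow> poly_bounded D T \<Longrightarrow> poly_bounded D (\<lambda>c. enc_size (f c)) \<Longrightarrow> polytime_on D f"
  unfolding polytime_on_def using computes_ostarI[of D f T T] by simp

lemma polytime_onE:
  assumes "polytime_on D f"
  obtains T where "computes D f T" "poly_bounded D T" "poly_bounded D (\<lambda>c. enc_size (f c))"
  using assms poly_bounded_power[OF poly_bounded_enc_size] unfolding polytime_on_def computes_ostar_def
  by auto

lemma polytime_enc_size: "polytime_on D f \<Longrightarrow> poly_bounded D (\<lambda>c. enc_size (f c))"
  unfolding polytime_on_def by blast

lemma polytime_nat_bounded: "polytime_on D f \<Longrightarrow> poly_bounded D f" for f :: "'a::encodable \<Rightarrow> nat"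
  by (drule polytime_enc_size, erule poly_bounded_mono) auto

lemma polytime_cong: "polytime_on D f \<Longrightarrow> (\<And>c. c \<in> D \<Longrightarrow> f' c = f c) \<Longrightarrow> polytime_on D f'"
  by (elim polytime_onE, rule polytime_onI) (auto elim: poly_bounded_mono computes_mono)

lemma polytime_recode:
  assumes "polytime_on D f" "\<And>c. c \<in> D \<Longrightarrow> enc (f' c) = enc (f c)"
  shows "polytime_on D f'"
  using assms
  by (elim polytime_onE, intro polytime_onI)
    (auto elim: poly_bounded_mono computes_recode simp: enc_size_def)

named_theorems polytime

lemma polytime_id[polytime]: "polytime_on D (\<lambda>c. c)"
  by (rule polytime_onI[OF computes_id]) (intro poly_bounded_intros)+

lemma polytime_const[polytime]: "polytime_on D (\<lambda>_. k)"
  by (rule polytime_onI[OF computes_const]) (intro poly_bounded_intros)+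

lemma polytime_comp:
  assumes "polytime_on D' g" "polytime_on D f" "\<And>c. c \<in> D \<Longrightarrow> f c \<in> D'"
  shows "polytime_on D (\<lambda>c. g (f c))"
proof -
  obtain Tg where g: "computes D' g Tg" "poly_bounded D' Tg" "poly_bounded D' (\<lambda>c. enc_size (g c))"
    using assms(1) by (rule polytime_onE)
  obtain Tf where f: "computes D f Tf" "poly_bounded D Tf" "poly_bounded D (\<lambda>c. enc_size (f c))"
    using assms(2) by (rule polytime_onE)
  show ?thesis
  proof (rule polytime_onI)
    show "computes D (\<lambda>c. g (f c)) (\<lambda>c. Tf c + Tg (f c) + 2)"
      by (rule computes_comp[OF f(1) g(1) assms(3)])
    show "poly_bounded D (\<lambda>c. Tf c + Tg (f c) + 2)"
      by (intro poly_bounded_intros f poly_bounded_comp[OF g(2) f(3) assms(3)])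
    show "poly_bounded D (\<lambda>c. enc_size (g (f c)))" by (rule poly_bounded_comp[OF g(3) f(3) assms(3)])
  qed
qed

lemma polytime_comp_UNIV: "polytime_on UNIV g \<Longrightarrow> polytime_on D f \<Longrightarrow> polytime_on D (\<lambda>c. g (f c))"
  by (rule polytime_comp) auto

lemma polytime_Pair[polytime]: "polytime_on D f \<Longrightarrow> polytime_on D g \<Longrightarrow> polytime_on D (\<lambda>c. (f c, g c))"
  by (elim polytime_onE, rule polytime_onI[OF computes_Pair], assumption, assumption)
    (unfold enc_size_Pair, (intro poly_bounded_intros; assumption)+)

lemma polytime_comp2:
  assumes "polytime_on UNIV (\<lambda>p. g (fst p) (snd p))" "polytime_on D f1" "polytime_on D f2"
  shows "polytime_on D (\<lambda>c. g (f1 c) (f2 c))"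
  using polytime_comp_UNIV[OF assms(1) polytime_Pair[OF assms(2,3)]] by simp

lemma polytime_comp3:
  assumes "polytime_on UNIV (\<lambda>p. g (fst p) (fst (snd p)) (snd (snd p)))"
    "polytime_on D f1" "polytime_on D f2" "polytime_on D f3"
  shows "polytime_on D (\<lambda>c. g (f1 c) (f2 c) (f3 c))"
  using polytime_comp_UNIV[OF assms(1) polytime_Pair[OF assms(2) polytime_Pair[OF assms(3,4)]]] by simp

lemma polytime_comp4:
  assumes "polytime_on UNIV (\<lambda>p. g (fst p) (fst (snd p)) (fst (snd (snd p))) (snd (snd (snd p))))"
    "polytime_on D f1" "polytime_on D f2" "polytime_on D f3" "polytime_on D f4"
  shows "polytime_on D (\<lambda>c. g (f1 c) (f2 c) (f3 c) (f4 c))"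
  using polytime_comp_UNIV[OF assms(1)
    polytime_Pair[OF assms(2) polytime_Pair[OF assms(3) polytime_Pair[OF assms(4,5)]]]]
  by simp

lemma enc_size_tl: "enc_size (tl xs) \<le> enc_size xs"
  by (cases xs) auto

lemma polytime_fst[polytime]: "polytime_on D f \<Longrightarrow> polytime_on D (\<lambda>c. fst (f c))"
  by (rule polytime_comp_UNIV[of fst], rule polytime_onI[OF computes_fst])
    (auto intro: poly_bounded_intros poly_bounded_mono[OF poly_bounded_enc_size] simp: enc_size_prod)

lemma polytime_snd[polytime]: "polytime_on D f \<Longrightarrow> polytime_on D (\<lambda>c. snd (f c))"
  by (rule polytime_comp_UNIV[of snd], rule polytime_onI[OF computes_snd])
    (auto intro: poly_bounded_intros poly_bounded_mono[OF poly_bounded_enc_size] simp: enc_size_prod)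

text \<open>The body of an iteration sees the pair of the current element and the context.\<close>

lemma polytime_in_context: "polytime_on D f \<Longrightarrow> polytime_on {p. snd p \<in> D \<and> P p} (\<lambda>p. f (snd p))"
  by (rule polytime_comp[OF _ polytime_snd[OF polytime_id]]) auto

lemma polytime_tl[polytime]: "polytime_on D f \<Longrightarrow> polytime_on D (\<lambda>c. tl (f c))"
  by (rule polytime_comp_UNIV[of tl], rule polytime_onI[OF computes_tl])
    (auto intro: poly_bounded_intros poly_bounded_mono[OF poly_bounded_enc_size] simp: enc_size_tl)

lemma poly_bounded_enc_size_bool: "poly_bounded D (\<lambda>c. enc_size (b c :: bool))"
  by (rule poly_bounded_mono[OF poly_bounded_const[where k = 4]]) (auto simp: enc_size_bool_le)

lemma polytime_null[polytime]: "polytime_on D f \<Longrightarrow> polytime_on D (\<lambda>c. f c = [])"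
  by (rule polytime_comp_UNIV[of "\<lambda>xs. xs = []"], rule polytime_onI[OF computes_null])
    (intro poly_bounded_intros poly_bounded_enc_size_bool)+

lemma polytime_eq[polytime]:
  assumes "polytime_on D f" "polytime_on D g"
  shows "polytime_on D (\<lambda>c. f c = g c)"
proof (rule polytime_comp2[OF _ assms])
  show "polytime_on UNIV (\<lambda>p. fst p = (snd p :: 'b))"
    by (rule polytime_onI[OF computes_eq])
      (intro poly_bounded_intros poly_bounded_enc_size_bool polytime_enc_size polytime)+
qed

lemma computes_ostar_if:
  assumes b: "polytime_on D b" and f: "computes_ostar {c\<in>D. b c} f W"
    and g: "computes_ostar {c\<in>D. \<not> b c} g W"
    and W: "\<And>c. c \<in> D \<Longrightarrow> 1 \<le> W c"
  shows "computes_ostar D (\<lambda>c. if b c then f c else g c) W"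
proof -
  obtain Tb where Tb: "computes D b Tb" "poly_bounded D Tb" using b by (rule polytime_onE)
  obtain d e where Tf: "computes {c\<in>D. b c} f (\<lambda>c. enc_size c ^ d * W c)"
    and Tg: "computes {c\<in>D. \<not> b c} g (\<lambda>c. enc_size c ^ e * W c)"
    using f g unfolding computes_ostar_def by blast
  show ?thesis
  proof (rule computes_ostarI[OF computes_if[OF Tb(1) Tf Tg]])
    show "poly_bounded D (\<lambda>c. Tb c + 5 + enc_size c ^ d + enc_size c ^ e)"
      by (intro poly_bounded_intros Tb)
    fix c assume "c \<in> D"
    then have "Tb c + 5 \<le> (Tb c + 5) * W c" using W by simp
    then show "Tb c + (if b c then enc_size c ^ d * W c else enc_size c ^ e * W c) + 5
        \<le> (Tb c + 5 + enc_size c ^ d + enc_size c ^ e) * W c"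
      by (simp add: algebra_simps)
  qed
qed

lemma polytime_if[polytime]:
  assumes "polytime_on D b" "polytime_on D f" "polytime_on D g"
  shows "polytime_on D (\<lambda>c. if b c then f c else g c)"
  unfolding polytime_on_def
proof
  show "computes_ostar D (\<lambda>c. if b c then f c else g c) (\<lambda>_. 1)"
    using assms unfolding polytime_on_def
    by (intro computes_ostar_if[OF assms(1)]) (auto elim: computes_ostar_mono)
  show "poly_bounded D (\<lambda>c. enc_size (if b c then f c else g c))"
    by (rule poly_bounded_mono[OF poly_bounded_add[OF polytime_enc_size[OF assms(2)]
      polytime_enc_size[OF assms(3)]]])
      auto
qed

lemma polytime_Cons[polytime]: "polytime_on D f \<Longrightarrow> polytime_on D g \<Longrightarrow> polytime_on D (\<lambda>c. f c # g c)"
  by (rule polytime_recode[of D "\<lambda>c. (f c, g c)"]) (auto intro: polytime simp: enc_Cons enc_Pair)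

lemma polytime_not[polytime]: "polytime_on D b \<Longrightarrow> polytime_on D (\<lambda>c. \<not> b c)"
  by (rule polytime_cong[of D "\<lambda>c. if b c then False else True"], intro polytime) auto

lemma polytime_conj[polytime]: "polytime_on D b \<Longrightarrow> polytime_on D b' \<Longrightarrow> polytime_on D (\<lambda>c. b c \<and> b' c)"
  by (rule polytime_cong[of D "\<lambda>c. if b c then b' c else False"], intro polytime) auto

lemma polytime_disj[polytime]: "polytime_on D b \<Longrightarrow> polytime_on D b' \<Longrightarrow> polytime_on D (\<lambda>c. b c \<or> b' c)"
  by (rule polytime_cong[of D "\<lambda>c. if b c then True else b' c"], intro polytime) auto

lemma polytime_Suc[polytime]: "polytime_on D f \<Longrightarrow> polytime_on D (\<lambda>c. Suc (f c))"
  by (rule polytime_recode[of D "\<lambda>c. ((), f c)"])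
    (auto intro: polytime simp: enc_Suc enc_Pair enc_unit_def)

lemma computes_ostar_comp:
  assumes f: "polytime_on D f" and g: "computes_ostar D' g W" and D: "\<And>c. c \<in> D \<Longrightarrow> f c \<in> D'"
    and W: "\<And>c. c \<in> D' \<Longrightarrow> 1 \<le> W c"
  shows "computes_ostar D (\<lambda>c. g (f c)) (\<lambda>c. W (f c))"
proof -
  obtain T where T: "computes D f T" "poly_bounded D T" "poly_bounded D (\<lambda>c. enc_size (f c))"
    using f by (rule polytime_onE)
  obtain e where e: "computes D' g (\<lambda>c. enc_size c ^ e * W c)" using g
    unfolding computes_ostar_def by blast
  show ?thesis
  proof (rule computes_ostarI[OF computes_comp[OF T(1) e D]])
    show "poly_bounded D (\<lambda>c. T c + 2 + enc_size (f c) ^ e)" by (intro poly_bounded_intros T)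
    fix c assume "c \<in> D"
    then have "T c + 2 \<le> (T c + 2) * W (f c)" using mult_le_mono2[OF W[OF D], of c "T c + 2"] by simp
    then show "T c + enc_size (f c) ^ e * W (f c) + 2 \<le> (T c + 2 + enc_size (f c) ^ e) * W (f c)"
      by (simp add: algebra_simps)
  qed
qed

lemma computes_ostar_fold:
  assumes xs: "polytime_on D xs" and s: "polytime_on D s0"
    and f: "polytime_on E (\<lambda>p. f (fst p) (fst (snd p)) (snd (snd p)))"
    and step: "\<And>c ys x zs. c \<in> D \<Longrightarrow> xs c = ys @ x # zs \<Longrightarrow> (x, fold (\<lambda>x s. f x s c) ys (s0 c), c) \<in> E"
    and size: "\<And>c ys zs. c \<in> D \<Longrightarrow> xs c = ys @ zs \<Longrightarrow> enc_size (fold (\<lambda>x s. f x s c) ys (s0 c)) \<le> N c * S c"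
    and S: "poly_bounded D S" and N: "\<And>c. c \<in> D \<Longrightarrow> 1 \<le> N c"
  shows "\<exists>a. computes_ostar D (\<lambda>c. fold (\<lambda>x s. f x s c) (xs c) (s0 c)) (\<lambda>c. N c ^ a)"
proof -
  obtain Tx where Tx: "computes D xs Tx" "poly_bounded D Tx" "poly_bounded D (\<lambda>c. enc_size (xs c))"
    using xs by (rule polytime_onE)
  obtain Ts where Ts: "computes D s0 Ts" "poly_bounded D Ts" using s by (rule polytime_onE)
  obtain Tf where Tf: "computes E (\<lambda>p. f (fst p) (fst (snd p)) (snd (snd p))) Tf" "poly_bounded E Tf"
    using f by (rule polytime_onE)
  obtain a where a: "\<And>p. p \<in> E \<Longrightarrow> Tf p \<le> enc_size p ^ a" using Tf unfolding poly_bounded_def by blast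
  define R where "R = (\<lambda>c. enc_size (xs c) + S c + enc_size c)"
  have step_time: "Tf (x, fold (\<lambda>x s. f x s c) ys (s0 c), c) \<le> N c ^ a * R c ^ a"
    if c: "c \<in> D" and split: "xs c = ys @ x # zs" for c ys x zs
  proof -
    let ?s = "fold (\<lambda>x s. f x s c) ys (s0 c)"
    have "enc_size (x, ?s, c) \<le> enc_size (xs c) + N c * S c + enc_size c"
      using enc_size_member[of x "xs c"] size[OF c, of ys "x # zs"] split by simp
    also have "\<dots> \<le> N c * R c"
      using N[OF c] mult_le_mono1[OF N[OF c], of "enc_size (xs c) + enc_size c"]
      unfolding R_def by (simp add: algebra_simps)
    finally have "enc_size (x, ?s, c) ^ a \<le> (N c * R c) ^ a" by (rule power_mono) simp
    then show ?thesis using a[OF step[OF c split]] by (simp add: power_mult_distrib)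
  qed
  have "computes D (\<lambda>c. fold (\<lambda>x s. f x s c) (xs c) (s0 c))
      (\<lambda>c. Tx c + Ts c + (length (xs c) + 1) * (N c ^ a * R c ^ a + 30))"
    using computes_fold[OF Tx(1) Ts(1) Tf(1), of "\<lambda>c. N c ^ a * R c ^ a"] step step_time by simp
  moreover have "poly_bounded D (\<lambda>c. Tx c + Ts c + (length (xs c) + 1) * (R c ^ a + 30))"
  proof -
    have "length ys \<le> enc_size ys" for ys :: "'b list" using length_le_enc_size[of ys] by linarith
    then show ?thesis unfolding R_def
      by (intro poly_bounded_intros Tx Ts S poly_bounded_mono[OF Tx(3)]) auto
  qed
  moreover have "Tx c + Ts c + (length (xs c) + 1) * (N c ^ a * R c ^ a + 30)
      \<le> (Tx c + Ts c + (length (xs c) + 1) * (R c ^ a + 30)) * N c ^ a" if "c \<in> D" for c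
    using mult_le_mono2[of 1 "N c ^ a" "Tx c + Ts c + (length (xs c) + 1) * 30"] N[OF that]
    by (simp add: algebra_simps)
  ultimately show ?thesis by (intro exI[of _ a]) (rule computes_ostarI)
qed

lemma polytime_fold:
  assumes "polytime_on D xs" "polytime_on D s0"
      "polytime_on E (\<lambda>p. f (fst p) (fst (snd p)) (snd (snd p)))"
    and "\<And>c ys x zs. c \<in> D \<Longrightarrow> xs c = ys @ x # zs \<Longrightarrow> (x, fold (\<lambda>x s. f x s c) ys (s0 c), c) \<in> E"
    and S: "poly_bounded D S"
    and size: "\<And>c ys zs. c \<in> D \<Longrightarrow> xs c = ys @ zs \<Longrightarrow> enc_size (fold (\<lambda>x s. f x s c) ys (s0 c)) \<le> S c"
  shows "polytime_on D (\<lambda>c. fold (\<lambda>x s. f x s c) (xs c) (s0 c))"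
  unfolding polytime_on_def
proof
  show "computes_ostar D (\<lambda>c. fold (\<lambda>x s. f x s c) (xs c) (s0 c)) (\<lambda>_. 1)"
    using computes_ostar_fold[OF assms(1-4) _ S, where N = "\<lambda>_. 1"] size by simp
  show "poly_bounded D (\<lambda>c. enc_size (fold (\<lambda>x s. f x s c) (xs c) (s0 c)))"
    by (rule poly_bounded_mono[OF S order_refl]) (use size in force)
qed

section \<open>Polynomial-time list functions\<close>

lemma poly_bounded_elements:
  assumes "poly_bounded {p. snd p \<in> D \<and> fst p \<in> set (xs (snd p))} t"
      "poly_bounded D (\<lambda>c. enc_size (xs c))"
  obtains B where "poly_bounded D B" "\<And>c x. c \<in> D \<Longrightarrow> x \<in> set (xs c) \<Longrightarrow> t (x, c) \<le> B c"
proof -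
  obtain a where a: "\<And>c x. c \<in> D \<Longrightarrow> x \<in> set (xs c) \<Longrightarrow> t (x, c) \<le> enc_size (x, c) ^ a"
    using assms(1) unfolding poly_bounded_def by force
  show ?thesis
  proof (rule that)
    show "poly_bounded D (\<lambda>c. (enc_size (xs c) + enc_size c) ^ a)" by (intro poly_bounded_intros assms)
    fix c x assume elem: "c \<in> D" "x \<in> set (xs c)"
    have "t (x, c) \<le> enc_size (x, c) ^ a" using a elem by blast
    also have "\<dots> \<le> (enc_size (xs c) + enc_size c) ^ a"
      using enc_size_member[OF elem(2)] by (intro power_mono) auto
    finally show "t (x, c) \<le> (enc_size (xs c) + enc_size c) ^ a" .
  qed
qed

lemma enc_size_rev: "enc_size (rev xs) = enc_size xs"
  by (simp add: enc_size_list rev_map[symmetric])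

lemma enc_size_prefix_le: "xs = ys @ zs \<Longrightarrow> enc_size ys \<le> enc_size xs"
  using enc_size_append[of ys zs] enc_size_ge_2[of zs] by simp

lemma enc_size_suffix_le: "xs = ys @ zs \<Longrightarrow> enc_size zs \<le> enc_size xs"
  using enc_size_append[of ys zs] enc_size_ge_2[of ys] by simp

lemma enc_size_filter_le: "enc_size (filter P xs) \<le> enc_size xs"
  by (induction xs) auto

lemma enc_size_concat_le: "enc_size (concat xss) \<le> enc_size xss"
proof (induction xss)
  case (Cons xs xss)
  then show ?case using enc_size_append[of xs "concat xss"] by simp
qed simp

lemma fold_Cons_rev_append: "fold (\<lambda>x s. x # s) xs ys = rev xs @ ys"
  by (induction xs arbitrary: ys) auto

lemma polytime_rev_append:
  assumes "polytime_on D xs" "polytime_on D ys"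
  shows "polytime_on D (\<lambda>c. rev (xs c) @ ys c)"
  unfolding fold_Cons_rev_append[symmetric]
proof (rule polytime_fold[where E = UNIV and S = "\<lambda>c. enc_size (xs c) + enc_size (ys c)"])
  show "poly_bounded D (\<lambda>c. enc_size (xs c) + enc_size (ys c))"
    by (intro poly_bounded_intros polytime_enc_size assms)
  fix c us zs assume "xs c = us @ zs"
  then show "enc_size (fold (\<lambda>x s. x # s) us (ys c)) \<le> enc_size (xs c) + enc_size (ys c)"
    unfolding fold_Cons_rev_append
    using enc_size_append[of "rev us" "ys c"] enc_size_prefix_le[of "xs c" us zs]
    by (simp add: enc_size_rev)
qed (auto intro!: polytime assms)

lemma polytime_rev[polytime]: "polytime_on D xs \<Longrightarrow> polytime_on D (\<lambda>c. rev (xs c))"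
  using polytime_rev_append[OF _ polytime_const, of D xs "[]"] by simp

lemma polytime_append[polytime]: "polytime_on D xs \<Longrightarrow> polytime_on D ys \<Longrightarrow> polytime_on D (\<lambda>c. xs c @ ys c)"
  using polytime_rev_append[OF polytime_rev, of D xs ys] by simp

lemma fold_append_concat_map: "fold (\<lambda>x s. s @ f x) xs ys = ys @ concat (map f xs)"
  by (induction xs arbitrary: ys) auto

lemma polytime_concat_map[polytime]:
  assumes xs: "polytime_on D xs"
    and f: "polytime_on {p. snd p \<in> D \<and> fst p \<in> set (xs (snd p))} (\<lambda>p. f (fst p) (snd p))"
  shows "polytime_on D (\<lambda>c. concat (map (\<lambda>x. f x c) (xs c)))"
proof -
  let ?E = "{p. snd p \<in> D \<and> fst p \<in> set (xs (snd p))}"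
  let ?E' = "{p. (fst p, snd (snd p)) \<in> ?E}"
  obtain B where B: "poly_bounded D B" "\<And>c x. c \<in> D \<Longrightarrow> x \<in> set (xs c) \<Longrightarrow> enc_size (f x c) \<le> B c"
    using poly_bounded_elements[OF polytime_enc_size[OF f] polytime_enc_size[OF xs]] by auto
  have "polytime_on D (\<lambda>c. fold (\<lambda>x s. s @ f x c) (xs c) [])"
  proof (rule polytime_fold[OF xs polytime_const, where E = ?E'])
    have "polytime_on ?E' (\<lambda>p. f (fst p) (snd (snd p)))"
      using polytime_comp[OF f polytime_Pair[OF polytime_fst[OF polytime_id]
        polytime_snd[OF polytime_snd[OF polytime_id]]],
          of ?E'] by simp
    then show "polytime_on ?E' (\<lambda>p. fst (snd p) @ f (fst p) (snd (snd p)))"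
      by (intro polytime)
    show "poly_bounded D (\<lambda>c. 2 + enc_size (xs c) * B c)"
      by (intro poly_bounded_intros B polytime_enc_size xs)
    fix c ys zs assume c: "c \<in> D" "xs c = ys @ zs"
    have "enc_size (concat (map (\<lambda>x. f x c) ys)) \<le> enc_size (map (\<lambda>x. f x c) ys)"
      by (rule enc_size_concat_le)
    also have "\<dots> \<le> 2 + length (map (\<lambda>x. f x c) ys) * B c"
      by (rule enc_size_list_le) (use B c in auto)
    also have "\<dots> \<le> 2 + enc_size (xs c) * B c"
      using length_le_enc_size[of "xs c"] c by (intro add_mono mult_le_mono) auto
    finally show "enc_size (fold (\<lambda>x s. s @ f x c) ys []) \<le> 2 + enc_size (xs c) * B c"
      by (simp add: fold_append_concat_map)
  qed auto
  then show ?thesis by (simp add: fold_append_concat_map)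
qed

lemma polytime_map[polytime]:
  assumes "polytime_on D xs"
    and "polytime_on {p. snd p \<in> D \<and> fst p \<in> set (xs (snd p))} (\<lambda>p. f (fst p) (snd p))"
  shows "polytime_on D (\<lambda>c. map (\<lambda>x. f x c) (xs c))"
proof -
  have "concat (map (\<lambda>x. [f x c]) ys) = map (\<lambda>x. f x c) ys" for c ys
    by (induction ys) auto
  then show ?thesis using polytime_concat_map[OF assms(1) polytime_Cons[OF assms(2) polytime_const],
      of "[]"] by simp
qed

lemma polytime_filter[polytime]:
  assumes "polytime_on D xs"
    and "polytime_on {p. snd p \<in> D \<and> fst p \<in> set (xs (snd p))} (\<lambda>p. P (fst p) (snd p))"
  shows "polytime_on D (\<lambda>c. filter (\<lambda>x. P x c) (xs c))"
proof -
  have "concat (map (\<lambda>x. if P x c then [x] else []) ys) = filter (\<lambda>x. P x c) ys" for c ys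
    by (induction ys) auto
  then show ?thesis
    using polytime_concat_map[OF assms(1)
        polytime_if[OF assms(2) polytime_Cons[OF polytime_fst[OF polytime_id] polytime_const]
            polytime_const], of "[]" "[]"]
    by simp
qed

lemma polytime_Bex[polytime]:
  assumes "polytime_on D xs"
    and "polytime_on {p. snd p \<in> D \<and> fst p \<in> set (xs (snd p))} (\<lambda>p. P (fst p) (snd p))"
  shows "polytime_on D (\<lambda>c. \<exists>x\<in>set (xs c). P x c)"
  by (rule polytime_cong[of D "\<lambda>c. \<not> (filter (\<lambda>x. P x c) (xs c) = [])"], intro polytime assms)
    (auto simp: filter_empty_conv)

lemma polytime_Ball[polytime]:
  assumes "polytime_on D xs"
    and "polytime_on {p. snd p \<in> D \<and> fst p \<in> set (xs (snd p))} (\<lambda>p. P (fst p) (snd p))"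
  shows "polytime_on D (\<lambda>c. \<forall>x\<in>set (xs c). P x c)"
  by (rule polytime_cong[of D "\<lambda>c. \<not> (\<exists>x\<in>set (xs c). \<not> P x c)"], intro polytime assms) auto

lemma polytime_member[polytime]:
  assumes "polytime_on D x" "polytime_on D xs"
  shows "polytime_on D (\<lambda>c. x c \<in> set (xs c))"
proof -
  have "polytime_on D (\<lambda>c. \<exists>y\<in>set (xs c). y = x c)"
    by (intro polytime_Bex polytime_eq polytime_fst polytime_id polytime_in_context assms)
  then show ?thesis by simp
qed

text \<open>A number has the same encoding as a list of that many units, so one can fold over it.\<close>

lemma polytime_units: "polytime_on D f \<Longrightarrow> polytime_on D (\<lambda>c. replicate (f c) ())"
  by (rule polytime_recode[of D f]) (auto simp: enc_replicate_unit)

lemma polytime_of_units: "polytime_on D (\<lambda>c. replicate (f c) ()) \<Longrightarrow> polytime_on D f"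
  by (erule polytime_recode) (simp add: enc_replicate_unit)

lemma polytime_length[polytime]: "polytime_on D xs \<Longrightarrow> polytime_on D (\<lambda>c. length (xs c))"
  using polytime_map[OF _ polytime_const, of D xs "()"]
  by (intro polytime_of_units) (simp add: map_replicate_const)

lemma polytime_add[polytime]:
  fixes f g :: "'a::encodable \<Rightarrow> nat"
  assumes "polytime_on D f" "polytime_on D g"
  shows "polytime_on D (\<lambda>c. f c + g c)"
  by (rule polytime_of_units, unfold replicate_add, intro polytime_append polytime_units assms)

lemma fold_tl: "fold (\<lambda>_ s. tl s) xs ys = drop (length xs) ys"
  by (induction xs arbitrary: ys) (auto simp: drop_Suc)

lemma polytime_drop[polytime]:
  assumes "polytime_on D n" "polytime_on D xs"
  shows "polytime_on D (\<lambda>c. drop (n c) (xs c))"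
proof -
  have "polytime_on D (\<lambda>c. fold (\<lambda>_ s. tl s) (replicate (n c) ()) (xs c))"
  proof (rule polytime_fold[where E = UNIV and S = "\<lambda>c. enc_size (xs c)"])
    fix c and us :: "unit list"
    show "enc_size (fold (\<lambda>_ s. tl s) us (xs c)) \<le> enc_size (xs c)"
      unfolding fold_tl using enc_size_suffix_le[OF append_take_drop_id[symmetric]] .
  qed (intro polytime polytime_units polytime_enc_size assms UNIV_I)+
  then show ?thesis unfolding fold_tl by simp
qed

lemma polytime_diff[polytime]:
  fixes f g :: "'a::encodable \<Rightarrow> nat"
  assumes "polytime_on D f" "polytime_on D g"
  shows "polytime_on D (\<lambda>c. f c - g c)"
proof (rule polytime_of_units)
  have "polytime_on D (\<lambda>c. drop (g c) (replicate (f c) ()))"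
    by (intro polytime_drop polytime_units assms)
  then show "polytime_on D (\<lambda>c. replicate (f c - g c) ())" by simp
qed

lemma polytime_take[polytime]:
  assumes "polytime_on D n" "polytime_on D xs"
  shows "polytime_on D (\<lambda>c. take (n c) (xs c))"
proof (rule polytime_cong)
  show "polytime_on D (\<lambda>c. rev (drop (length (xs c) - n c) (rev (xs c))))" by (intro polytime assms)
  show "take (n c) (xs c) = rev (drop (length (xs c) - n c) (rev (xs c)))" for c
    by (cases "n c \<le> length (xs c)") (simp_all add: rev_drop)
qed

lemma polytime_le[polytime]: "polytime_on D f \<Longrightarrow> polytime_on D g \<Longrightarrow> polytime_on D (\<lambda>c. f c \<le> (g c :: nat))"
  by (rule polytime_cong[of D "\<lambda>c. f c - g c = 0"], intro polytime) auto

lemma polytime_less[polytime]: "polytime_on D f \<Longrightarrow> polytime_on D g \<Longrightarrow>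
    polytime_on D (\<lambda>c. f c < (g c :: nat))"
  unfolding less_eq_Suc_le by (intro polytime)

lemma polytime_sum_list[polytime]:
  fixes xs :: "'a::encodable \<Rightarrow> nat list"
  assumes "polytime_on D xs"
  shows "polytime_on D (\<lambda>c. sum_list (xs c))"
proof (rule polytime_of_units)
  have "concat (map (\<lambda>n. replicate n ()) ys) = replicate (sum_list ys) ()" for ys
    by (induction ys) (auto simp: replicate_add)
  moreover have "polytime_on D (\<lambda>c. concat (map (\<lambda>n. replicate n ()) (xs c)))"
    by (intro polytime_concat_map assms polytime_units polytime_fst polytime_id)
  ultimately show "polytime_on D (\<lambda>c. replicate (sum_list (xs c)) ())" by simp
qed

lemma fold_max_eq_Max: "fold max xs (a::nat) = Max (insert a (set xs))"
  using Max.set_eq_fold[of a xs] by (simp del: Max.set_eq_fold)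

lemma polytime_Max[polytime]:
  fixes xs :: "'a::encodable \<Rightarrow> nat list"
  assumes "polytime_on D xs"
  shows "polytime_on D (\<lambda>c. Max (insert 0 (set (xs c))))"
  unfolding fold_max_eq_Max[symmetric]
proof (rule polytime_fold[where E = UNIV and S = "\<lambda>c. enc_size (xs c) + 2"])
  show "poly_bounded D (\<lambda>c. enc_size (xs c) + 2)" by (intro poly_bounded_intros polytime_enc_size assms)
  fix c ys zs assume split: "xs c = ys @ zs"
  have "Max (insert 0 (set ys)) \<in> insert 0 (set ys)" by (rule Max_in) auto
  then show "enc_size (fold max ys 0) \<le> enc_size (xs c) + 2"
    unfolding fold_max_eq_Max using split enc_size_member[of "Max (insert 0 (set ys))" "xs c"] by auto
qed (auto simp: max_def intro!: polytime assms)

lemma fold_upt_rev: "fold (\<lambda>_ s. (Suc (fst s), fst s # snd s)) xs (0, []) =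
    (length xs, rev [0..<length xs])"
  by (induction xs rule: rev_induct) auto

lemma polytime_upt[polytime]:
  assumes "polytime_on D n"
  shows "polytime_on D (\<lambda>c. [0..<n c])"
proof -
  have "polytime_on D (\<lambda>c. fold (\<lambda>_ s. (Suc (fst s), fst s # snd s)) (replicate (n c) ()) (0, []))"
  proof (rule polytime_fold[where E = UNIV
    and S = "\<lambda>c. enc_size (n c) + (2 + enc_size (n c) * enc_size (n c))"])
    show "poly_bounded D (\<lambda>c. enc_size (n c) + (2 + enc_size (n c) * enc_size (n c)))"
      by (intro poly_bounded_intros polytime_enc_size assms)
    fix c and us zs :: "unit list" assume "replicate (n c) () = us @ zs"
    then have len: "length us \<le> n c" by (metis length_append length_replicate le_add1)
    have "enc_size (rev [0..<length us]) \<le> 2 + length (rev [0..<length us]) * enc_size (n c)"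
      by (rule enc_size_list_le) (use len in auto)
    also have "\<dots> \<le> 2 + enc_size (n c) * enc_size (n c)" using len by (intro add_mono mult_le_mono) auto
    finally show "enc_size (fold (\<lambda>_ s. (Suc (fst s), fst s # snd s)) us (0, []))
        \<le> enc_size (n c) + (2 + enc_size (n c) * enc_size (n c))"
      using len unfolding fold_upt_rev by simp
  qed (auto intro!: polytime polytime_units assms)
  from polytime_rev[OF polytime_snd[OF this]] show ?thesis unfolding fold_upt_rev by simp
qed

lemma remdups_eq_fold: "remdups xs = fold (\<lambda>x s. if x \<in> set s then s else x # s) (rev xs) []"
proof -
  have "remdups xs = foldr (\<lambda>x s. if x \<in> set s then s else x # s) xs []"
  proof (induction xs)
    case (Cons x xs)
    then show ?case using set_remdups[of xs] by auto
  qed simp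
  then show ?thesis by (simp add: foldr_conv_fold)
qed

lemma enc_size_remdups_le: "enc_size (remdups xs) \<le> enc_size xs"
  by (induction xs) auto

lemma polytime_remdups[polytime]:
  assumes "polytime_on D xs"
  shows "polytime_on D (\<lambda>c. remdups (xs c))"
  unfolding remdups_eq_fold
proof (rule polytime_fold[where f = "\<lambda>x s c. if x \<in> set s then s else x # s" and E = UNIV
      and S = "\<lambda>c. enc_size (xs c)"])
  fix c ys zs assume "rev (xs c) = ys @ zs"
  then have "enc_size (rev ys) \<le> enc_size (xs c)" using enc_size_suffix_le[of "xs c" "rev zs" "rev ys"]
    by (simp add: rev_swap)
  then show "enc_size (fold (\<lambda>x s. if x \<in> set s then s else x # s) ys []) \<le> enc_size (xs c)"
    using enc_size_remdups_le[of "rev ys"] unfolding remdups_eq_fold by simp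
qed (intro polytime polytime_enc_size assms UNIV_I)+

lemma polytime_mult[polytime]:
  fixes f g :: "'a::encodable \<Rightarrow> nat"
  assumes "polytime_on D f" "polytime_on D g"
  shows "polytime_on D (\<lambda>c. f c * g c)"
proof -
  have "polytime_on D (\<lambda>c. sum_list (map (\<lambda>_. g c) [0..<f c]))"
    by (intro polytime assms polytime_in_context)
  then show ?thesis by (simp add: map_replicate_const sum_list_replicate)
qed

lemma length_filter_mult_le: "0 < g \<Longrightarrow> length (filter (\<lambda>i. Suc i * g \<le> p) [0..<p]) = p div g"
proof -
  assume g: "0 < g"
  have "length (filter (\<lambda>i. Suc i * g \<le> p) [0..<p]) = card {i. i < p \<and> Suc i * g \<le> p}"
    by (subst distinct_card[symmetric]) (auto intro: arg_cong[where f = card])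
  also have "{i. i < p \<and> Suc i * g \<le> p} = {..<p div g}"
    unfolding less_eq_div_iff_mult_less_eq[OF g, symmetric] Suc_le_eq
    by (auto intro: less_le_trans[OF _ div_le_dividend])
  finally show ?thesis by simp
qed

lemma polytime_div_const[polytime]:
  fixes f :: "'a::encodable \<Rightarrow> nat"
  assumes "polytime_on D f"
  shows "polytime_on D (\<lambda>c. f c div g)"
proof (cases "0 < g")
  case True
  show ?thesis
    unfolding length_filter_mult_le[OF True, symmetric] by (intro polytime assms polytime_in_context)
qed (simp add: polytime_const)

lemma fold_Bex: "fold (\<lambda>x s. if s then True else P x) xs b \<longleftrightarrow> b \<or> (\<exists>x\<in>set xs. P x)"
  by (induction xs arbitrary: b) auto

lemma computes_Bex:
  assumes xs: "computes D xs Tx"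
    and P: "computes {p. snd p \<in> D \<and> fst p \<in> set (xs (snd p))} (\<lambda>p. P (fst p) (snd p)) Tp"
    and B: "\<And>c x. c \<in> D \<Longrightarrow> x \<in> set (xs c) \<Longrightarrow> Tp (x, c) \<le> B c"
  shows "computes D (\<lambda>c. \<exists>x\<in>set (xs c). P x c) (\<lambda>c. Tx c + (length (xs c) + 2) * (B c + 70))"
proof -
  let ?E = "{p. snd p \<in> D \<and> fst p \<in> set (xs (snd p))}"
  let ?F = "{p :: _ \<times> bool \<times> _. (fst p, snd (snd p)) \<in> ?E}"
  have found: "computes ?F (\<lambda>p. fst (snd p)) (\<lambda>_. 8)" and outer: "computes ?F (\<lambda>p. snd (snd p)) (\<lambda>_. 8)"
    by (rule computes_mono[OF computes_comp[OF computes_snd computes_fst]]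
        computes_mono[OF computes_comp[OF computes_snd computes_snd]]; simp)+
  have "computes ?F (\<lambda>p. (fst p, snd (snd p))) (\<lambda>_. 12)"
    by (rule computes_mono[OF computes_Pair[OF computes_mono[OF computes_fst] outer]]) auto
  from computes_comp[OF this P] have "computes ?F (\<lambda>p. P (fst p) (snd (snd p)))
      (\<lambda>p. 12 + Tp (fst p, snd (snd p)) + 2)"
    by simp
  then have "computes {c \<in> ?F. \<not> fst (snd c)} (\<lambda>p. P (fst p) (snd (snd p)))
      (\<lambda>p. 12 + Tp (fst p, snd (snd p)) + 2)"
    by (rule computes_mono) auto
  from computes_if[OF found computes_const[of _ True] this]
  have body: "computes ?F (\<lambda>p. if fst (snd p) then True else P (fst p) (snd (snd p)))
      (\<lambda>p. 31 + Tp (fst p, snd (snd p)))"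
    by (rule computes_mono) (simp_all del: split_paired_All)
  have "computes D (\<lambda>c. fold (\<lambda>x s. if s then True else P x c) (xs c) False)
      (\<lambda>c. Tx c + enc_size False + (length (xs c) + 1) * ((B c + 31) + 30))"
    using computes_fold[OF xs computes_const[of D False] body,
      where B = "\<lambda>c. B c + 31", unfolded fst_conv snd_conv] B
    by simp
  then show ?thesis unfolding fold_Bex by (rule computes_mono) (auto simp: algebra_simps)
qed

lemma computes_ostar_Bex:
  assumes xs: "computes_ostar D xs (\<lambda>c. N c ^ a)"
    and P: "computes_ostar {p. snd p \<in> D \<and> fst p \<in> set (xs (snd p))} (\<lambda>p. P (fst p) (snd p))
        (\<lambda>p. W (snd p))"
    and len: "\<And>c. c \<in> D \<Longrightarrow> length (xs c) \<le> N c * Y c" "poly_bounded D Y"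
    and elem: "\<And>c x. c \<in> D \<Longrightarrow> x \<in> set (xs c) \<Longrightarrow> enc_size x \<le> Z c" "poly_bounded D Z"
    and pos: "\<And>c. c \<in> D \<Longrightarrow> 1 \<le> N c" "\<And>c. c \<in> D \<Longrightarrow> 1 \<le> W c"
  shows "computes_ostar D (\<lambda>c. \<exists>x\<in>set (xs c). P x c) (\<lambda>c. N c ^ Suc a * W c)"
proof -
  obtain d where d: "computes D xs (\<lambda>c. enc_size c ^ d * N c ^ a)" using xs
    unfolding computes_ostar_def by blast
  obtain e where e: "computes {p. snd p \<in> D \<and> fst p \<in> set (xs (snd p))} (\<lambda>p. P (fst p) (snd p))
      (\<lambda>p. enc_size p ^ e * W (snd p))" using P unfolding computes_ostar_def by blast
  define B where "B = (\<lambda>c. (Z c + enc_size c) ^ e)"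
  have time: "computes D (\<lambda>c. \<exists>x\<in>set (xs c). P x c)
      (\<lambda>c. enc_size c ^ d * N c ^ a + (length (xs c) + 2) * (B c * W c + 70))"
  proof (rule computes_Bex[OF d e])
    fix c x assume "c \<in> D" "x \<in> set (xs c)"
    then show "enc_size (x, c) ^ e * W (snd (x, c)) \<le> B c * W c"
      unfolding B_def using elem(1) by (auto intro!: mult_le_mono power_mono)
  qed
  show ?thesis
  proof (rule computes_ostarI[OF time])
    show "poly_bounded D (\<lambda>c. enc_size c ^ d + (Y c + 2) * (B c + 70))"
      unfolding B_def by (intro poly_bounded_intros len elem)
    fix c assume c: "c \<in> D"
    let ?V = "N c ^ Suc a * W c"
    have "N c ^ a * 1 \<le> N c ^ Suc a * W c" using pos[OF c] by (intro mult_le_mono) simp_all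
    then have generate: "enc_size c ^ d * N c ^ a \<le> enc_size c ^ d * ?V" by simp
    have "length (xs c) + 2 \<le> (Y c + 2) * N c" "B c * W c + 70 \<le> (B c + 70) * W c"
      using len(1)[OF c] pos[OF c] by (simp_all add: algebra_simps)
    then have "(length (xs c) + 2) * (B c * W c + 70) \<le> (Y c + 2) * N c * ((B c + 70) * W c)"
      by (rule mult_le_mono)
    also have "\<dots> = (Y c + 2) * (B c + 70) * (N c * W c)" by (simp only: mult_ac)
    also have "\<dots> \<le> (Y c + 2) * (B c + 70) * ?V" using pos[OF c]
      by (intro mult_le_mono2 mult_le_mono1) simp
    finally show "enc_size c ^ d * N c ^ a + (length (xs c) + 2) * (B c * W c + 70)
        \<le> (enc_size c ^ d + (Y c + 2) * (B c + 70)) * ?V"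
      using generate by (simp only: add_mult_distrib add_mono)
  qed
qed

section \<open>Disjoint families and token pairs\<close>

lemma exists_small_member_of_family:
  assumes "finite X" "finite I" "disjoint_family_on A I" "\<And>i. i \<in> I \<Longrightarrow> A i \<subseteq> X"
    and "card X \<le> card I * m" "x \<in> X" "x \<notin> (\<Union>i\<in>I. A i)"
  obtains i where "i \<in> I" "card (A i) < m"
proof (rule ccontr)
  assume "\<not> thesis"
  then have "card I * m \<le> (\<Sum>i\<in>I. card (A i))" using that
    by (intro sum_bounded_below[of I m, simplified]) (meson not_le)
  also have "\<dots> = card (\<Union>i\<in>I. A i)"
    using assms finite_subset by (intro card_UN_disjoint'[symmetric]) blast+
  also have "\<dots> < card X" using assms by (intro psubset_card_mono) auto
  finally show False using assms by simp
qed

lemma extend_to_partition: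
  assumes "finite X" "finite I" "disjoint_family_on A I" "\<And>i. i \<in> I \<Longrightarrow> A i \<subseteq> X"
      "\<And>i. i \<in> I \<Longrightarrow> card (A i) \<le> m"
    and "card X \<le> card I * m"
  shows "\<exists>S. disjoint_family_on S I \<and> (\<Union>i\<in>I. S i) = X \<and> (\<forall>i\<in>I. A i \<subseteq> S i \<and> card (S i) \<le> m)"
  using assms(3-5)
proof (induction "card (X - (\<Union>i\<in>I. A i))" arbitrary: A)
  case 0
  then have "(\<Union>i\<in>I. A i) = X" using \<open>finite X\<close> by auto
  then show ?case using "0.prems" by (intro exI[of _ A]) simp
next
  case (Suc k)
  then obtain x where x: "x \<in> X" "x \<notin> (\<Union>i\<in>I. A i)"
    by (metis Diff_iff card.empty ex_in_conv nat.distinct(1))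
  obtain i where i: "i \<in> I" "card (A i) < m"
    by (rule exists_small_member_of_family[OF assms(1,2) Suc.prems(1,2) assms(6) x])
  let ?A = "A(i := insert x (A i))"
  have UN: "(\<Union>j\<in>I. ?A j) = insert x (\<Union>j\<in>I. A j)" using i by (auto split: if_splits)
  have "k = card (X - (\<Union>j\<in>I. ?A j))"
    unfolding UN using Suc.hyps(2) x \<open>finite X\<close> by (simp add: Diff_insert[of X x] card_Diff_singleton)
  moreover have "disjoint_family_on ?A I"
    using Suc.prems(1) x unfolding disjoint_family_on_def by auto
  moreover have "\<And>j. j \<in> I \<Longrightarrow> ?A j \<subseteq> X" using Suc.prems(2) x(1) by auto
  moreover have "\<And>j. j \<in> I \<Longrightarrow> card (?A j) \<le> m"
    using Suc.prems(3) i card_insert_le_m1[of m "A i" x] by (cases m) auto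
  ultimately obtain S where S: "disjoint_family_on S I" "(\<Union>j\<in>I. S j) = X"
      "\<forall>j\<in>I. ?A j \<subseteq> S j \<and> card (S j) \<le> m"
    using Suc.hyps(1) by blast
  then have "A j \<subseteq> S j" if "j \<in> I" for j using that by (metis fun_upd_apply insert_subset)
  then show ?case using S by blast
qed

lemma disjoint_nonempty_subfamilies:
  assumes "finite \<S>" "finite I" "disjoint_family_on H I" "\<And>i. i \<in> I \<Longrightarrow> H i \<subseteq> \<S>" "\<And>i. i \<in> I \<Longrightarrow> H i \<noteq> {}"
    and "card \<S> \<le> card I"
  shows "(\<Union>i\<in>I. H i) = \<S>" "\<And>i. i \<in> I \<Longrightarrow> \<exists>X. H i = {X}"
proof -
  have fin: "finite (H i)" if "i \<in> I" for i using assms that finite_subset by blast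
  have pos: "1 \<le> card (H i)" if "i \<in> I" for i using assms(5)[OF that] fin[OF that]
    by (simp add: Suc_le_eq card_gt_0_iff)
  have sum: "card (\<Union>i\<in>I. H i) = (\<Sum>i\<in>I. card (H i))" by (rule card_UN_disjoint'[OF assms(3) fin assms(2)])
  have sub: "(\<Union>i\<in>I. H i) \<subseteq> \<S>" using assms(4) by blast
  have le: "(\<Sum>i\<in>I. card (H i)) \<le> card I" using card_mono[OF assms(1) sub] assms(6) sum by simp
  have ge: "card I \<le> (\<Sum>i\<in>I. card (H i))" using sum_bounded_below[of I 1 "\<lambda>i. card (H i)"] pos by simp
  show "(\<Union>i\<in>I. H i) = \<S>" by (rule card_seteq[OF assms(1) sub]) (use ge assms(6) sum in simp)
  show "\<exists>X. H i = {X}" if "i \<in> I" for i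
  proof (rule ccontr)
    assume "\<nexists>X. H i = {X}"
    then have "1 < card (H i)" using pos[OF that] by (metis card_1_singletonE le_neq_implies_less)
    then have "(\<Sum>i\<in>I. 1) < (\<Sum>i\<in>I. card (H i))" using assms(2) pos that
      by (intro sum_strict_mono_ex1) auto
    then show False using le by simp
  qed
qed

text \<open>
  The tokens of the pair \<open>j\<close> are \<open>p + j\<close> and \<open>p + r + j\<close>. The elements of \<open>T\<close> lie in singletons
  only and no set meets two token pairs, so the budget leaves exactly one set for each of these
  \<open>card T + r\<close> demands.
\<close>

definition token_family :: "nat \<Rightarrow> nat \<Rightarrow> (nat set \<times> nat) set \<Rightarrow> nat set set" where
  "token_family p r \<A> = (\<lambda>x. {x}) ` {..<p + r + r} \<union> (\<lambda>(A, j). A \<union> {p + j, p + r + j}) ` \<A>"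

lemma token_familyE:
  assumes "X \<in> token_family p r \<A>"
  obtains x where "x < p + r + r" "X = {x}" | A j where "(A, j) \<in> \<A>" "X = A \<union> {p + j, p + r + j}"
  using assms unfolding token_family_def by auto

definition token_hits :: "nat \<Rightarrow> nat \<Rightarrow> nat set set \<Rightarrow> nat \<Rightarrow> nat set set" where
  "token_hits p r \<S> i = {X \<in> \<S>. i \<in> X \<or> p \<le> i \<and> i + r \<in> X}"

context
  fixes p r :: nat and T :: "nat set" and \<A> :: "(nat set \<times> nat) set" and \<S> :: "nat set set"
  assumes \<A>: "\<And>A j. (A, j) \<in> \<A> \<Longrightarrow> A \<subseteq> {..<p} - T \<and> j < r" and T: "T \<subseteq> {..<p}"
    and sub: "\<S> \<subseteq> token_family p r \<A>" and cov: "\<Union>\<S> = {..<p + r + r}" and fin: "finite \<S>"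
    and card: "card \<S> \<le> r + card T"
begin

lemma token_hits_partition:
  "(\<Union>i\<in>T \<union> {p..<p + r}. token_hits p r \<S> i) = \<S>"
  "i \<in> T \<union> {p..<p + r} \<Longrightarrow> \<exists>X. token_hits p r \<S> i = {X}"
proof -
  let ?I = "T \<union> {p..<p + r}"
  have finI: "finite ?I" using T finite_subset by auto
  have "i = i'"
    if "X \<in> token_hits p r \<S> i" "X \<in> token_hits p r \<S> i'" "i \<in> ?I" "i' \<in> ?I" for X i i'
  proof -
    have "X \<in> token_family p r \<A>" using that sub by (auto simp: token_hits_def)
    then show ?thesis
    proof (cases rule: token_familyE)
      case (1 x)
      then show ?thesis using that T by (auto simp: token_hits_def)
    next
      case (2 A j)
      then show ?thesis using that \<A>[OF 2(1)] T by (auto simp: token_hits_def)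
    qed
  qed
  then have disjoint: "disjoint_family_on (token_hits p r \<S>) ?I"
    unfolding disjoint_family_on_def by blast
  have nonempty: "token_hits p r \<S> i \<noteq> {}" if "i \<in> ?I" for i
  proof -
    have "i \<in> \<Union>\<S>" unfolding cov using that T by auto
    then show ?thesis by (auto simp: token_hits_def)
  qed
  have hit_sub: "token_hits p r \<S> i \<subseteq> \<S>" for i by (auto simp: token_hits_def)
  have "T \<inter> {p..<p + r} = {}" using T by auto
  then have "card \<S> \<le> card ?I" using card card_Un_disjoint[of T "{p..<p + r}"] finI by simp
  note partition = disjoint_nonempty_subfamilies[OF fin finI disjoint hit_sub nonempty this]
  show "(\<Union>i\<in>?I. token_hits p r \<S> i) = \<S>" by (rule partition(1))
  show "\<exists>X. token_hits p r \<S> i = {X}" if "i \<in> ?I" by (rule partition(2)[OF _ that])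
qed

lemma token_hits_pair:
  assumes j: "j < r"
  shows "\<exists>A. (A, j) \<in> \<A> \<and> token_hits p r \<S> (p + j) = {A \<union> {p + j, p + r + j}}"
proof -
  obtain X where X: "token_hits p r \<S> (p + j) = {X}" using token_hits_partition(2)[of "p + j"] j by auto
  have "p + j \<in> \<Union>\<S>" "p + r + j \<in> \<Union>\<S>" unfolding cov using j by auto
  then have tokens: "p + j \<in> X" "p + r + j \<in> X" using X by (auto simp: token_hits_def ac_simps)
  have "X \<in> token_family p r \<A>" using X sub by (auto simp: token_hits_def)
  then show ?thesis
  proof (cases rule: token_familyE)
    case (2 A i)
    then show ?thesis using tokens(1) \<A>[OF 2(1)] j X by auto
  qed (use tokens j in auto)
qed

lemma token_family_coverD: "\<exists>F. (\<forall>j<r. (F j, j) \<in> \<A>) \<and> {..<p} - T \<subseteq> (\<Union>j<r. F j)"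
proof -
  obtain F where F: "\<And>j. j < r \<Longrightarrow> (F j, j) \<in> \<A> \<and> token_hits p r \<S> (p + j) = {F j \<union> {p + j, p + r + j}}"
    using token_hits_pair by metis
  have "y \<in> (\<Union>j<r. F j)" if y: "y \<in> {..<p} - T" for y
  proof -
    have "y \<in> \<Union>\<S>" unfolding cov using y by simp
    then obtain X i where X: "X \<in> \<S>" "y \<in> X" "i \<in> T \<union> {p..<p + r}" "X \<in> token_hits p r \<S> i"
      using token_hits_partition(1) by blast
    have "i \<notin> T"
    proof
      assume "i \<in> T"
      then have "i < p" "i \<in> X" using X(4) T by (auto simp: token_hits_def)
      have "X \<in> token_family p r \<A>" using X sub by blast
      then show False
      proof (cases rule: token_familyE)
        case (1 x)
        then show ?thesis using X(2) y \<open>i \<in> X\<close> \<open>i \<in> T\<close> by simp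
      next
        case (2 A j)
        then show ?thesis using \<A>[OF 2(1)] \<open>i \<in> X\<close> \<open>i < p\<close> \<open>i \<in> T\<close> by auto
      qed
    qed
    then obtain j where "j < r" "i = p + j" using X(3) by (auto simp: le_iff_add)
    then show ?thesis using F[of j] X y by auto
  qed
  then show ?thesis using F by blast
qed

end

lemma token_family_coverI:
  assumes F: "\<And>j. j < r \<Longrightarrow> (F j, j) \<in> \<A>" "(\<Union>j<r. F j) = {..<p} - T" and T: "T \<subseteq> {..<p}"
  shows "\<exists>\<S>\<subseteq>token_family p r \<A>. \<Union>\<S> = {..<p + r + r} \<and> card \<S> \<le> r + card T"
proof -
  let ?pair = "\<lambda>j. F j \<union> {p + j, p + r + j}"
  let ?\<S> = "(\<lambda>x. {x}) ` T \<union> ?pair ` {..<r}"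
  have "?pair j \<in> token_family p r \<A>" if "j < r" for j
    unfolding token_family_def using F(1)[OF that] by (intro UnI2 image_eqI[of _ _ "(F j, j)"]) simp_all
  moreover have "{x} \<in> token_family p r \<A>" if "x \<in> T" for x
    using that T unfolding token_family_def by auto
  ultimately have "?\<S> \<subseteq> token_family p r \<A>" by blast
  moreover have "\<Union>?\<S> = {..<p + r + r}"
  proof -
    have "\<Union>?\<S> = T \<union> (\<Union>j<r. F j) \<union> ((\<lambda>j. p + j) ` {..<r} \<union> (\<lambda>j. p + r + j) ` {..<r})" by auto
    moreover have "(\<lambda>j. a + j) ` {..<r} = {a..<a + r}" for a
      using image_add_atLeastLessThan[of a 0 r] by (simp add: lessThan_atLeast0 add.commute)
    ultimately have "\<Union>?\<S> = T \<union> ({..<p} - T) \<union> ({p..<p + r} \<union> {p + r..<p + r + r})" by (simp only: F(2))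
    also have "\<dots> = {..<p + r + r}" using T by (simp add: ivl_disj_un_two ivl_disj_un_one Un_absorb1)
    finally show ?thesis .
  qed
  moreover have "card ?\<S> \<le> r + card T"
  proof -
    have "card ?\<S> \<le> card ((\<lambda>x. {x}) ` T) + card (?pair ` {..<r})" by (rule card_Un_le)
    also have "\<dots> \<le> card T + r"
      using T finite_subset card_image_le[of T "\<lambda>x. {x}"] card_image_le[of "{..<r}" ?pair]
      by (intro add_mono) auto
    finally show ?thesis by simp
  qed
  ultimately show ?thesis by blast
qed

definition heavy :: "nat \<Rightarrow> ('a \<Rightarrow> 'b set) \<Rightarrow> 'a set \<Rightarrow> 'b set" where
  "heavy D K A = {q. D < card {c \<in> A. q \<in> K c}}"

lemma heavy_subset: "heavy D K A \<subseteq> (\<Union>c\<in>A. K c)"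
proof
  fix q assume "q \<in> heavy D K A"
  then have "{c \<in> A. q \<in> K c} \<noteq> {}" unfolding heavy_def by (auto simp del: Collect_empty_eq)
  then show "q \<in> (\<Union>c\<in>A. K c)" by blast
qed

lemma card_heavy_le:
  assumes "finite A" "\<And>c. c \<in> A \<Longrightarrow> finite (K c)" "\<And>c. c \<in> A \<Longrightarrow> card (K c) \<le> \<mu>"
  shows "D * card (heavy D K A) \<le> card A * \<mu>"
proof -
  let ?H = "heavy D K A"
  have fin: "finite ?H" using assms heavy_subset[of D K A] by (meson finite_UN finite_subset)
  have "card ?H * D \<le> (\<Sum>q\<in>?H. card {c \<in> A. q \<in> K c})"
    using sum_bounded_below[of ?H D] by (simp add: heavy_def less_imp_le)
  also have "\<dots> = (\<Sum>c\<in>A. card {q \<in> ?H. q \<in> K c})"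
    using sum.swap_restrict[OF fin assms(1), of "\<lambda>_ _. 1::nat" "\<lambda>q c. q \<in> K c"] by simp
  also have "\<dots> \<le> (\<Sum>c\<in>A. \<mu>)"
    by (intro sum_mono le_trans[OF card_mono assms(3)]) (use assms(2) in auto)
  finally show ?thesis by (simp add: mult.commute)
qed

section \<open>Packings within a set of hub vertices\<close>

definition vertex_disjoint :: "'a list set \<Rightarrow> bool" where
  "vertex_disjoint Y \<longleftrightarrow> pairwise (\<lambda>s t. disjnt (set s) (set t)) Y"

definition covered :: "'a list set \<Rightarrow> 'a set" where
  "covered Y = (\<Union>t\<in>Y. set t)"

lemma covered_simps [simp]:
  "covered {} = {}" "covered (insert t Y) = set t \<union> covered Y" "covered (Y \<union> Z) = covered Y \<union> covered Z"
  "covered (\<Union>\<Y>) = (\<Union>Y\<in>\<Y>. covered Y)"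
  by (auto simp: covered_def)

lemma covered_mono: "Y \<subseteq> Z \<Longrightarrow> covered Y \<subseteq> covered Z"
  by (auto simp: covered_def)

lemma vertex_disjoint_empty [simp]: "vertex_disjoint {}"
  by (simp add: vertex_disjoint_def)

lemma vertex_disjoint_mono: "vertex_disjoint Z \<Longrightarrow> Y \<subseteq> Z \<Longrightarrow> vertex_disjoint Y"
  unfolding vertex_disjoint_def by (rule pairwise_subset)

lemma vertex_disjoint_insert:
  "t \<notin> Y \<Longrightarrow> vertex_disjoint (insert t Y) \<longleftrightarrow> vertex_disjoint Y \<and> set t \<inter> covered Y = {}"
  unfolding vertex_disjoint_def pairwise_insert covered_def disjnt_def by blast

lemma vertex_disjoint_UN:
  assumes "\<And>i. i \<in> I \<Longrightarrow> vertex_disjoint (Y i)" "disjoint_family_on (\<lambda>i. covered (Y i)) I"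
  shows "vertex_disjoint (\<Union>i\<in>I. Y i)"
  unfolding vertex_disjoint_def
proof (rule pairwiseI)
  fix s t assume "s \<in> (\<Union>i\<in>I. Y i)" "t \<in> (\<Union>i\<in>I. Y i)" "s \<noteq> t"
  then obtain i j where ij: "i \<in> I" "s \<in> Y i" "j \<in> I" "t \<in> Y j" by blast
  show "disjnt (set s) (set t)"
  proof (cases "i = j")
    case True
    then show ?thesis using assms(1)[OF ij(1)] ij \<open>s \<noteq> t\<close>
      by (auto simp: vertex_disjoint_def pairwise_def)
  next
    case False
    then have "covered (Y i) \<inter> covered (Y j) = {}" using assms(2) ij
      unfolding disjoint_family_on_def by blast
    then show ?thesis using ij by (auto simp: covered_def disjnt_def)
  qed
qed

lemma vertex_disjoint_Un:
  assumes "vertex_disjoint Y" "vertex_disjoint Z" "covered Y \<inter> covered Z = {}"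
  shows "vertex_disjoint (Y \<union> Z)"
  using assms unfolding vertex_disjoint_def pairwise_def covered_def disjnt_def by blast

lemma covered_disjoint:
  assumes "vertex_disjoint Z" "X \<subseteq> Z" "Y \<subseteq> Z" "X \<inter> Y = {}"
  shows "covered X \<inter> covered Y = {}"
proof -
  have "set s \<inter> set t = {}" if "s \<in> X" "t \<in> Y" for s t
    using assms that unfolding vertex_disjoint_def by (metis disjnt_def disjoint_iff pairwiseD subsetD)
  then show ?thesis unfolding covered_def by blast
qed

lemma card_vertex_disjoint_le:
  assumes "vertex_disjoint Y" "finite Y" "finite B" "\<And>t. t \<in> Y \<Longrightarrow> set t \<inter> B \<noteq> {}"
  shows "card Y \<le> card B"
proof -
  have "card Y \<le> (\<Sum>t\<in>Y. card (set t \<inter> B))"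
    using sum_bounded_below[of Y 1 "\<lambda>t. card (set t \<inter> B)"] assms(4)
    by (simp add: Suc_le_eq card_gt_0_iff)
  also have "\<dots> = card (\<Union>t\<in>Y. set t \<inter> B)"
    using assms(1,2)
    by (intro card_UN_disjoint[symmetric]) (auto simp: vertex_disjoint_def pairwise_def disjnt_def)
  also have "\<dots> \<le> card B" by (rule card_mono) (use assms(3) in auto)
  finally show ?thesis .
qed

text \<open>A class consists of its key, a list of hub vertices, and its triangles.\<close>

type_synonym triangle_class = "nat list \<times> nat list list"

definition all_members :: "triangle_class list \<Rightarrow> nat list set" where
  "all_members cs = (\<Union>c\<in>set cs. set (snd c))"

lemma finite_all_members [simp]: "finite (all_members cs)"
  by (simp add: all_members_def)

lemma all_members_mono: "set cs \<subseteq> set ds \<Longrightarrow> all_members cs \<subseteq> all_members ds"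
  by (auto simp: all_members_def)

definition packing_within :: "nat set \<Rightarrow> nat set \<Rightarrow> triangle_class list \<Rightarrow> nat list set \<Rightarrow> bool" where
  "packing_within Q S cs Y \<longleftrightarrow> Y \<subseteq> all_members cs \<and> vertex_disjoint Y \<and> covered Y \<inter> Q \<subseteq> S"

locale triangle_classes =
  fixes Qs :: "nat list" and \<mu> M :: nat and cls :: "triangle_class list"
  assumes distinct_Qs: "distinct Qs" and distinct_cls: "distinct cls"
    and key_subset: "c \<in> set cls \<Longrightarrow> set (fst c) \<subseteq> set Qs"
    and length_key: "c \<in> set cls \<Longrightarrow> length (fst c) \<le> \<mu>"
    and length_members: "c \<in> set cls \<Longrightarrow> length (snd c) \<le> M"
    and member_nonempty: "c \<in> set cls \<Longrightarrow> t \<in> set (snd c) \<Longrightarrow> t \<noteq> []"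
    and member_hub_subset: "c \<in> set cls \<Longrightarrow> t \<in> set (snd c) \<Longrightarrow> set t \<inter> set Qs \<subseteq> set (fst c)"
    and class_of_member: "c \<in> set cls \<Longrightarrow> d \<in> set cls \<Longrightarrow> t \<in> set (snd c) \<Longrightarrow> t \<in> set (snd d) \<Longrightarrow> c = d"
    and class_of_vertex: "c \<in> set cls \<Longrightarrow> d \<in> set cls \<Longrightarrow> s \<in> set (snd c) \<Longrightarrow> t \<in> set (snd d) \<Longrightarrow>
      x \<in> set s \<Longrightarrow> x \<in> set t \<Longrightarrow> x \<notin> set Qs \<Longrightarrow> c = d"
begin

abbreviation Q :: "nat set" where "Q \<equiv> set Qs"

lemma packing_within_finite: "packing_within Q S cs Y \<Longrightarrow> finite Y"
  unfolding packing_within_def using finite_all_members finite_subset by blast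

lemma all_members_disjoint:
  assumes "set cs \<subseteq> set cls" "set ds \<subseteq> set cls" "set cs \<inter> set ds = {}"
  shows "all_members cs \<inter> all_members ds = {}"
  using assms class_of_member unfolding all_members_def by blast

lemma covered_Int_subset_hub:
  assumes "set cs \<subseteq> set cls" "set ds \<subseteq> set cls" "set cs \<inter> set ds = {}"
    and "Y \<subseteq> all_members cs" "Z \<subseteq> all_members ds"
  shows "covered Y \<inter> covered Z \<subseteq> Q"
proof
  fix x assume "x \<in> covered Y \<inter> covered Z"
  then obtain c d s t where "c \<in> set cs" "s \<in> set (snd c)" "x \<in> set s" "d \<in> set ds"
      "t \<in> set (snd d)" "x \<in> set t"
    using assms(4,5) unfolding covered_def all_members_def by blast
  then show "x \<in> Q" using assms(1-3) class_of_vertex[of c d s t x] by blast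
qed

lemma packing_within_Un:
  assumes sub: "set cs \<subseteq> set cls" "set ds \<subseteq> set cls" "set cs \<inter> set ds = {}"
    and Y: "packing_within Q S cs Y" and Z: "packing_within Q T ds Z"
    and disj: "covered Y \<inter> covered Z \<inter> Q = {}"
  shows "packing_within Q (S \<union> T) (cs @ ds) (Y \<union> Z)" "card (Y \<union> Z) = card Y + card Z"
proof -
  have "covered Y \<inter> covered Z \<subseteq> Q"
    using covered_Int_subset_hub[OF sub, of Y Z] Y Z by (simp add: packing_within_def)
  then have "covered Y \<inter> covered Z = {}" using disj by blast
  then show "packing_within Q (S \<union> T) (cs @ ds) (Y \<union> Z)"
    using Y Z vertex_disjoint_Un by (auto simp: packing_within_def all_members_def)
  have "Y \<inter> Z = {}" using all_members_disjoint[OF sub] Y Z by (auto simp: packing_within_def)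
  then show "card (Y \<union> Z) = card Y + card Z"
    using packing_within_finite[OF Y] packing_within_finite[OF Z] by (rule card_Un_disjoint[rotated 2])
qed

lemma packing_within_UN:
  assumes "finite I" "\<And>i. i \<in> I \<Longrightarrow> set (cs i) \<subseteq> set cls" "disjoint_family_on (\<lambda>i. set (cs i)) I"
    and Y: "\<And>i. i \<in> I \<Longrightarrow> packing_within Q (S i) (cs i) (Y i)" and S: "disjoint_family_on S I"
  shows "vertex_disjoint (\<Union>i\<in>I. Y i)" "card (\<Union>i\<in>I. Y i) = (\<Sum>i\<in>I. card (Y i))"
proof -
  have sub: "covered (Y i) \<inter> covered (Y j) \<subseteq> Q" "Y i \<inter> Y j = {}" if ij: "i \<in> I" "j \<in> I" "i \<noteq> j" for i j
  proof -
    have disj: "set (cs i) \<inter> set (cs j) = {}" using assms(3) ij unfolding disjoint_family_on_def by blast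
    note parts = assms(2)[OF ij(1)] assms(2)[OF ij(2)] disj
    show "covered (Y i) \<inter> covered (Y j) \<subseteq> Q"
      using covered_Int_subset_hub[OF parts] Y ij by (simp add: packing_within_def)
    show "Y i \<inter> Y j = {}"
      using all_members_disjoint[OF parts] Y ij by (auto simp: packing_within_def)
  qed
  have "disjoint_family_on (\<lambda>i. covered (Y i)) I"
    unfolding disjoint_family_on_def
  proof (intro ballI impI)
    fix i j assume ij: "i \<in> I" "j \<in> I" "i \<noteq> j"
    then have "S i \<inter> S j = {}" using S unfolding disjoint_family_on_def by blast
    then show "covered (Y i) \<inter> covered (Y j) = {}"
      using sub(1)[OF ij] Y[OF ij(1)] Y[OF ij(2)] unfolding packing_within_def by blast
  qed
  then show "vertex_disjoint (\<Union>i\<in>I. Y i)" using Y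
    by (intro vertex_disjoint_UN) (auto simp: packing_within_def)
  show "card (\<Union>i\<in>I. Y i) = (\<Sum>i\<in>I. card (Y i))"
    using sub(2) packing_within_finite[OF Y] assms(1) by (intro card_UN_disjoint) auto
qed

end

text \<open>
  The dynamic program runs over the classes. A state consists of the vertices of \<open>S\<close> that a packing
  occupies and of the number of its triangles.
\<close>

type_synonym packing_state = "nat list \<times> nat"

definition sub_packings :: "nat list list \<Rightarrow> nat list list list" where
  "sub_packings ts = fold (\<lambda>t L. L @ map (\<lambda>Y. t # Y)
     (filter (\<lambda>Y. \<forall>u\<in>set Y. \<forall>x\<in>set u. x \<notin> set t) L)) ts [[]]"

definition extend_states :: "nat list \<Rightarrow> nat list \<Rightarrow> triangle_class \<Rightarrow> packing_state list \<Rightarrow>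
    packing_state list" where
  "extend_states Qs S c L = remdups (concat (map (\<lambda>s. map
     (\<lambda>Y. (filter (\<lambda>q. q \<in> set (fst s) \<or> (\<exists>t\<in>set Y. q \<in> set t)) S, snd s + length Y))
     (filter (\<lambda>Y. \<forall>t\<in>set Y. \<forall>q\<in>set t. q \<notin> set Qs \<or> q \<in> set S \<and> q \<notin> set (fst s))
       (sub_packings (snd c)))) L))"

definition packing_states :: "nat list \<Rightarrow> nat list \<Rightarrow> triangle_class list \<Rightarrow> packing_state list" where
  "packing_states Qs S cs = fold (\<lambda>c L. extend_states Qs S c L) cs [([], 0)]"

definition best_packing :: "nat list \<Rightarrow> nat list \<Rightarrow> triangle_class list \<Rightarrow> nat" where
  "best_packing Qs S cs = Max (insert 0 (set (map (\<lambda>s. snd s) (packing_states Qs S cs))))"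

lemma sub_packings_snoc:
  "sub_packings (ts @ [t]) =
    sub_packings ts @ map (\<lambda>Y. t # Y) (filter (\<lambda>Y. \<forall>u\<in>set Y. \<forall>x\<in>set u. x \<notin> set t) (sub_packings ts))"
  by (simp add: sub_packings_def)

lemma disjoint_covered_iff: "(\<forall>u\<in>Y. \<forall>x\<in>set u. x \<notin> set t) \<longleftrightarrow> set t \<inter> covered Y = {}"
  by (auto simp: covered_def)

lemma sub_packings_sound:
  assumes "\<And>t. t \<in> set ts \<Longrightarrow> t \<noteq> []" "Y \<in> set (sub_packings ts)"
  shows "set Y \<subseteq> set ts \<and> vertex_disjoint (set Y) \<and> distinct Y"
  using assms
proof (induction ts arbitrary: Y rule: rev_induct)
  case Nil
  then show ?case by (simp add: sub_packings_def)
next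
  case (snoc t ts)
  consider "Y \<in> set (sub_packings ts)"
    | Y' where "Y' \<in> set (sub_packings ts)" "set t \<inter> covered (set Y') = {}" "Y = t # Y'"
    using snoc.prems(2) unfolding sub_packings_snoc disjoint_covered_iff by auto
  then show ?case
  proof cases
    case 1
    then show ?thesis using snoc.IH[of Y] snoc.prems(1) by auto
  next
    case 2
    have "t \<noteq> []" using snoc.prems(1) by simp
    then have "t \<notin> set Y'" using 2(2) unfolding covered_def by (metis Int_absorb2 UN_upper set_empty)
    then show ?thesis using 2 snoc.IH[of Y'] snoc.prems(1) by (auto simp: vertex_disjoint_insert)
  qed
qed

lemma sub_packings_complete:
  "Z \<subseteq> set ts \<Longrightarrow> vertex_disjoint Z \<Longrightarrow> \<exists>Y\<in>set (sub_packings ts). set Y = Z"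
proof (induction ts arbitrary: Z rule: rev_induct)
  case Nil
  then show ?case by (simp add: sub_packings_def)
next
  case (snoc t ts)
  show ?case
  proof (cases "t \<in> Z")
    case False
    then show ?thesis using snoc.IH[of Z] snoc.prems unfolding sub_packings_snoc by auto
  next
    case True
    let ?Z = "Z - {t}"
    have Z: "Z = insert t ?Z" "t \<notin> ?Z" using True by auto
    then have disjoint: "vertex_disjoint ?Z" "set t \<inter> covered ?Z = {}"
      using snoc.prems(2) vertex_disjoint_insert by metis+
    then obtain Y where Y: "Y \<in> set (sub_packings ts)" "set Y = ?Z"
      using snoc.IH[of ?Z] snoc.prems(1) by auto
    then have "t # Y \<in> set (sub_packings (ts @ [t]))"
      using disjoint(2) unfolding sub_packings_snoc by (simp add: disjoint_covered_iff)
    then show ?thesis using Y(2) Z(1) by (intro bexI[of _ "t # Y"]) auto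
  qed
qed

lemma length_sub_packings: "length (sub_packings ts) \<le> 2 ^ length ts"
proof (induction ts rule: rev_induct)
  case (snoc t ts)
  then show ?case
    using le_trans[OF length_filter_le snoc, of "\<lambda>Y. \<forall>u\<in>set Y. \<forall>x\<in>set u. x \<notin> set t"]
    by (simp add: sub_packings_snoc)
qed (simp add: sub_packings_def)

lemma set_extend_states:
  "set (extend_states Qs S c L) =
    {(filter (\<lambda>q. q \<in> set (fst s) \<union> covered (set Y)) S, snd s + length Y) |s Y.
       s \<in> set L \<and> Y \<in> set (sub_packings (snd c)) \<and> covered (set Y) \<inter> set Qs \<subseteq> set S - set (fst s)}"
proof -
  have "set (concat (map (\<lambda>s. map (g s) (filter (P s) Ys)) L)) =
      {g s Y |s Y. s \<in> set L \<and> Y \<in> set Ys \<and> P s Y}"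
    for g :: "packing_state \<Rightarrow> nat list list \<Rightarrow> packing_state" and P Ys by auto
  moreover have "(\<forall>t\<in>set Y. \<forall>q\<in>set t. q \<notin> set Qs \<or> q \<in> set S \<and> q \<notin> A) \<longleftrightarrow>
      covered (set Y) \<inter> set Qs \<subseteq> set S - A" for Y A
    by (auto simp: covered_def)
  moreover have "(\<exists>t\<in>set Y. q \<in> set t) \<longleftrightarrow> q \<in> covered (set Y)" for q :: nat and Y
    by (auto simp: covered_def)
  ultimately show ?thesis unfolding extend_states_def set_remdups by simp
qed

definition state_of :: "nat list \<Rightarrow> nat list set \<Rightarrow> packing_state" where
  "state_of S Y = (filter (\<lambda>q. q \<in> covered Y) S, card Y)"

lemma set_extend_states_of:
  assumes "set L = state_of S ` \<Y>"
  shows "set (extend_states Qs S c L) =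
      {(filter (\<lambda>q. q \<in> covered (Y \<union> set Z)) S, card Y + length Z) |Y Z.
    Y \<in> \<Y> \<and> Z \<in> set (sub_packings (snd c)) \<and> covered (set Z) \<inter> set Qs \<subseteq> set S - covered Y}"
proof -
  have filter: "filter (\<lambda>q. q \<in> set (fst (state_of S Y)) \<union> B) S =
      filter (\<lambda>q. q \<in> covered Y \<union> B) S" for Y B
    by (auto simp: state_of_def intro: filter_cong)
  have free: "set S - set (fst (state_of S Y)) = set S - covered Y" for Y by (auto simp: state_of_def)
  have card: "snd (state_of S Y) = card Y" for Y by (simp add: state_of_def)
  have image: "{f s Z |s Z. s \<in> state_of S ` \<Y> \<and> R s Z} =
      {f (state_of S Y) Z |Y Z. Y \<in> \<Y> \<and> R (state_of S Y) Z}"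
    for f :: "packing_state \<Rightarrow> nat list list \<Rightarrow> packing_state" and R by blast
  show ?thesis unfolding set_extend_states assms image filter free card covered_simps ..
qed

lemma distinct_packing_states: "distinct (packing_states Qs S cs)"
  by (cases cs rule: rev_cases) (simp_all add: packing_states_def extend_states_def)

context triangle_classes
begin

lemma packing_state_extend:
  assumes cs: "set (c # cs) \<subseteq> set cls" "c \<notin> set cs" and Y: "packing_within Q (set S) cs Y"
    and Z: "Z \<in> set (sub_packings (snd c))" "covered (set Z) \<inter> Q \<subseteq> set S - covered Y"
  shows "packing_within Q (set S) (cs @ [c]) (Y \<union> set Z)"
    "state_of S (Y \<union> set Z) = (filter (\<lambda>q. q \<in> covered (Y \<union> set Z)) S, card Y + length Z)"
proof -
  have Z': "set Z \<subseteq> set (snd c)" "vertex_disjoint (set Z)" "distinct Z"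
    using sub_packings_sound[OF _ Z(1)] member_nonempty[of c] cs(1) by auto
  then have "packing_within Q (set S) [c] (set Z)" using Z(2)
    by (auto simp: packing_within_def all_members_def)
  note union = packing_within_Un[OF _ _ _ Y this]
  show "packing_within Q (set S) (cs @ [c]) (Y \<union> set Z)" using union(1) cs Z(2) by auto
  have "card (Y \<union> set Z) = card Y + length Z" using union(2) cs Z(2) distinct_card[OF Z'(3)] by auto
  then show "state_of S (Y \<union> set Z) = (filter (\<lambda>q. q \<in> covered (Y \<union> set Z)) S, card Y + length Z)"
    by (simp add: state_of_def)
qed

lemma packing_within_snocE:
  assumes "packing_within Q S (cs @ [c]) Y"
  obtains Y1 Y2 where "Y = Y1 \<union> Y2" "packing_within Q S cs Y1" "Y2 \<subseteq> set (snd c)" "vertex_disjoint Y2"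
    "covered Y2 \<inter> Q \<subseteq> S - covered Y1"
proof -
  let ?Y1 = "Y \<inter> all_members cs" and ?Y2 = "Y - all_members cs"
  have Y: "Y \<subseteq> all_members cs \<union> set (snd c)" "vertex_disjoint Y" "covered Y \<inter> Q \<subseteq> S"
    using assms by (auto simp: packing_within_def all_members_def)
  have "covered ?Y1 \<inter> covered ?Y2 = {}" by (rule covered_disjoint[OF Y(2)]) auto
  then show thesis
    using Y vertex_disjoint_mono[OF Y(2)] covered_mono[of ?Y1 Y] covered_mono[of ?Y2 Y]
    by (intro that[of ?Y1 ?Y2]) (auto simp: packing_within_def)
qed

theorem set_packing_states:
  assumes "set S \<subseteq> Q" "distinct cs" "set cs \<subseteq> set cls"
  shows "set (packing_states Qs S cs) = state_of S ` {Y. packing_within Q (set S) cs Y}"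
  using assms(2,3)
proof (induction cs rule: rev_induct)
  case Nil
  then show ?case by (auto simp: packing_states_def packing_within_def all_members_def state_of_def)
next
  case (snoc c cs)
  have cs: "set (c # cs) \<subseteq> set cls" "c \<notin> set cs" using snoc.prems by auto
  let ?ext = "\<lambda>Y Z. packing_within Q (set S) cs Y \<and> Z \<in> set (sub_packings (snd c)) \<and>
    covered (set Z) \<inter> Q \<subseteq> set S - covered Y"
  have "set (packing_states Qs S cs) = state_of S ` {Y. packing_within Q (set S) cs Y}"
    using snoc by simp
  from set_extend_states_of[OF this]
  have "set (packing_states Qs S (cs @ [c])) =
      {(filter (\<lambda>q. q \<in> covered (Y \<union> set Z)) S, card Y + length Z) |Y Z. ?ext Y Z}"
    by (simp add: packing_states_def del: covered_simps)
  also have "\<dots> = {state_of S (Y \<union> set Z) |Y Z. ?ext Y Z}"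
    by (intro Collect_cong ex_cong1) (metis packing_state_extend(2)[OF cs])
  also have "\<dots> = state_of S ` {Y \<union> set Z |Y Z. ?ext Y Z}" by blast
  also have "{Y \<union> set Z |Y Z. ?ext Y Z} = {Y. packing_within Q (set S) (cs @ [c]) Y}"
  proof (intro equalityI subsetI CollectI)
    fix X assume "X \<in> {Y \<union> set Z |Y Z. ?ext Y Z}"
    then show "packing_within Q (set S) (cs @ [c]) X" using packing_state_extend(1)[OF cs] by blast
  next
    fix X assume "X \<in> {Y. packing_within Q (set S) (cs @ [c]) Y}"
    then obtain Y1 Y2 where "X = Y1 \<union> Y2" "packing_within Q (set S) cs Y1"
        "covered Y2 \<inter> Q \<subseteq> set S - covered Y1"
      and Y2: "Y2 \<subseteq> set (snd c)" "vertex_disjoint Y2"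
      by (elim CollectE packing_within_snocE)
    moreover obtain Z where "Z \<in> set (sub_packings (snd c))" "set Z = Y2"
      using sub_packings_complete[OF Y2] by blast
    ultimately show "\<exists>Y Z. X = Y \<union> set Z \<and> ?ext Y Z" by blast
  qed
  finally show ?case .
qed

lemma length_packing_states:
  assumes "set S \<subseteq> Q" "distinct cs" "set cs \<subseteq> set cls"
  shows "length (packing_states Qs S cs) \<le> 2 ^ length S * Suc (card (all_members cs))"
proof -
  let ?sub = "(\<lambda>B. filter (\<lambda>q. q \<in> B) S) ` Pow (set S)"
  have "length (packing_states Qs S cs) = card (set (packing_states Qs S cs))"
    using distinct_packing_states by (rule distinct_card[symmetric])
  also have "\<dots> \<le> card (?sub \<times> {..card (all_members cs)})"
  proof (rule card_mono)
    have "filter (\<lambda>q. q \<in> A) S = filter (\<lambda>q. q \<in> A \<inter> set S) S" for A by (auto intro: filter_cong)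
    then have "filter (\<lambda>q. q \<in> A) S \<in> ?sub" for A by (metis Int_lower2 PowI imageI)
    moreover have "card Y \<le> card (all_members cs)" if "packing_within Q (set S) cs Y" for Y
      using that by (intro card_mono) (simp_all add: packing_within_def)
    ultimately show "set (packing_states Qs S cs) \<subseteq> ?sub \<times> {..card (all_members cs)}"
      unfolding set_packing_states[OF assms] state_of_def by auto
  qed simp
  also have "\<dots> \<le> 2 ^ card (set S) * Suc (card (all_members cs))"
    using card_image_le[of "Pow (set S)" "\<lambda>B. filter (\<lambda>q. q \<in> B) S"]
    by (simp add: card_cartesian_product card_Pow del: mult_Suc_right)
  also have "\<dots> \<le> 2 ^ length S * Suc (card (all_members cs))"
    by (intro mult_le_mono1 power_increasing card_length) simp
  finally show ?thesis .
qed

lemma best_packing_ge: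
  assumes "set S \<subseteq> Q" "distinct cs" "set cs \<subseteq> set cls" "packing_within Q (set S) cs Y"
  shows "card Y \<le> best_packing Qs S cs"
proof -
  have "card Y \<in> snd ` set (packing_states Qs S cs)"
    unfolding set_packing_states[OF assms(1-3)] state_of_def using assms(4) by force
  then show ?thesis unfolding best_packing_def by (intro Max_ge) auto
qed

lemma best_packing_attained:
  assumes "set S \<subseteq> Q" "distinct cs" "set cs \<subseteq> set cls"
  obtains Y where "packing_within Q (set S) cs Y" "card Y = best_packing Qs S cs"
proof -
  have "best_packing Qs S cs \<in> insert 0 (snd ` set (packing_states Qs S cs))"
    unfolding best_packing_def set_map by (rule Max_in) auto
  then consider "best_packing Qs S cs = 0"
    | Y where "packing_within Q (set S) cs Y" "best_packing Qs S cs = card Y"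
    unfolding set_packing_states[OF assms] state_of_def by auto
  then show thesis
  proof cases
    case 1
    then show thesis by (intro that[of "{}"]) (simp_all add: packing_within_def)
  next
    case 2
    then show thesis using that by simp
  qed
qed

end

section \<open>Reduction to Set Cover\<close>

definition small_subsets :: "nat \<Rightarrow> 'a list \<Rightarrow> 'a list list" where
  "small_subsets k xs = fold (\<lambda>x L. L @ map (\<lambda>U. x # U) (filter (\<lambda>U. length U < k) L)) xs [[]]"

definition choices :: "nat \<Rightarrow> (nat \<times> nat) list" where
  "choices m = concat (map (\<lambda>s. map (\<lambda>w. (s, w)) [0..<Suc m]) [0..<Suc m])"

definition assignments :: "'a list \<Rightarrow> nat \<Rightarrow> (nat \<times> 'a) list list" where
  "assignments os r = fold (\<lambda>j L. concat (map (\<lambda>x. map (\<lambda>a. (j, x) # a) L) os)) [0..<r] [[]]"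

lemma small_subsets_snoc:
  "small_subsets k (xs @ [x]) =
    small_subsets k xs @ map (\<lambda>U. x # U) (filter (\<lambda>U. length U < k) (small_subsets k xs))"
  by (simp add: small_subsets_def)

lemma small_subsets_sound:
  "distinct xs \<Longrightarrow> U \<in> set (small_subsets k xs) \<Longrightarrow> distinct U \<and> set U \<subseteq> set xs \<and> length U \<le> k"
proof (induction xs arbitrary: U rule: rev_induct)
  case Nil
  then show ?case by (simp add: small_subsets_def)
next
  case (snoc x xs)
  consider "U \<in> set (small_subsets k xs)" | U'
      where "U' \<in> set (small_subsets k xs)" "length U' < k" "U = x # U'"
    using snoc.prems(2) unfolding small_subsets_snoc by auto
  then show ?case
  proof cases
    case 1
    then show ?thesis using snoc by auto
  next
    case 2
    then show ?thesis using snoc.IH[of U'] snoc.prems(1) by auto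
  qed
qed

lemma small_subsets_complete:
  "distinct xs \<Longrightarrow> B \<subseteq> set xs \<Longrightarrow> card B \<le> k \<Longrightarrow> \<exists>U\<in>set (small_subsets k xs). set U = B"
proof (induction xs arbitrary: B rule: rev_induct)
  case Nil
  then show ?case by (simp add: small_subsets_def)
next
  case (snoc x xs)
  show ?case
  proof (cases "x \<in> B")
    case False
    then show ?thesis using snoc.IH[of B] snoc.prems unfolding small_subsets_snoc by auto
  next
    case True
    have fin: "finite B" using snoc.prems(2) finite_subset by blast
    have "card (B - {x}) < k" using card_Diff1_less[OF fin True] snoc.prems(3) by linarith
    then obtain U where U: "U \<in> set (small_subsets k xs)" "set U = B - {x}"
      using snoc.IH[of "B - {x}"] snoc.prems by auto
    moreover have "length U < k"
      using U distinct_card[of U] small_subsets_sound[of xs U k] snoc.prems(1) \<open>card (B - {x}) < k\<close>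
      by simp
    ultimately have "x # U \<in> set (small_subsets k (xs @ [x]))" unfolding small_subsets_snoc by simp
    then show ?thesis using U(2) True by (intro bexI[of _ "x # U"]) auto
  qed
qed

lemma set_choices: "(s, w) \<in> set (choices m) \<longleftrightarrow> s \<le> m \<and> w \<le> m"
  by (auto simp: choices_def image_iff simp del: upt_Suc)

lemma length_choices: "length (choices m) = (m + 1) ^ 2"
  unfolding choices_def by (simp add: length_concat comp_def sum_list_triv power2_eq_square del: upt_Suc)

lemma assignments_Suc: "assignments os (Suc r) =
    concat (map (\<lambda>x. map (\<lambda>a. (r, x) # a) (assignments os r)) os)"
  by (simp add: assignments_def)

lemma set_assignments: "set (assignments os r) =
    {map (\<lambda>j. (j, f j)) (rev [0..<r]) |f. \<forall>j<r. f j \<in> set os}"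
proof (induction r)
  case 0
  then show ?case by (auto simp: assignments_def)
next
  case (Suc r)
  show ?case
  proof (intro equalityI subsetI)
    fix a assume "a \<in> set (assignments os (Suc r))"
    then obtain x b where x: "x \<in> set os" "b \<in> set (assignments os r)" "a = (r, x) # b"
      by (auto simp: assignments_Suc)
    then obtain f where "\<forall>j<r. f j \<in> set os" "b = map (\<lambda>j. (j, f j)) (rev [0..<r])"
      unfolding Suc.IH by blast
    then have "a = map (\<lambda>j. (j, (f(r := x)) j)) (rev [0..<Suc r])" "\<forall>j<Suc r. (f(r := x)) j \<in> set os"
      using x by (auto simp: less_Suc_eq)
    then show "a \<in> {map (\<lambda>j. (j, f j)) (rev [0..<Suc r]) |f. \<forall>j<Suc r. f j \<in> set os}" by blast
  next
    fix a assume "a \<in> {map (\<lambda>j. (j, f j)) (rev [0..<Suc r]) |f. \<forall>j<Suc r. f j \<in> set os}"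
    then obtain f where f: "\<forall>j<Suc r. f j \<in> set os" "a = (r, f r) # map (\<lambda>j. (j, f j)) (rev [0..<r])"
      by auto
    then have "map (\<lambda>j. (j, f j)) (rev [0..<r]) \<in> set (assignments os r)" unfolding Suc.IH by auto
    then show "a \<in> set (assignments os (Suc r))" unfolding assignments_Suc using f by auto
  qed
qed

lemma length_assignments: "length (assignments os r) = length os ^ r"
proof (induction r)
  case (Suc r)
  have "length (concat (map (\<lambda>x. map (\<lambda>a. (r, x) # a) L) ys)) = length ys * length L"
      for ys :: "'a list" and L
    by (induction ys) auto
  then show ?case using Suc by (simp add: assignments_Suc)
qed (simp add: assignments_def)

text \<open>
  A class is anchored at the first vertex of its key that is not in \<open>H\<close>, and belongs to the bucket
  of that vertex. The anchor is represented as a list with at most one element.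
\<close>

definition anchor :: "nat list \<Rightarrow> triangle_class \<Rightarrow> nat list" where
  "anchor H c = take 1 (filter (\<lambda>q. q \<notin> set H) (fst c))"

definition chunk :: "nat \<Rightarrow> nat list \<Rightarrow> nat \<Rightarrow> nat list" where
  "chunk g Qs j = take g (drop (j * g) Qs)"

definition bucket :: "nat \<Rightarrow> nat list \<Rightarrow> nat list \<Rightarrow> triangle_class list \<Rightarrow> nat \<Rightarrow> triangle_class list" where
  "bucket g Qs H cls j = filter (\<lambda>c. \<exists>q\<in>set (anchor H c). q \<in> set (chunk g Qs j)) cls"

definition unanchored :: "nat list \<Rightarrow> triangle_class list \<Rightarrow> triangle_class list" where
  "unanchored H cls = filter (\<lambda>c. anchor H c = []) cls"

definition bucket_count :: "nat \<Rightarrow> nat list \<Rightarrow> nat" where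
  "bucket_count g Qs = length Qs div g + 1"

text \<open>
  An entry \<open>(j, s, w)\<close> of an assignment gives \<open>s\<close> hub vertices to bucket \<open>j\<close> and demands \<open>w\<close>
  triangles more than the bucket can pack without hub vertices.
\<close>

type_synonym assignment = "(nat \<times> nat \<times> nat) list"

definition demand :: "nat \<Rightarrow> nat list \<Rightarrow> nat list \<Rightarrow> triangle_class list \<Rightarrow> nat \<times> nat \<times> nat \<Rightarrow> nat" where
  "demand g Qs H cls x = best_packing Qs [] (bucket g Qs H cls (fst x)) + snd (snd x)"

definition block_sets ::
    "nat \<Rightarrow> nat \<Rightarrow> nat list \<Rightarrow> nat list \<Rightarrow> triangle_class list \<Rightarrow> nat list \<Rightarrow> assignment \<Rightarrow>
        (nat list \<times> nat) list" where
  "block_sets m g Qs H cls T a = concat (map (\<lambda>x. map (\<lambda>U. (U, fst x))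
     (filter (\<lambda>U. length U = fst (snd x) \<and> (\<forall>q\<in>set U. q \<notin> set T) \<and>
         demand g Qs H cls x \<le> best_packing Qs U (bucket g Qs H cls (fst x)))
       (small_subsets m Qs))) a)"

definition positions :: "nat list \<Rightarrow> nat list \<Rightarrow> nat list" where
  "positions Qs U = filter (\<lambda>i. \<exists>q\<in>set (take 1 (drop i Qs)). q \<in> set U) [0..<length Qs]"

definition cover_family :: "nat list \<Rightarrow> nat \<Rightarrow> (nat list \<times> nat) list \<Rightarrow> nat list list" where
  "cover_family Qs r Bs = map (\<lambda>x. [x]) [0..<length Qs + r + r] @
     remdups (map (\<lambda>b. positions Qs (fst b) @ [length Qs + snd b, length Qs + r + snd b]) Bs)"

lemma positions_eq: "positions Qs U = filter (\<lambda>i. Qs ! i \<in> set U) [0..<length Qs]"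
  unfolding positions_def by (rule filter_cong) (auto simp: hd_drop_conv_nth take_Suc)

lemma set_positions: "set (positions Qs U) = {i. i < length Qs \<and> Qs ! i \<in> set U}"
  by (auto simp: positions_eq)

lemma card_positions: "distinct Qs \<Longrightarrow> set U \<subseteq> set Qs \<Longrightarrow> card (set (positions Qs U)) = card (set U)"
proof -
  assume Qs: "distinct Qs" and U: "set U \<subseteq> set Qs"
  have "set U = (\<lambda>i. Qs ! i) ` set (positions Qs U)"
    using U unfolding set_positions by (auto simp: image_iff) (metis in_set_conv_nth subsetD)
  moreover have "inj_on (\<lambda>i. Qs ! i) (set (positions Qs U))"
    using Qs by (auto simp: set_positions inj_on_def nth_eq_iff_index_eq)
  ultimately show ?thesis by (simp add: card_image)
qed

lemma set_cover_family:
  "set ` set (cover_family Qs r Bs) = token_family (length Qs)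
      r ((\<lambda>(U, j). (set (positions Qs U), j)) ` set Bs)"
  unfolding cover_family_def token_family_def
  by (simp add: image_Un image_image lessThan_atLeast0 case_prod_beta)

lemma cover_family_coverD:
  assumes Qs: "distinct Qs" and T: "distinct T" "set T \<subseteq> set Qs"
    and Bs: "\<And>U j. (U, j) \<in> set Bs \<Longrightarrow> set U \<subseteq> set Qs - set T \<and> j < r"
    and cover: "has_set_cover {..<length Qs + r + r} (set ` set (cover_family Qs r Bs))
        (int (r + length T))"
  shows "\<exists>U. (\<forall>j<r. (U j, j) \<in> set Bs) \<and> (\<Union>j<r. set (U j)) = set Qs - set T"
proof -
  let ?\<A> = "(\<lambda>(U, j). (set (positions Qs U), j)) ` set Bs"
  let ?T = "set (positions Qs T)"
  have T_sub: "?T \<subseteq> {..<length Qs}" by (auto simp: set_positions)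
  have card_T: "card ?T = length T" using card_positions[OF Qs T(2)] distinct_card[OF T(1)] by simp
  obtain \<S> where \<S>: "\<S> \<subseteq> token_family (length Qs) r ?\<A>" "\<Union>\<S> = {..<length Qs + r + r}"
      "card \<S> \<le> r + card ?T"
    using cover unfolding has_set_cover_def set_cover_family card_T by auto
  have fin: "finite \<S>" by (rule finite_subset[OF \<S>(1)]) (simp flip: set_cover_family)
  have block: "A \<subseteq> {..<length Qs} - ?T \<and> j < r" if A: "(A, j) \<in> ?\<A>" for A j
  proof -
    obtain U where "(U, j) \<in> set Bs" "A = set (positions Qs U)" using A by auto
    then show ?thesis using Bs[of U j] by (auto simp: set_positions)
  qed
  obtain F where F: "\<forall>j<r. (F j, j) \<in> ?\<A>" "{..<length Qs} - ?T \<subseteq> (\<Union>j<r. F j)"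
    using token_family_coverD[OF block T_sub \<S>(1,2) fin \<S>(3)] by blast
  then have "\<forall>j<r. \<exists>U. (U, j) \<in> set Bs \<and> F j = set (positions Qs U)" by fast
  then obtain U where U: "\<And>j. j < r \<Longrightarrow> (U j, j) \<in> set Bs \<and> F j = set (positions Qs (U j))" by metis
  have "q \<in> (\<Union>j<r. set (U j))" if q: "q \<in> set Qs - set T" for q
  proof -
    obtain i where i: "i < length Qs" "q = Qs ! i" using q by (auto simp: in_set_conv_nth)
    then have "i \<in> {..<length Qs} - ?T" using q by (simp add: set_positions)
    then obtain j where "j < r" "i \<in> F j" using F(2) by blast
    then show ?thesis using U[of j] i by (auto simp: set_positions)
  qed
  moreover have "(\<Union>j<r. set (U j)) \<subseteq> set Qs - set T" using U Bs by blast
  ultimately show ?thesis using U by (intro exI[of _ U]) blast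
qed

lemma cover_family_coverI:
  assumes Qs: "distinct Qs" and T: "distinct T" "set T \<subseteq> set Qs"
    and U: "\<And>j. j < r \<Longrightarrow> (U j, j) \<in> set Bs" "(\<Union>j<r. set (U j)) = set Qs - set T"
  shows "has_set_cover {..<length Qs + r + r} (set ` set (cover_family Qs r Bs)) (int (r + length T))"
proof -
  let ?\<A> = "(\<lambda>(U, j). (set (positions Qs U), j)) ` set Bs"
  let ?T = "set (positions Qs T)"
  have T_sub: "?T \<subseteq> {..<length Qs}" by (auto simp: set_positions)
  have card_T: "card ?T = length T" using card_positions[OF Qs T(2)] distinct_card[OF T(1)] by simp
  have union: "(\<Union>j<r. set (positions Qs (U j))) = {..<length Qs} - ?T"
  proof (rule set_eqI)
    fix i
    have "(\<exists>j<r. Qs ! i \<in> set (U j)) \<longleftrightarrow> Qs ! i \<in> set Qs - set T" using U(2) by blast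
    then show "i \<in> (\<Union>j<r. set (positions Qs (U j))) \<longleftrightarrow> i \<in> {..<length Qs} - ?T"
      by (auto simp: set_positions)
  qed
  have block: "(set (positions Qs (U j)), j) \<in> ?\<A>" if "j < r" for j using U(1)[OF that] by force
  obtain \<S> where "\<S> \<subseteq> token_family (length Qs) r ?\<A>" "\<Union>\<S> = {..<length Qs + r + r}" "card \<S> \<le> r + card ?T"
    using token_family_coverI[OF block union T_sub] by blast
  then show ?thesis
    unfolding has_set_cover_def set_cover_family card_T by (intro exI[of _ \<S>]) simp
qed

lemma cover_family_instance:
  assumes Qs: "distinct Qs" and Bs: "\<And>U j. (U, j) \<in> set Bs \<Longrightarrow> j < r \<and> length U \<le> m \<and> set U \<subseteq> set Qs"
  shows "set_cover_instance (m + 2) {..<length Qs + r + r} (set ` set (cover_family Qs r Bs))"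
proof -
  have "X \<subseteq> {..<length Qs + r + r} \<and> card X \<le> m + 2"
    if "X \<in> set ` set (cover_family Qs r Bs)" for X
    using that unfolding set_cover_family
  proof (cases rule: token_familyE)
    case (1 x)
    then show ?thesis by simp
  next
    case (2 A j)
    then obtain U where U: "(U, j) \<in> set Bs" "A = set (positions Qs U)" by auto
    then have "card A = card (set U)" using card_positions[OF Qs, of U] Bs[OF U(1)] by simp
    then have "card A \<le> m" using Bs[OF U(1)] card_length[of U] by linarith
    moreover have "card {length Qs + j, length Qs + r + j} \<le> 2" by (rule card_insert_le_m1) simp_all
    ultimately have "card X \<le> m + 2"
      using card_Un_le[of A "{length Qs + j, length Qs + r + j}"] unfolding 2(2) by linarith
    then show ?thesis using 2(2) U(2) Bs[OF U(1)] by (auto simp: set_positions)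
  qed
  moreover have "{..<length Qs + r + r} \<subseteq> \<Union>(set ` set (cover_family Qs r Bs))"
    unfolding set_cover_family token_family_def by auto
  ultimately show ?thesis unfolding set_cover_instance_def by (intro conjI ballI equalityI) auto
qed

lemma lists_family_cover_family:
  assumes Bs: "\<And>U j. (U, j) \<in> set Bs \<Longrightarrow> j < r"
  shows "lists_family (cover_family Qs r Bs) (set ` set (cover_family Qs r Bs))"
proof -
  let ?p = "length Qs"
  let ?block = "\<lambda>b. positions Qs (fst b) @ [?p + snd b, ?p + r + snd b]"
  let ?singles = "map (\<lambda>x. [x]) [0..<?p + r + r]" and ?blocks = "remdups (map ?block Bs)"
  have "inj_on set (?block ` set Bs)"
  proof (rule inj_onI, elim imageE)
    fix xs ys b c assume bc: "set xs = set ys" "xs = ?block b" "ys = ?block c" "b \<in> set Bs" "c \<in> set Bs"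
    then have j: "snd b < r" "snd c < r" using Bs[of "fst b" "snd b"] Bs[of "fst c" "snd c"] by auto
    have parts: "set (?block d) \<inter> {..<?p} = set (positions Qs (fst d))"
        "set (?block d) \<inter> {?p..<?p + r} = {?p + snd d}"
      if "snd d < r" for d using that by (auto simp: set_positions)
    have "set (positions Qs (fst b)) = set (positions Qs (fst c))" using parts(1) j bc(1-3) by metis
    then have "positions Qs (fst b) = positions Qs (fst c)" unfolding positions_eq
      by (intro filter_cong) auto
    moreover have "snd b = snd c" using parts(2)[OF j(1)] parts(2)[OF j(2)]
      unfolding bc(1)[unfolded bc(2,3)] by simp
    ultimately show "xs = ys" using bc by simp
  qed
  then have "distinct (map set ?blocks)" by (simp add: distinct_map)
  moreover have "distinct (map set ?singles)" by (simp add: distinct_map inj_on_def)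
  moreover have "set (map set ?singles) \<inter> set (map set ?blocks) = {}"
  proof -
    have "{x} \<noteq> set (?block b)" if "b \<in> set Bs" for x b using Bs[of "fst b" "snd b"] that by auto
    then show ?thesis by auto
  qed
  ultimately have "distinct (map set (cover_family Qs r Bs))" by (simp add: cover_family_def)
  moreover have "\<forall>xs\<in>set (cover_family Qs r Bs). distinct xs"
    using Bs unfolding cover_family_def by (fastforce simp: positions_eq)
  ultimately show ?thesis by (simp add: lists_family_def lists_set_def)
qed

section \<open>Correctness of the search\<close>

definition promising :: "nat \<Rightarrow> nat \<Rightarrow> nat list \<Rightarrow> nat list \<Rightarrow> triangle_class list \<Rightarrow> packing_state \<Rightarrow>
    assignment \<Rightarrow> bool" where
  "promising g t Qs H cls s a \<longleftrightarrow> t \<le> sum_list (map (\<lambda>x. demand g Qs H cls x) a) + snd s \<and>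
     sum_list (map (\<lambda>x. fst (snd x)) a) + length (fst s) = length Qs"

definition covers_blocks :: "nat \<Rightarrow> nat \<Rightarrow> nat list \<Rightarrow> nat list \<Rightarrow> triangle_class list \<Rightarrow> nat list \<Rightarrow>
    assignment \<Rightarrow> bool" where
  "covers_blocks m g Qs H cls T a \<longleftrightarrow>
     has_set_cover {..<length Qs + bucket_count g Qs + bucket_count g Qs}
       (set ` set (cover_family Qs (bucket_count g Qs) (block_sets m g Qs H cls T a)))
           (int (bucket_count g Qs + length T))"

definition search :: "nat \<Rightarrow> nat \<Rightarrow> nat \<Rightarrow> nat \<Rightarrow> nat list \<Rightarrow> triangle_class list \<Rightarrow> bool" where
  "search m g h t Qs cls \<longleftrightarrow> (\<exists>H\<in>set (small_subsets (length Qs div h) Qs).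
     \<exists>s\<in>set (packing_states Qs H (unanchored H cls)). \<exists>a\<in>set
         (assignments (choices m) (bucket_count g Qs)).
       promising g t Qs H cls s a \<and> covers_blocks m g Qs H cls (fst s) a)"

lemma in_set_chunk_iff:
  assumes "0 < g"
  shows "q \<in> set (chunk g Qs j) \<longleftrightarrow> (\<exists>i<length Qs. i div g = j \<and> Qs ! i = q)"
proof
  assume "q \<in> set (chunk g Qs j)"
  then obtain i where "i < g" "j * g + i < length Qs" "Qs ! (j * g + i) = q"
    by (auto simp: chunk_def in_set_conv_nth)
  moreover have "(j * g + i) div g = j" using \<open>i < g\<close> by simp
  ultimately show "\<exists>i<length Qs. i div g = j \<and> Qs ! i = q" by blast
next
  assume "\<exists>i<length Qs. i div g = j \<and> Qs ! i = q"
  then obtain i where i: "i < length Qs" "i div g = j" "Qs ! i = q" by blast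
  then have "j * g + i mod g = i" "i mod g < g" using assms by auto
  moreover from this have "i mod g < length (chunk g Qs j)" using i(1) unfolding chunk_def by auto
  ultimately show "q \<in> set (chunk g Qs j)"
    using i unfolding in_set_conv_nth by (intro exI[of _ "i mod g"]) (simp add: chunk_def)
qed

lemma card_chunk_le: "card (set (chunk g Qs j)) \<le> g"
  using card_length[of "chunk g Qs j"] by (simp add: chunk_def)

lemma set_anchor: "set (anchor H c) \<subseteq> set (fst c) - set H"
  unfolding anchor_def using set_take_subset[of 1 "filter (\<lambda>q. q \<notin> set H) (fst c)"] by auto

lemma anchor_unique: "q \<in> set (anchor H c) \<Longrightarrow> q' \<in> set (anchor H c) \<Longrightarrow> q = q'"
  unfolding anchor_def by (cases "filter (\<lambda>q. q \<notin> set H) (fst c)") auto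

lemma anchor_empty_iff: "anchor H c = [] \<longleftrightarrow> set (fst c) \<subseteq> set H"
  unfolding anchor_def by (auto simp: filter_empty_conv)

lemma block_sets_iff:
  "(U, j) \<in> set (block_sets m g Qs H cls T a) \<longleftrightarrow> U \<in> set (small_subsets m Qs) \<and> set U \<inter> set T = {} \<and>
    (\<exists>s w. (j, s, w) \<in> set a \<and> length U = s \<and> demand g Qs H cls (j, s, w) \<le> best_packing Qs U
        (bucket g Qs H cls j))"
proof -
  have "(U, j) \<in> set (block_sets m g Qs H cls T a) \<longleftrightarrow>
      (\<exists>x\<in>set a. j = fst x \<and> U \<in> set (small_subsets m Qs) \<and>
      length U = fst (snd x) \<and> set U \<inter> set T = {} \<and> demand g Qs H cls x \<le> best_packing Qs U
          (bucket g Qs H cls j))"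
    unfolding block_sets_def by auto
  then show ?thesis by (simp add: Bex_def) blast
qed

lemma disjoint_family_on_if_sum_card_le:
  assumes "finite I" "\<And>i. i \<in> I \<Longrightarrow> finite (A i)" "(\<Sum>i\<in>I. card (A i)) \<le> card (\<Union>i\<in>I. A i)"
  shows "disjoint_family_on A I"
  unfolding disjoint_family_on_def
proof (intro ballI impI, rule ccontr)
  fix i j assume ij: "i \<in> I" "j \<in> I" "i \<noteq> j" and "A i \<inter> A j \<noteq> {}"
  then obtain x where x: "x \<in> A i" "x \<in> A j" by blast
  let ?A = "A(i := A i - {x})"
  have "(\<Union>j\<in>I. A j) = (\<Union>j\<in>I. ?A j)" using ij x by (auto split: if_splits)
  then have "card (\<Union>j\<in>I. A j) \<le> (\<Sum>j\<in>I. card (?A j))" using card_UN_le[OF assms(1), of ?A] by simp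
  also have "\<dots> < (\<Sum>j\<in>I. card (A j))"
    using assms(1,2) ij x card_Diff1_less[of "A i" x]
    by (intro sum_strict_mono_ex1) (auto intro!: bexI[of _ i] less_imp_le)
  finally show False using assms(3) by simp
qed

lemma sum_list_map_pairs: "(\<Sum>x\<leftarrow>map (\<lambda>j. (j, f j)) (rev [0..<r]). h x) = (\<Sum>j<r. h (j, f j))"
  by (induction r) (simp_all add: add.commute)

context triangle_classes
begin

lemma bucket_facts:
  "distinct (bucket g Qs H cls j)" "set (bucket g Qs H cls j) \<subseteq> set cls"
  "distinct (unanchored H cls)" "set (unanchored H cls) \<subseteq> set cls"
  using distinct_cls by (auto simp: bucket_def unanchored_def)

lemma bucket_unique:
  assumes "0 < g" "c \<in> set (bucket g Qs H cls i)" "c \<in> set (bucket g Qs H cls j)"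
  shows "i = j"
proof -
  obtain q q' where "q \<in> set (anchor H c)" "q \<in> set (chunk g Qs i)" "q' \<in> set (anchor H c)"
      "q' \<in> set (chunk g Qs j)"
    using assms(2,3) unfolding bucket_def by auto
  then have "q \<in> set (chunk g Qs i)" "q \<in> set (chunk g Qs j)" using anchor_unique by metis+
  then show ?thesis unfolding in_set_chunk_iff[OF assms(1)]
    using distinct_Qs nth_eq_iff_index_eq by metis
qed

lemma bucket_unanchored_disjoint: "set (bucket g Qs H cls j) \<inter> set (unanchored H cls) = {}"
  by (auto simp: bucket_def unanchored_def)

lemma bucket_or_unanchored:
  assumes "0 < g" "c \<in> set cls"
  shows "(\<exists>j<bucket_count g Qs. c \<in> set (bucket g Qs H cls j)) \<or> c \<in> set (unanchored H cls)"
proof (cases "anchor H c")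
  case (Cons q qs)
  then have "q \<in> set (anchor H c)" by simp
  moreover have "q \<in> Q" using calculation set_anchor[of H c] key_subset[OF assms(2)] by blast
  then obtain i where "i < length Qs" "Qs ! i = q" by (auto simp: in_set_conv_nth)
  then have "q \<in> set (chunk g Qs (i div g))" unfolding in_set_chunk_iff[OF assms(1)] by blast
  moreover have "i div g < bucket_count g Qs"
    using \<open>i < length Qs\<close> by (simp add: bucket_count_def div_le_mono le_imp_less_Suc)
  ultimately show ?thesis using assms(2) by (auto simp: bucket_def)
qed (use assms in \<open>simp add: unanchored_def\<close>)

lemma combine_packings:
  assumes g: "0 < g"
    and buckets: "\<And>j. j < r \<Longrightarrow> packing_within Q (S j) (bucket g Qs H cls j) (Y j)"
    and rest: "packing_within Q T (unanchored H cls) Z"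
    and S: "disjoint_family_on S {..<r}" "\<And>j. j < r \<Longrightarrow> S j \<inter> T = {}"
  shows "\<exists>X\<subseteq>all_members cls. vertex_disjoint X \<and> card X = (\<Sum>j<r. card (Y j)) + card Z"
proof -
  let ?X = "\<Union>j<r. Y j"
  have "disjoint_family_on (\<lambda>j. set (bucket g Qs H cls j)) {..<r}"
    unfolding disjoint_family_on_def using bucket_unique[OF g] by blast
  note union = packing_within_UN[OF _ bucket_facts(2) this _ S(1), of Y]
  have X: "vertex_disjoint ?X" "card ?X = (\<Sum>j<r. card (Y j))" using union buckets by simp_all
  let ?cs = "concat (map (\<lambda>j. bucket g Qs H cls j) [0..<r])"
  have sub: "set ?cs \<subseteq> set cls" "set ?cs \<inter> set (unanchored H cls) = {}"
    unfolding set_concat set_map using bucket_facts(2) bucket_unanchored_disjoint by blast+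
  have "packing_within Q (\<Union>j<r. S j) ?cs ?X"
    unfolding packing_within_def
  proof (intro conjI X(1))
    show "?X \<subseteq> all_members ?cs" using buckets by (fastforce simp: packing_within_def all_members_def)
    show "covered ?X \<inter> Q \<subseteq> (\<Union>j<r. S j)" using buckets by (fastforce simp: packing_within_def)
  qed
  moreover have "covered ?X \<inter> covered Z \<inter> Q = {}"
    using buckets rest S(2) unfolding packing_within_def by fastforce
  ultimately have "packing_within Q ((\<Union>j<r. S j) \<union> T) (?cs @ unanchored H cls) (?X \<union> Z)"
    "card (?X \<union> Z) = card ?X + card Z"
    using packing_within_Un[OF sub(1) bucket_facts(4) sub(2) _ rest] by blast+
  then show ?thesis
    using X(2) all_members_mono[of "?cs @ unanchored H cls" cls] sub(1) bucket_facts(4)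
    by (intro exI[of _ "?X \<union> Z"]) (auto simp: packing_within_def)
qed

lemma disjoint_blocks_if_covered:
  assumes T: "distinct T" "set T \<subseteq> Q"
    and size: "(\<Sum>j<bucket_count g Qs. fst (f j)) + length T = length Qs"
    and covers: "covers_blocks m g Qs H cls T (map (\<lambda>j. (j, f j)) (rev [0..<bucket_count g Qs]))"
  obtains U where "disjoint_family_on (\<lambda>j. set (U j)) {..<bucket_count g Qs}"
    "\<And>j. j < bucket_count g Qs \<Longrightarrow> set (U j) \<subseteq> Q - set T \<and>
      demand g Qs H cls (j, f j) \<le> best_packing Qs (U j) (bucket g Qs H cls j)"
proof -
  let ?r = "bucket_count g Qs"
  let ?Bs = "block_sets m g Qs H cls T (map (\<lambda>j. (j, f j)) (rev [0..<?r]))"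
  have blocks: "distinct U \<and> set U \<subseteq> Q - set T \<and> length U = fst (f j) \<and> j < ?r \<and>
      demand g Qs H cls (j, f j) \<le> best_packing Qs U (bucket g Qs H cls j)" if "(U, j) \<in> set ?Bs" for U j
  proof -
    have "U \<in> set (small_subsets m Qs)" "set U \<inter> set T = {}" "length U = fst (f j)" "j < ?r"
      "demand g Qs H cls (j, f j) \<le> best_packing Qs U (bucket g Qs H cls j)"
      using that unfolding block_sets_iff by (auto dest: arg_cong[where f = fst])
    then show ?thesis using small_subsets_sound[OF distinct_Qs, of U m] by blast
  qed
  then have "\<And>U j. (U, j) \<in> set ?Bs \<Longrightarrow> set U \<subseteq> Q - set T \<and> j < ?r" by blast
  from cover_family_coverD[OF distinct_Qs T this covers[unfolded covers_blocks_def]]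
  obtain U where U: "\<forall>j<?r. (U j, j) \<in> set ?Bs" "(\<Union>j<?r. set (U j)) = Q - set T" by blast
  have "(\<Sum>j<?r. card (set (U j))) = (\<Sum>j<?r. fst (f j))"
    using U(1) blocks distinct_card by (intro sum.cong) fastforce+
  then have "(\<Sum>j<?r. card (set (U j))) \<le> card (\<Union>j<?r. set (U j))"
    unfolding U(2) using size card_Diff_subset[OF _ T(2)] distinct_card[OF T(1)]
      distinct_card[OF distinct_Qs] by simp
  then have "disjoint_family_on (\<lambda>j. set (U j)) {..<?r}"
    by (intro disjoint_family_on_if_sum_card_le) simp_all
  then show thesis using that U(1) blocks by blast
qed

lemma search_sound:
  assumes g: "0 < g" and search: "search m g h t Qs cls"
  shows "\<exists>Y\<subseteq>all_members cls. vertex_disjoint Y \<and> t \<le> card Y"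
proof -
  let ?r = "bucket_count g Qs"
  obtain H T v f where H: "H \<in> set (small_subsets (length Qs div h) Qs)"
    and Tv: "(T, v) \<in> set (packing_states Qs H (unanchored H cls))"
    and a: "promising g t Qs H cls (T, v) (map (\<lambda>j. (j, f j)) (rev [0..<?r]))"
      "covers_blocks m g Qs H cls T (map (\<lambda>j. (j, f j)) (rev [0..<?r]))"
    using search unfolding search_def set_assignments by auto
  have total: "t \<le> (\<Sum>j<?r. demand g Qs H cls (j, f j)) + v" "(\<Sum>j<?r. fst (f j)) + length T = length Qs"
    using a(1) unfolding promising_def sum_list_map_pairs by simp_all
  have H': "distinct H" "set H \<subseteq> Q" using small_subsets_sound[OF distinct_Qs H] by auto
  obtain Z where Z: "packing_within Q (set H) (unanchored H cls) Z" "T = filter (\<lambda>q. q \<in> covered Z) H"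
      "v = card Z"
    using Tv unfolding set_packing_states[OF H'(2) bucket_facts(3,4)] state_of_def by blast
  have T: "distinct T" "set T \<subseteq> Q" "packing_within Q (set T) (unanchored H cls) Z"
    using H' Z unfolding packing_within_def by auto
  obtain U where disjoint: "disjoint_family_on (\<lambda>j. set (U j)) {..<?r}"
    and U: "\<And>j. j < ?r \<Longrightarrow> set (U j) \<subseteq> Q - set T \<and> demand g Qs H cls (j, f j) \<le>
        best_packing Qs (U j) (bucket g Qs H cls j)"
    using disjoint_blocks_if_covered[OF T(1,2) total(2) a(2)] by blast
  have "\<exists>Y. packing_within Q (set (U j)) (bucket g Qs H cls j) Y \<and> demand g Qs H cls (j, f j) \<le> card Y"
      if "j < ?r" for j
    using best_packing_attained[OF _ bucket_facts(1,2), of "U j" g H j] U[OF that]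
    by (metis Diff_subset order_trans)
  then obtain Y where Y: "\<And>j. j < ?r \<Longrightarrow> packing_within Q (set (U j)) (bucket g Qs H cls j) (Y j)"
    "\<And>j. j < ?r \<Longrightarrow> demand g Qs H cls (j, f j) \<le> card (Y j)" by metis
  have "set (U j) \<inter> set T = {}" if "j < ?r" for j using U[OF that] by blast
  from combine_packings[OF g Y(1) T(3) disjoint this]
  obtain X where X: "X \<subseteq> all_members cls" "vertex_disjoint X" "card X = (\<Sum>j<?r. card (Y j)) + card Z"
    by blast
  note total(1)
  also have "(\<Sum>j<?r. demand g Qs H cls (j, f j)) + v \<le> card X"
    unfolding X(3) Z(3) by (intro add_mono sum_mono Y(2)) simp_all
  finally show ?thesis using X by blast
qed

definition active :: "nat list set \<Rightarrow> triangle_class set" where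
  "active Y = {c \<in> set cls. covered (Y \<inter> set (snd c)) \<inter> Q \<noteq> {}}"

definition heavy_vertices :: "nat \<Rightarrow> nat list set \<Rightarrow> nat set" where
  "heavy_vertices D Y = heavy D (\<lambda>c. set (fst c)) (active Y)"

abbreviation bucket_packing :: "nat \<Rightarrow> nat list \<Rightarrow> nat list set \<Rightarrow> nat \<Rightarrow> nat list set" where
  "bucket_packing g H Y j \<equiv> Y \<inter> all_members (bucket g Qs H cls j)"

lemma finite_active: "finite (active Y)"
  by (simp add: active_def)

lemma card_active_le:
  assumes "vertex_disjoint Y"
  shows "card (active Y) \<le> length Qs"
proof -
  let ?used = "\<lambda>c. covered (Y \<inter> set (snd c)) \<inter> Q"
  have "disjoint_family_on ?used (active Y)"
    unfolding disjoint_family_on_def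
  proof (intro ballI impI)
    fix c d assume "c \<in> active Y" "d \<in> active Y" "c \<noteq> d"
    then have "(Y \<inter> set (snd c)) \<inter> (Y \<inter> set (snd d)) = {}"
      using class_of_member[of c d] unfolding active_def by blast
    then have "covered (Y \<inter> set (snd c)) \<inter> covered (Y \<inter> set (snd d)) = {}"
      by (intro covered_disjoint[OF assms]) auto
    then show "?used c \<inter> ?used d = {}" by blast
  qed
  then have "(\<Sum>c\<in>active Y. card (?used c)) = card (\<Union>c\<in>active Y. ?used c)"
    by (intro card_UN_disjoint'[symmetric] finite_active) auto
  also have "\<dots> \<le> card Q" by (rule card_mono) auto
  finally have "(\<Sum>c\<in>active Y. card (?used c)) \<le> length Qs" by (simp add: distinct_card[OF distinct_Qs])
  moreover have "1 \<le> card (?used c)" if "c \<in> active Y" for c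
    using that by (simp add: active_def Suc_le_eq card_gt_0_iff)
  ultimately show ?thesis using sum_bounded_below[of "active Y" 1 "\<lambda>c. card (?used c)"] by simp
qed

lemma heavy_vertices_subset: "heavy_vertices D Y \<subseteq> Q"
proof -
  have "set (fst c) \<subseteq> Q" if "c \<in> active Y" for c using that key_subset[of c] by (simp add: active_def)
  then show ?thesis unfolding heavy_vertices_def using heavy_subset[of D "\<lambda>c. set (fst c)" "active Y"]
    by blast
qed

lemma card_heavy_vertices_le:
  assumes "vertex_disjoint Y" "0 < \<mu>" "0 < h"
  shows "card (heavy_vertices (\<mu> * h) Y) \<le> length Qs div h"
proof -
  have "card (set (fst c)) \<le> \<mu>" if "c \<in> active Y" for c
    using that length_key[of c] card_length[of "fst c"] by (simp add: active_def)
  then have "\<mu> * h * card (heavy_vertices (\<mu> * h) Y) \<le> card (active Y) * \<mu>"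
    unfolding heavy_vertices_def by (intro card_heavy_le finite_active) simp_all
  also have "\<dots> \<le> length Qs * \<mu>" by (intro mult_le_mono1 card_active_le assms(1))
  finally have "\<mu> * (card (heavy_vertices (\<mu> * h) Y) * h) \<le> \<mu> * length Qs" by (simp only: mult_ac)
  then show ?thesis using assms(2,3) by (simp add: less_eq_div_iff_mult_less_eq)
qed

lemma card_active_bucket_le:
  assumes H: "set H = heavy_vertices D Y"
  shows "card (active Y \<inter> set (bucket g Qs H cls j)) \<le> g * D"
proof -
  let ?chunk = "set (chunk g Qs j) - set H"
  let ?at = "\<lambda>q. {c \<in> active Y. q \<in> set (fst c)}"
  have "active Y \<inter> set (bucket g Qs H cls j) \<subseteq> (\<Union>q\<in>?chunk. ?at q)"
    using set_anchor by (fastforce simp: bucket_def)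
  then have "card (active Y \<inter> set (bucket g Qs H cls j)) \<le> card (\<Union>q\<in>?chunk. ?at q)"
    using finite_active by (intro card_mono) auto
  also have "\<dots> \<le> (\<Sum>q\<in>?chunk. card (?at q))" by (rule card_UN_le) simp
  also have "\<dots> \<le> card ?chunk * D"
    using H sum_bounded_above[of ?chunk "\<lambda>q. card (?at q)" D]
    by (simp add: heavy_vertices_def heavy_def not_less)
  also have "card ?chunk \<le> g" using card_mono[of "set (chunk g Qs j)" ?chunk] card_chunk_le[of g Qs j]
    by simp
  finally show ?thesis by simp
qed

lemma card_bucket_hub_vertices_le:
  assumes "set H = heavy_vertices D Y"
  shows "card (covered (bucket_packing g H Y j) \<inter> Q) \<le> g * D * \<mu>"
proof -
  let ?B = "active Y \<inter> set (bucket g Qs H cls j)"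
  have "covered (bucket_packing g H Y j) \<inter> Q \<subseteq> (\<Union>c\<in>?B. set (fst c))"
  proof
    fix x assume "x \<in> covered (bucket_packing g H Y j) \<inter> Q"
    then obtain c t where x: "x \<in> set t" "x \<in> Q" "t \<in> Y" "c \<in> set (bucket g Qs H cls j)"
        "t \<in> set (snd c)"
      unfolding covered_def all_members_def by blast
    then have c: "c \<in> set cls" using bucket_facts(2) by blast
    moreover have "x \<in> covered (Y \<inter> set (snd c)) \<inter> Q" using x unfolding covered_def by blast
    ultimately have "c \<in> ?B" using x(4) unfolding active_def by blast
    then show "x \<in> (\<Union>c\<in>?B. set (fst c))" using member_hub_subset[OF c x(5)] x(1,2) by blast
  qed
  then have "card (covered (bucket_packing g H Y j) \<inter> Q) \<le> card (\<Union>c\<in>?B. set (fst c))"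
    using finite_active by (intro card_mono) auto
  also have "\<dots> \<le> (\<Sum>c\<in>?B. card (set (fst c)))" using finite_active by (intro card_UN_le) simp
  also have "\<dots> \<le> card ?B * \<mu>"
  proof (rule order_trans[OF sum_bounded_above])
    show "card (set (fst c)) \<le> \<mu>" if "c \<in> ?B" for c
      using that length_key[of c] card_length[of "fst c"] by (simp add: active_def)
  qed simp
  also have "\<dots> \<le> g * D * \<mu>" by (rule mult_le_mono1[OF card_active_bucket_le[OF assms]])
  finally show ?thesis .
qed

lemma card_packing_le_best:
  assumes "distinct cs" "set cs \<subseteq> set cls" "Y \<subseteq> all_members cs" "vertex_disjoint Y"
  shows "card Y \<le> best_packing Qs [] cs + card (covered Y \<inter> Q)"
proof -
  let ?free = "{t \<in> Y. set t \<inter> Q = {}}" and ?hub = "{t \<in> Y. set t \<inter> Q \<noteq> {}}"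
  have fin: "finite Y" using assms(3) finite_all_members finite_subset by blast
  have "packing_within Q (set []) cs ?free"
    using assms(3) vertex_disjoint_mono[OF assms(4)] by (auto simp: packing_within_def covered_def)
  then have "card ?free \<le> best_packing Qs [] cs" using assms(1,2) by (intro best_packing_ge) auto
  moreover have "card ?hub \<le> card (covered Y \<inter> Q)"
    using fin vertex_disjoint_mono[OF assms(4)]
    by (intro card_vertex_disjoint_le) (auto simp: covered_def)
  moreover have "card Y \<le> card ?free + card ?hub"
    using card_Un_le[of ?free ?hub]
    by (simp add: Collect_disj_eq[symmetric] conj_disj_distribL[symmetric])
  ultimately show ?thesis by linarith
qed

lemma exists_block_partition:
  assumes Y: "vertex_disjoint Y" and g: "0 < g"
    and Z: "Z \<subseteq> Y" "Z \<inter> (\<Union>j<bucket_count g Qs. bucket_packing g H Y j) = {}"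
    and m: "g \<le> m" "\<And>j. card (covered (bucket_packing g H Y j) \<inter> Q) \<le> m"
  obtains U where "disjoint_family_on (\<lambda>j. set (U j)) {..<bucket_count g Qs}"
    "(\<Union>j<bucket_count g Qs. set (U j)) = Q - covered Z"
    "\<And>j. j < bucket_count g Qs \<Longrightarrow> U j \<in> set (small_subsets m Qs) \<and> covered (bucket_packing g H Y j) \<inter> Q
        \<subseteq> set (U j)"
proof -
  let ?r = "bucket_count g Qs" and ?Y = "bucket_packing g H Y"
  have members: "?Y i \<inter> ?Y j = {}" if "i \<noteq> j" for i j
  proof -
    have "set (bucket g Qs H cls i) \<inter> set (bucket g Qs H cls j) = {}"
      using bucket_unique[OF g] that by blast
    then show ?thesis using all_members_disjoint[OF bucket_facts(2,2), of g H i g H j] by blast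
  qed
  have "disjoint_family_on (\<lambda>j. covered (?Y j) \<inter> Q) {..<?r}"
    unfolding disjoint_family_on_def using covered_disjoint[OF Y _ _ members] by blast
  moreover have "covered (?Y j) \<inter> Q \<subseteq> Q - covered Z" if "j < ?r" for j
    using covered_disjoint[OF Y _ Z(1), of "?Y j"] Z(2) that by blast
  moreover have "card (Q - covered Z) \<le> card {..<?r} * m"
  proof -
    have "card (Q - covered Z) \<le> length Qs"
      using card_mono[of Q "Q - covered Z"] distinct_card[OF distinct_Qs] by simp
    also have "\<dots> \<le> ?r * g"
      using dividend_less_div_times[OF g, of "length Qs"] by (simp add: bucket_count_def algebra_simps)
    also have "\<dots> \<le> ?r * m" by (rule mult_le_mono2[OF m(1)])
    finally show ?thesis by simp
  qed
  ultimately obtain S where S: "disjoint_family_on S {..<?r}" "(\<Union>j<?r. S j) = Q - covered Z"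
    "\<forall>j<?r. covered (?Y j) \<inter> Q \<subseteq> S j \<and> card (S j) \<le> m"
    using extend_to_partition[of "Q - covered Z" "{..<?r}" "\<lambda>j. covered (?Y j) \<inter> Q" m] m(2) by auto
  then have "\<exists>U\<in>set (small_subsets m Qs). set U = S j" if "j < ?r" for j
    using that by (intro small_subsets_complete[OF distinct_Qs]) auto
  then obtain U where "\<And>j. j < ?r \<Longrightarrow> U j \<in> set (small_subsets m Qs) \<and> set (U j) = S j" by metis
  then show thesis using S by (intro that[of U]) (auto simp: disjoint_family_on_def)
qed

definition surplus_assignment :: "nat \<Rightarrow> nat list \<Rightarrow> nat list set \<Rightarrow> (nat \<Rightarrow> nat list) \<Rightarrow> assignment" where
  "surplus_assignment g H Y U = map (\<lambda>j. (j, length (U j),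
     card (bucket_packing g H Y j) - best_packing Qs [] (bucket g Qs H cls j)))
         (rev [0..<bucket_count g Qs])"

lemma surplus_assignment_in_assignments:
  assumes Y: "vertex_disjoint Y" "\<And>j. card (covered (bucket_packing g H Y j) \<inter> Q) \<le> m"
    and U: "\<And>j. j < bucket_count g Qs \<Longrightarrow> U j \<in> set (small_subsets m Qs)"
  shows "surplus_assignment g H Y U \<in> set (assignments (choices m) (bucket_count g Qs))"
proof -
  let ?f = "\<lambda>j. (length (U j), card (bucket_packing g H Y j) - best_packing Qs [] (bucket g Qs H cls j))"
  have "card (bucket_packing g H Y j) \<le> best_packing Qs [] (bucket g Qs H cls j) + m" for j
    using card_packing_le_best[OF bucket_facts(1,2), of "bucket_packing g H Y j" g H j] Y(2)[of j]
      vertex_disjoint_mono[OF Y(1), of "bucket_packing g H Y j"] by fastforce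
  then have "\<forall>j<bucket_count g Qs. ?f j \<in> set (choices m)"
    using U small_subsets_sound[OF distinct_Qs] unfolding set_choices
    by (simp add: le_diff_conv add.commute)
  then show ?thesis unfolding surplus_assignment_def set_assignments
    by (intro CollectI exI[of _ ?f] conjI refl)
qed

lemma surplus_in_block_sets:
  assumes Y: "vertex_disjoint Y" "covered (bucket_packing g H Y j) \<inter> Q \<subseteq> set (U j)"
    and U: "U j \<in> set (small_subsets m Qs)" "set (U j) \<inter> set T = {}" and j: "j < bucket_count g Qs"
  shows "(U j, j) \<in> set (block_sets m g Qs H cls T (surplus_assignment g H Y U))"
proof -
  let ?cs = "bucket g Qs H cls j" and ?Y = "bucket_packing g H Y j"
  have sub: "set (U j) \<subseteq> Q" using small_subsets_sound[OF distinct_Qs U(1)] by simp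
  obtain Z where "packing_within Q (set []) ?cs Z" "card Z = best_packing Qs [] ?cs"
    using best_packing_attained[OF _ bucket_facts(1,2), of "[]" g H j]
    by (metis empty_subsetI list.set(1))
  then have "best_packing Qs [] ?cs \<le> best_packing Qs (U j) ?cs"
    using best_packing_ge[OF sub bucket_facts(1,2), of g H j Z] by (simp add: packing_within_def)
  moreover have "packing_within Q (set (U j)) ?cs ?Y"
    using Y(2) vertex_disjoint_mono[OF Y(1)] by (simp add: packing_within_def)
  then have "card ?Y \<le> best_packing Qs (U j) ?cs" by (rule best_packing_ge[OF sub bucket_facts(1,2)])
  ultimately have "demand g Qs H cls (j, length (U j), card ?Y - best_packing Qs [] ?cs) \<le>
      best_packing Qs (U j) ?cs"
    by (simp add: demand_def)
  then show ?thesis unfolding block_sets_iff surplus_assignment_def using U j by force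
qed

lemma promising_surplus_assignment:
  assumes Y: "Y \<subseteq> all_members cls" "t \<le> card Y" and g: "0 < g"
    and U: "disjoint_family_on (\<lambda>j. set (U j)) {..<bucket_count g Qs}"
        "(\<Union>j<bucket_count g Qs. set (U j)) = Q - covered Z"
      "\<And>j. j < bucket_count g Qs \<Longrightarrow> distinct (U j)"
    and Z: "Z = Y \<inter> all_members (unanchored H cls)" and T: "distinct T" "set T = Q \<inter> covered Z"
  shows "promising g t Qs H cls (T, card Z) (surplus_assignment g H Y U)"
proof -
  let ?r = "bucket_count g Qs" and ?Y = "bucket_packing g H Y"
  let ?f = "\<lambda>j. (length (U j), card (?Y j) - best_packing Qs [] (bucket g Qs H cls j))"
  have fin: "finite Y" using Y(1) finite_all_members finite_subset by blast
  have "Y \<subseteq> (\<Union>j<?r. ?Y j) \<union> Z"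
  proof
    fix t assume "t \<in> Y"
    then obtain c where "c \<in> set cls" "t \<in> set (snd c)" using Y(1) unfolding all_members_def by blast
    then show "t \<in> (\<Union>j<?r. ?Y j) \<union> Z"
      using bucket_or_unanchored[OF g, of c H] \<open>t \<in> Y\<close> unfolding Z all_members_def by blast
  qed
  then have "card Y \<le> card ((\<Union>j<?r. ?Y j) \<union> Z)" using fin Z by (intro card_mono) auto
  also have "\<dots> \<le> card (\<Union>j<?r. ?Y j) + card Z" by (rule card_Un_le)
  also have "card (\<Union>j<?r. ?Y j) \<le> (\<Sum>j<?r. card (?Y j))" by (rule card_UN_le) simp
  also have "\<dots> \<le> (\<Sum>j<?r. demand g Qs H cls (j, ?f j))" by (intro sum_mono) (simp add: demand_def)
  also have "\<dots> = (\<Sum>x\<leftarrow>surplus_assignment g H Y U. demand g Qs H cls x)"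
    unfolding surplus_assignment_def by (rule sum_list_map_pairs[symmetric])
  finally have "t \<le> (\<Sum>x\<leftarrow>surplus_assignment g H Y U. demand g Qs H cls x) + card Z" using Y(2) by simp
  moreover have "(\<Sum>j<?r. card (set (U j))) = card (Q - covered Z)"
    unfolding U(2)[symmetric] by (rule card_UN_disjoint'[OF U(1), symmetric]) simp_all
  then have "(\<Sum>j<?r. length (U j)) = card (Q - covered Z)" using distinct_card[OF U(3)] by simp
  then have "(\<Sum>x\<leftarrow>surplus_assignment g H Y U. fst (snd x)) + length T = length Qs"
    unfolding surplus_assignment_def sum_list_map_pairs
    using card_Int_Diff[of Q "covered Z"] distinct_card[OF T(1)] T(2) distinct_card[OF distinct_Qs]
    by simp
  ultimately show ?thesis unfolding promising_def by simp
qed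

lemma packing_within_unanchored:
  assumes "vertex_disjoint Y"
  shows "packing_within Q (set H) (unanchored H cls) (Y \<inter> all_members (unanchored H cls))"
proof -
  have "covered (Y \<inter> all_members (unanchored H cls)) \<inter> Q \<subseteq> set H"
    using member_hub_subset by (fastforce simp: covered_def all_members_def unanchored_def
      anchor_empty_iff)
  then show ?thesis using vertex_disjoint_mono[OF assms] by (simp add: packing_within_def)
qed

lemma search_complete:
  assumes Y: "Y \<subseteq> all_members cls" "vertex_disjoint Y" "t \<le> card Y" and pos: "0 < \<mu>" "0 < g" "0 < h"
    and m: "m = g * (\<mu> * h) * \<mu>"
  shows "search m g h t Qs cls"
proof -
  let ?r = "bucket_count g Qs"
  obtain H where H: "H \<in> set (small_subsets (length Qs div h) Qs)" "set H = heavy_vertices (\<mu> * h) Y"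
    using small_subsets_complete[OF distinct_Qs heavy_vertices_subset
      card_heavy_vertices_le[OF Y(2) pos(1,3)]] by blast
  have H': "distinct H" "set H \<subseteq> Q" using small_subsets_sound[OF distinct_Qs H(1)] by auto
  have hub: "card (covered (bucket_packing g H Y j) \<inter> Q) \<le> m" for j
    unfolding m by (rule card_bucket_hub_vertices_le[OF H(2)])
  define Z where "Z = Y \<inter> all_members (unanchored H cls)"
  have Z: "packing_within Q (set H) (unanchored H cls) Z" unfolding Z_def
    by (rule packing_within_unanchored[OF Y(2)])
  define T where "T = filter (\<lambda>q. q \<in> covered Z) H"
  have state: "(T, card Z) \<in> set (packing_states Qs H (unanchored H cls))"
    unfolding set_packing_states[OF H'(2) bucket_facts(3,4)] state_of_def T_def using Z by blast
  have T: "distinct T" "set T \<subseteq> Q" "set T = Q \<inter> covered Z"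
    using H' Z unfolding T_def packing_within_def by auto
  have "Z \<inter> (\<Union>j<?r. bucket_packing g H Y j) = {}"
    using all_members_disjoint[OF bucket_facts(2,4) bucket_unanchored_disjoint] unfolding Z_def by blast
  moreover have "1 * (g * 1) \<le> \<mu> * (g * (\<mu> * h))" using pos by (intro mult_le_mono) simp_all
  then have "g \<le> m" by (simp add: m mult_ac)
  ultimately obtain U where U: "disjoint_family_on (\<lambda>j. set (U j)) {..<?r}"
      "(\<Union>j<?r. set (U j)) = Q - covered Z"
    "\<And>j. j < ?r \<Longrightarrow> U j \<in> set (small_subsets m Qs) \<and> covered (bucket_packing g H Y j) \<inter> Q \<subseteq> set (U j)"
    using exists_block_partition[OF Y(2) pos(2) _ _ _ hub] unfolding Z_def by (metis Int_lower1)
  let ?a = "surplus_assignment g H Y U"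
  have "set (U j) \<inter> set T = {}" if "j < ?r" for j using U(2) T(3) that by blast
  then have "(U j, j) \<in> set (block_sets m g Qs H cls T ?a)" if "j < ?r" for j
    using U(3) that by (intro surplus_in_block_sets Y(2)) blast+
  moreover have "(\<Union>j<?r. set (U j)) = Q - set T" using U(2) T(3) by blast
  ultimately have "covers_blocks m g Qs H cls T ?a"
    unfolding covers_blocks_def by (intro cover_family_coverI[OF distinct_Qs T(1,2)])
  moreover have "distinct (U j)" if "j < ?r" for j
    using U(3)[OF that] small_subsets_sound[OF distinct_Qs] by blast
  then have "promising g t Qs H cls (T, card Z) ?a"
    by (rule promising_surplus_assignment[OF Y(1,3) pos(2) U(1,2) _ Z_def T(1,3)])
  moreover have "?a \<in> set (assignments (choices m) ?r)"
    using U(3) by (intro surplus_assignment_in_assignments Y(2) hub) blast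
  ultimately show ?thesis unfolding search_def using H(1) state by force
qed

end

section \<open>Running time of the search\<close>

lemma polytime_if_ostar:
  assumes "computes_ostar D f W" "poly_bounded D W" "poly_bounded D (\<lambda>c. enc_size (f c))"
  shows "polytime_on D f"
proof -
  obtain e where e: "computes D f (\<lambda>c. enc_size c ^ e * W c)" using assms(1)
    unfolding computes_ostar_def by blast
  show ?thesis by (rule polytime_onI[OF e]) (intro poly_bounded_intros assms)+
qed

lemma computes_ostar_conj:
  assumes "polytime_on D b" "computes_ostar {c\<in>D. b c} f W" "\<And>c. c \<in> D \<Longrightarrow> 1 \<le> W c"
  shows "computes_ostar D (\<lambda>c. b c \<and> f c) W"
proof -
  have "computes_ostar {c\<in>D. \<not> b c} (\<lambda>_. False) (\<lambda>_. 1)" using polytime_const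
    unfolding polytime_on_def by blast
  then have "computes_ostar {c\<in>D. \<not> b c} (\<lambda>_. False) W"
    by (rule computes_ostar_mono) (use assms(3) in auto)
  from computes_ostar_if[OF assms(1,2) this assms(3)] show ?thesis by (rule computes_ostar_mono) auto
qed

definition binomial_sum :: "nat \<Rightarrow> nat \<Rightarrow> nat" where
  "binomial_sum n k = (\<Sum>i\<le>k. n choose i)"

lemma binomial_sum_mono: "m \<le> n \<Longrightarrow> binomial_sum m k \<le> binomial_sum n k"
  unfolding binomial_sum_def by (intro sum_mono binomial_right_mono)

lemma power_le_binomial_sum: "k \<le> n \<Longrightarrow> 2 ^ k \<le> binomial_sum n k"
  using binomial_sum_mono[of k n k] choose_row_sum[of k] by (simp add: binomial_sum_def)

lemma binomial_sum_pos: "1 \<le> binomial_sum n k"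
proof -
  have "n choose 0 \<le> binomial_sum n k" unfolding binomial_sum_def by (rule member_le_sum) auto
  then show ?thesis by simp
qed

lemma length_filter_small_subsets:
  "j \<le> Suc k \<Longrightarrow> length (filter (\<lambda>U. length U < j) (small_subsets k xs)) = (\<Sum>i<j. length xs choose i)"
proof (induction xs arbitrary: j rule: rev_induct)
  case Nil
  then show ?case by (cases j) (simp_all add: small_subsets_def lessThan_Suc_eq_insert_0 sum.reindex)
next
  case (snoc x xs)
  show ?case
  proof (cases j)
    case (Suc i)
    have "filter (\<lambda>U. length U < j) (map (\<lambda>U. x # U) (filter (\<lambda>U. length U < k) L)) =
        map (\<lambda>U. x # U) (filter (\<lambda>U. length U < i) L)" for L :: "'a list list"
      using snoc.prems Suc by (simp add: filter_map comp_def) (auto intro: filter_cong)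
    then have "length (filter (\<lambda>U. length U < j) (small_subsets k (xs @ [x]))) =
        (\<Sum>i<j. length xs choose i) + (\<Sum>l<i. length xs choose l)"
      unfolding small_subsets_snoc using snoc.IH[of j] snoc.IH[of i] snoc.prems Suc by simp
    also have "\<dots> = (\<Sum>l<j. Suc (length xs) choose l)"
      unfolding Suc sum.lessThan_Suc_shift by (simp add: sum.distrib)
    finally show ?thesis by simp
  qed simp
qed

lemma length_small_subsets: "length (small_subsets k xs) = binomial_sum (length xs) k"
proof -
  have "filter (\<lambda>U. length U < Suc k) (small_subsets k xs) = small_subsets k xs"
  proof (rule filter_True, rule ballI)
    fix U assume "U \<in> set (small_subsets k xs)"
    then show "length U < Suc k"
      by (induction xs arbitrary: U rule: rev_induct)
        (auto simp: small_subsets_snoc, simp add: small_subsets_def)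
  qed
  then show ?thesis using length_filter_small_subsets[of "Suc k" k xs]
    by (simp add: binomial_sum_def lessThan_Suc_atMost)
qed

lemma enc_size_small_subset: "U \<in> set (small_subsets k xs) \<Longrightarrow> enc_size U \<le> enc_size xs"
proof (induction xs arbitrary: U rule: rev_induct)
  case Nil
  then show ?case by (simp add: small_subsets_def)
next
  case (snoc x xs)
  have "enc_size (xs @ [x]) = enc_size xs + enc_size x" using enc_size_append[of xs "[x]"] by simp
  then show ?case using snoc.IH snoc.prems unfolding small_subsets_snoc by fastforce
qed

lemma enc_size_small_subsets:
  "enc_size (small_subsets k xs) \<le> binomial_sum (length xs) k * (2 + enc_size xs)"
proof -
  have "enc_size (small_subsets k xs) \<le> 2 + length (small_subsets k xs) * enc_size xs"
    by (rule enc_size_list_le) (rule enc_size_small_subset)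
  then show ?thesis using binomial_sum_pos[of "length xs" k] unfolding length_small_subsets
    by (simp add: algebra_simps)
qed

lemma computes_ostar_small_subsets:
  "\<exists>a. computes_ostar UNIV (\<lambda>(k, xs :: 'a::encodable list). small_subsets k xs)
      (\<lambda>(k, xs). binomial_sum (length xs) k ^ a)"
  unfolding small_subsets_def case_prod_beta
proof (rule computes_ostar_fold[where E = UNIV and S = "\<lambda>c :: nat \<times> 'a list. 2 + enc_size (snd c)"
      and f = "\<lambda>x L (c :: nat \<times> 'a list). L @ map (\<lambda>U. x # U) (filter (\<lambda>U. length U < fst c) L)"],
          fold small_subsets_def)
  fix c :: "nat \<times> 'a list" and ys zs assume split: "snd c = ys @ zs"
  have "enc_size (small_subsets (fst c) ys) \<le> binomial_sum (length ys) (fst c) * (2 + enc_size ys)"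
    by (rule enc_size_small_subsets)
  also have "\<dots> \<le> binomial_sum (length (snd c)) (fst c) * (2 + enc_size (snd c))"
    using split enc_size_prefix_le[OF split] by (intro mult_le_mono binomial_sum_mono) auto
  finally show "enc_size (small_subsets (fst c) ys) \<le> binomial_sum (length (snd c)) (fst c)
      * (2 + enc_size (snd c))" .
qed (intro polytime poly_bounded_intros polytime_enc_size UNIV_I binomial_sum_pos)+

lemma binomial_sum_le_power: "binomial_sum n k \<le> (n + 1) ^ k"
proof (induction k)
  case (Suc k)
  have "n choose Suc k \<le> n ^ Suc k"
    by (cases "Suc k \<le> n") (auto simp del: binomial_Suc_Suc power_Suc intro: binomial_le_pow
      simp: binomial_eq_0)
  also have "\<dots> \<le> n * (n + 1) ^ k" by (simp add: power_mono)
  finally show ?case using Suc by (simp add: binomial_sum_def algebra_simps)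
qed (simp add: binomial_sum_def)

lemma polytime_small_subsets[polytime]:
  assumes "polytime_on D xs"
  shows "polytime_on D (\<lambda>c. small_subsets k (xs c))"
proof (rule polytime_comp_UNIV[OF _ assms])
  have length: "poly_bounded UNIV (\<lambda>xs :: 'b list. binomial_sum (length xs) k)"
  proof (rule poly_bounded_mono[OF poly_bounded_power[OF poly_bounded_enc_size] order_refl])
    fix xs :: "'b list"
    have "(length xs + 1) ^ k \<le> enc_size xs ^ k" using length_le_enc_size[of xs]
      by (intro power_mono) auto
    then show "binomial_sum (length xs) k \<le> enc_size xs ^ k"
      using binomial_sum_le_power le_trans by blast
  qed
  obtain a where "computes_ostar UNIV (\<lambda>(k, xs :: 'b list). small_subsets k xs)
      (\<lambda>(k, xs). binomial_sum (length xs) k ^ a)"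
    using computes_ostar_small_subsets by blast
  from computes_ostar_comp[OF polytime_Pair[OF polytime_const polytime_id] this, of UNIV k]
  have "computes_ostar UNIV (small_subsets k :: 'b list \<Rightarrow> _) (\<lambda>xs. binomial_sum (length xs) k ^ a)"
    by (simp add: one_le_power[OF binomial_sum_pos, unfolded One_nat_def] case_prod_beta)
  then show "polytime_on UNIV (small_subsets k :: 'b list \<Rightarrow> _)"
  proof (rule polytime_if_ostar)
    show "poly_bounded UNIV (\<lambda>xs :: 'b list. enc_size (small_subsets k xs))"
      by (rule poly_bounded_mono[OF poly_bounded_mult[OF length
        poly_bounded_add[OF poly_bounded_const poly_bounded_enc_size]]
            order_refl]) (rule enc_size_small_subsets)
  qed (intro poly_bounded_intros length)
qed

lemma enc_size_assignment:
  "a \<in> set (assignments os r) \<Longrightarrow> enc_size a \<le> 2 + r * (2 * r + 2 + enc_size os)"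
proof -
  assume "a \<in> set (assignments os r)"
  then obtain f where f: "\<forall>j<r. f j \<in> set os" "a = map (\<lambda>j. (j, f j)) (rev [0..<r])"
    unfolding set_assignments by blast
  have "enc_size x \<le> 2 * r + 2 + enc_size os" if "x \<in> set a" for x
    using that f enc_size_member[of _ os] by fastforce
  then have "enc_size a \<le> 2 + length a * (2 * r + 2 + enc_size os)" by (rule enc_size_list_le)
  then show ?thesis by (simp add: f(2))
qed

lemma computes_ostar_assignments:
  "\<exists>a. computes_ostar {(os, r). os \<noteq> []} (\<lambda>(os :: 'a::encodable list, r). assignments os r)
      (\<lambda>(os, r). (length os ^ r) ^ a)"
  unfolding assignments_def case_prod_beta
proof (rule computes_ostar_fold[where E = UNIV
      and S = "\<lambda>c :: 'a list \<times> nat. 2 + (2 + snd c * (2 * snd c + 2 + enc_size (fst c)))"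
      and f = "\<lambda>(j :: nat) L (c :: 'a list \<times> nat). concat (map (\<lambda>x. map (\<lambda>a. (j, x) # a) L) (fst c))"])
  let ?D = "{c :: 'a list \<times> nat. fst c \<noteq> []}"
  show "poly_bounded ?D (\<lambda>c. 2 + (2 + snd c * (2 * snd c + 2 + enc_size (fst c))))"
    by (intro poly_bounded_intros polytime_enc_size polytime polytime_nat_bounded)
  fix c ys zs assume c: "c \<in> ?D" and "[0..<snd c] = ys @ zs"
  then have "ys = take (length ys) [0..<snd c]" by simp
  moreover have "length ys \<le> snd c" using \<open>[0..<snd c] = ys @ zs\<close>
    by (metis length_append length_upt diff_zero le_add1)
  ultimately obtain k where k: "ys = [0..<k]" "k \<le> snd c" by (simp add: take_upt)
  have pos: "1 \<le> length (fst c) ^ i" for i using c by (simp add: Suc_le_eq)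
  let ?S = "\<lambda>k. 2 + k * (2 * k + 2 + enc_size (fst c))"
  have "enc_size (assignments (fst c) k) \<le> 2 + length (assignments (fst c) k) * ?S k"
    by (rule enc_size_list_le) (rule enc_size_assignment)
  also have "\<dots> \<le> 2 + length (fst c) ^ snd c * ?S (snd c)"
    unfolding length_assignments using k(2) pos[of 1]
    by (intro add_mono mult_le_mono power_increasing) auto
  also have "\<dots> \<le> length (fst c) ^ snd c * (2 + ?S (snd c))" using pos[of "snd c"]
    by (simp add: add_mult_distrib2)
  finally show "enc_size (fold (\<lambda>j L. concat (map (\<lambda>x. map (\<lambda>a. (j, x) # a) L) (fst c))) ys [[]])
      \<le> length (fst c) ^ snd c * (2 + ?S (snd c))"
    unfolding k(1) assignments_def[symmetric] .
qed (intro polytime UNIV_I | simp add: Suc_le_eq)+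

lemma enc_size_sub_packing: "Y \<in> set (sub_packings ts) \<Longrightarrow> enc_size Y \<le> enc_size ts"
proof (induction ts arbitrary: Y rule: rev_induct)
  case Nil
  then show ?case by (simp add: sub_packings_def)
next
  case (snoc t ts)
  have "enc_size (ts @ [t]) = enc_size ts + enc_size t" using enc_size_append[of ts "[t]"] by simp
  then show ?case using snoc.IH snoc.prems unfolding sub_packings_snoc by fastforce
qed

lemma polytime_sub_packings: "polytime_on {ts. length ts \<le> M} sub_packings"
  unfolding sub_packings_def[abs_def]
proof (rule polytime_fold[where E = UNIV and S = "\<lambda>ts. 2 + 2 ^ M * enc_size ts"], fold sub_packings_def)
  fix ts ys zs :: "nat list list" assume ts: "ts \<in> {ts. length ts \<le> M}" "ts = ys @ zs"
  have "enc_size (sub_packings ys) \<le> 2 + length (sub_packings ys) * enc_size ys"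
    by (rule enc_size_list_le) (rule enc_size_sub_packing)
  also have "\<dots> \<le> 2 + 2 ^ M * enc_size ts"
    using ts enc_size_prefix_le[OF ts(2)]
    by (intro add_mono mult_le_mono le_trans[OF length_sub_packings power_increasing]) auto
  finally show "enc_size (sub_packings ys) \<le> 2 + 2 ^ M * enc_size ts" .
qed (intro polytime poly_bounded_intros UNIV_I)+

lemma polytime_extend_states:
  "polytime_on {(Qs, S, c, L). length (snd c) \<le> M} (\<lambda>(Qs, S, c, L). extend_states Qs S c L)"
  unfolding extend_states_def case_prod_beta
  by (intro polytime polytime_comp[OF polytime_sub_packings]) auto

definition packing_domain :: "nat \<Rightarrow> nat \<Rightarrow> (nat list \<times> nat list \<times> triangle_class list) set" where
  "packing_domain \<mu> M = {(Qs, S, cs). set S \<subseteq> set Qs \<and> distinct cs \<and>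
      (\<exists>cls. triangle_classes Qs \<mu> M cls \<and> set cs \<subseteq> set cls)}"

lemma card_all_members_le: "card (all_members cs) \<le> enc_size cs"
proof -
  have "card (all_members cs) \<le> length (concat (map snd cs))"
    using card_length[of "concat (map snd cs)"] by (simp add: all_members_def)
  also have "\<dots> \<le> enc_size cs"
  proof (induction cs)
    case (Cons c cs)
    then show ?case using length_le_enc_size[of "snd c"] by (simp add: enc_size_prod)
  qed simp
  finally show ?thesis .
qed

lemma enc_size_packing_state:
  assumes "(Qs, S, cs) \<in> packing_domain \<mu> M" "s \<in> set (packing_states Qs S cs)"
  shows "enc_size s \<le> enc_size S + (2 * enc_size cs + 2)"
proof -
  obtain cls where cls: "triangle_classes Qs \<mu> M cls" "set S \<subseteq> set Qs" "distinct cs" "set cs \<subseteq> set cls"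
    using assms(1) unfolding packing_domain_def by blast
  obtain Y where Y: "Y \<subseteq> all_members cs" "s = (filter (\<lambda>q. q \<in> covered Y) S, card Y)"
    using assms(2) triangle_classes.set_packing_states[OF cls]
    unfolding packing_within_def state_of_def by blast
  have "card Y \<le> enc_size cs" using card_mono[OF finite_all_members Y(1)] card_all_members_le le_trans
    by blast
  then show ?thesis using enc_size_filter_le[of _ S] unfolding Y(2) by (simp add: add_le_mono)
qed

lemma length_packing_states_le:
  assumes "(Qs, S, cs) \<in> packing_domain \<mu> M"
  shows "length (packing_states Qs S cs) \<le> 2 ^ length S * (enc_size cs + 1)"
proof -
  obtain cls where cls: "triangle_classes Qs \<mu> M cls" "set S \<subseteq> set Qs" "distinct cs" "set cs \<subseteq> set cls"
    using assms unfolding packing_domain_def by blast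
  have "2 ^ length S * Suc (card (all_members cs)) \<le> 2 ^ length S * (enc_size cs + 1)"
    using card_all_members_le[of cs] by (intro mult_le_mono2) simp
  then show ?thesis using triangle_classes.length_packing_states[OF cls] by linarith
qed

lemma enc_size_packing_states:
  assumes "(Qs, S, cs) \<in> packing_domain \<mu> M"
  shows "enc_size (packing_states Qs S cs) \<le>
      2 ^ length S * (2 + (enc_size cs + 1) * (enc_size S + (2 * enc_size cs + 2)))"
proof -
  let ?B = "enc_size S + (2 * enc_size cs + 2)"
  have "enc_size (packing_states Qs S cs) \<le> 2 + length (packing_states Qs S cs) * ?B"
    by (rule enc_size_list_le) (rule enc_size_packing_state[OF assms])
  also have "\<dots> \<le> 2 + 2 ^ length S * (enc_size cs + 1) * ?B"
    by (intro add_left_mono mult_le_mono1 length_packing_states_le[OF assms])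
  also have "\<dots> \<le> 2 ^ length S * 2 + 2 ^ length S * ((enc_size cs + 1) * ?B)"
    unfolding mult.assoc by (intro add_right_mono) simp
  finally show ?thesis by (simp only: add_mult_distrib2)
qed

lemma packing_domain_prefix: "(Qs, S, ys @ zs) \<in> packing_domain \<mu> M \<Longrightarrow> (Qs, S, ys) \<in> packing_domain \<mu> M"
  unfolding packing_domain_def by auto

lemma computes_ostar_packing_states:
  "\<exists>a. computes_ostar (packing_domain \<mu> M) (\<lambda>(Qs, S, cs). packing_states Qs S cs)
      (\<lambda>(Qs, S, cs). (2 ^ length S) ^ a)"
  unfolding packing_states_def case_prod_beta
proof (rule computes_ostar_fold[where E = "{p. length (snd (fst p)) \<le> M}"
      and S = "\<lambda>c. 2 + (enc_size (snd (snd c)) + 1)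
          * (enc_size (fst (snd c)) + (2 * enc_size (snd (snd c)) + 2))"
      and f = "\<lambda>d L c. extend_states (fst c) (fst (snd c)) d L"], fold packing_states_def)
  have "polytime_on {p. length (snd (fst p)) \<le> M}
      (\<lambda>p :: triangle_class \<times> packing_state list \<times> nat list \<times> nat list \<times> triangle_class list.
        (fst (snd (snd p)), fst (snd (snd (snd p))), fst p, fst (snd p)))" by (intro polytime)
  from polytime_comp[OF polytime_extend_states this, of M]
  show "polytime_on {p. length (snd (fst p)) \<le> M}
      (\<lambda>p :: triangle_class \<times> packing_state list \<times> nat list \<times> nat list \<times> triangle_class list.
      extend_states (fst (snd (snd p))) (fst (snd (snd (snd p)))) (fst p) (fst (snd p)))" by simp
  fix c ys zs assume c: "c \<in> packing_domain \<mu> M" and split: "snd (snd c) = ys @ zs"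
  obtain Qs S where c': "c = (Qs, S, ys @ zs)" using split by (metis prod.collapse)
  have size: "enc_size ys \<le> enc_size (snd (snd c))" by (rule enc_size_prefix_le[OF split])
  have "enc_size (packing_states Qs S ys) \<le>
      2 ^ length S * (2 + (enc_size ys + 1) * (enc_size S + (2 * enc_size ys + 2)))"
    by (rule enc_size_packing_states[OF packing_domain_prefix]) (use c c' in simp)
  also have "\<dots> \<le> 2 ^ length S * (2 + (enc_size (snd (snd c)) + 1)
      * (enc_size S + (2 * enc_size (snd (snd c)) + 2)))"
    using size by (intro mult_le_mono add_mono order_refl)
  finally show "enc_size (packing_states (fst c) (fst (snd c)) ys) \<le> 2 ^ length (fst (snd c)) *
      (2 + (enc_size (snd (snd c)) + 1) * (enc_size (fst (snd c)) + (2 * enc_size (snd (snd c)) + 2)))"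
    by (simp add: c')
next
  fix c ys d zs assume "c \<in> packing_domain \<mu> M" "snd (snd c) = ys @ d # zs"
  then obtain cls where "triangle_classes (fst c) \<mu> M cls" "d \<in> set cls"
    unfolding packing_domain_def by auto
  then show "(d, packing_states (fst c) (fst (snd c)) ys, c) \<in> {p. length (snd (fst p)) \<le> M}"
    using triangle_classes.length_members by fastforce
qed (intro polytime poly_bounded_intros polytime_enc_size | simp)+

lemma polytime_best_packing:
  assumes pt: "polytime_on D Qs" "polytime_on D S" "polytime_on D cs"
    and dom: "\<And>c. c \<in> D \<Longrightarrow> (Qs c, S c, cs c) \<in> packing_domain \<mu> M" "\<And>c. c \<in> D \<Longrightarrow> length (S c) \<le> m"
  shows "polytime_on D (\<lambda>c. best_packing (Qs c) (S c) (cs c))"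
proof -
  obtain a where a: "computes_ostar (packing_domain \<mu> M) (\<lambda>(Qs, S, cs). packing_states Qs S cs)
      (\<lambda>(Qs, S, cs). (2 ^ length S) ^ a)"
    using computes_ostar_packing_states by blast
  have pow: "2 ^ length (S c) \<le> (2::nat) ^ m" if "c \<in> D" for c using dom(2)[OF that]
    by (intro power_increasing) simp_all
  have "polytime_on D (\<lambda>c. packing_states (Qs c) (S c) (cs c))"
  proof (rule polytime_if_ostar)
    show "computes_ostar D (\<lambda>c. packing_states (Qs c) (S c) (cs c)) (\<lambda>c. (2 ^ length (S c)) ^ a)"
      using computes_ostar_comp[OF polytime_Pair[OF pt(1) polytime_Pair[OF pt(2,3)]] a dom(1)]
      by (simp add: case_prod_beta)
    show "poly_bounded D (\<lambda>c. (2 ^ length (S c)) ^ a)"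
      by (rule poly_bounded_mono[OF poly_bounded_const[of D "(2 ^ m) ^ a"] order_refl])
        (intro power_mono pow, simp_all)
    have "poly_bounded D (\<lambda>c. 2 ^ m
        * (2 + (enc_size (cs c) + 1) * (enc_size (S c) + (2 * enc_size (cs c) + 2))))"
      by (intro poly_bounded_intros polytime_enc_size pt)
    then show "poly_bounded D (\<lambda>c. enc_size (packing_states (Qs c) (S c) (cs c)))"
      by (rule poly_bounded_mono) (use enc_size_packing_states[OF dom(1)] pow in
        \<open>blast intro: le_trans mult_le_mono1\<close>)+
  qed
  then show ?thesis unfolding best_packing_def
    by (intro polytime_Max polytime_map polytime_snd polytime_fst polytime_id)
qed

lemma polytime_anchor[polytime]:
  assumes "polytime_on D H" "polytime_on D d"
  shows "polytime_on D (\<lambda>c. anchor (H c) (d c))"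
  by (rule polytime_comp2[OF _ assms]) (unfold anchor_def, intro polytime)

lemma polytime_bucket[polytime]:
  assumes "polytime_on D Qs" "polytime_on D H" "polytime_on D cls" "polytime_on D j"
  shows "polytime_on D (\<lambda>c. bucket g (Qs c) (H c) (cls c) (j c))"
  by (rule polytime_comp4[OF _ assms]) (unfold bucket_def chunk_def, intro polytime)

lemma polytime_unanchored[polytime]:
  assumes "polytime_on D H" "polytime_on D cls"
  shows "polytime_on D (\<lambda>c. unanchored (H c) (cls c))"
  by (rule polytime_comp2[OF _ assms]) (unfold unanchored_def, intro polytime)

lemma polytime_bucket_count[polytime]: "polytime_on D Qs \<Longrightarrow> polytime_on D (\<lambda>c. bucket_count g (Qs c))"
  unfolding bucket_count_def by (intro polytime)

lemma polytime_cover_family[polytime]: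
  assumes "polytime_on D Qs" "polytime_on D r" "polytime_on D Bs"
  shows "polytime_on D (\<lambda>c. cover_family (Qs c) (r c) (Bs c))"
  by (rule polytime_comp3[OF _ assms]) (unfold cover_family_def positions_def, intro polytime)

lemma in_packing_domain:
  assumes "triangle_classes Qs \<mu> M cls" "set S \<subseteq> set Qs"
  shows "(Qs, S, bucket g Qs H cls j) \<in> packing_domain \<mu> M"
      "(Qs, S, unanchored H cls) \<in> packing_domain \<mu> M"
  using assms triangle_classes.bucket_facts[OF assms(1)] unfolding packing_domain_def
  by (simp_all, blast+)

lemma polytime_demand:
  assumes pt: "polytime_on D Qs" "polytime_on D H" "polytime_on D cls" "polytime_on D x"
    and cls: "\<And>c. c \<in> D \<Longrightarrow> triangle_classes (Qs c) \<mu> M (cls c)"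
  shows "polytime_on D (\<lambda>c. demand g (Qs c) (H c) (cls c) (x c))"
  unfolding demand_def
  by (intro polytime polytime_best_packing[where \<mu> = \<mu> and M = M and m = 0] pt in_packing_domain cls)
    simp_all

lemma polytime_block_sets:
  assumes pt: "polytime_on D Qs" "polytime_on D H" "polytime_on D cls" "polytime_on D T"
      "polytime_on D a"
    and cls: "\<And>c. c \<in> D \<Longrightarrow> triangle_classes (Qs c) \<mu> M (cls c)"
  shows "polytime_on D (\<lambda>c. block_sets m g (Qs c) (H c) (cls c) (T c) (a c))"
proof -
  let ?entry = "{p. snd p \<in> D \<and> fst p \<in> set (a (snd p))}"
  let ?subset = "{p. snd p \<in> ?entry \<and> fst p \<in> set (small_subsets m (Qs (snd (snd p))))}"
  have Qs: "polytime_on ?subset (\<lambda>p. Qs (snd (snd p)))"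
    and H: "polytime_on ?subset (\<lambda>p. H (snd (snd p)))"
    and cls': "polytime_on ?subset (\<lambda>p. cls (snd (snd p)))"
    and T: "polytime_on ?subset (\<lambda>p. T (snd (snd p)))"
    by (rule polytime_in_context[of ?entry "\<lambda>p. f (snd p)" for f], rule polytime_in_context, rule pt)+
  have demand: "polytime_on ?subset
      (\<lambda>p. demand g (Qs (snd (snd p))) (H (snd (snd p))) (cls (snd (snd p))) (fst (snd p)))"
    using cls by (intro polytime_demand[where \<mu> = \<mu> and M = M] Qs H cls' polytime) auto
  have best: "polytime_on ?subset (\<lambda>p. best_packing (Qs (snd (snd p))) (fst p)
      (bucket g (Qs (snd (snd p))) (H (snd (snd p))) (cls (snd (snd p))) (fst (fst (snd p)))))"
  proof (rule polytime_best_packing[where \<mu> = \<mu> and M = M and m = m])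
    fix p assume p: "p \<in> ?subset"
    then have cls_p: "triangle_classes (Qs (snd (snd p))) \<mu> M (cls (snd (snd p)))" using cls by simp
    note sound = small_subsets_sound[OF triangle_classes.distinct_Qs[OF cls_p], of "fst p" m]
    show "(Qs (snd (snd p)), fst p,
        bucket g (Qs (snd (snd p))) (H (snd (snd p))) (cls (snd (snd p))) (fst (fst (snd p))))
        \<in> packing_domain \<mu> M" using sound p by (intro in_packing_domain cls_p) simp
    show "length (fst p) \<le> m" using sound p by simp
  qed (intro Qs H cls' polytime)+
  show ?thesis
    unfolding block_sets_def
    by (intro polytime_concat_map polytime_map polytime_filter polytime_Pair polytime_conj polytime_Ball
        polytime_not polytime_member polytime_eq polytime_length polytime_le polytime_small_subsets
        demand best polytime_in_context[of ?subset] T polytime_fst polytime_snd polytime_id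
        polytime_in_context[OF pt(1)] pt(5))
qed

text \<open>
  A query is laid out like the input of a Set Cover algorithm, with the threshold split into sign
  and absolute value.
\<close>

type_synonym query = "nat \<times> nat list list \<times> (bool \<times> nat) \<times> unit"

definition set_cover_answer :: "query \<Rightarrow> bool" where
  "set_cover_answer = (\<lambda>(u, Fs, (_, t), _). has_set_cover {..<u} (set ` set Fs) (int t))"

definition set_cover_queries :: "nat \<Rightarrow> query set" where
  "set_cover_queries d = {(u, Fs, (neg, t), _). set_cover_instance d {..<u} (set ` set Fs) \<and>
     lists_family Fs (set ` set Fs) \<and> \<not> neg}"

definition cover_query :: "nat \<Rightarrow> nat \<Rightarrow> nat list \<Rightarrow> nat list \<Rightarrow> triangle_class list \<Rightarrow> nat list \<Rightarrow> assignment
    \<Rightarrow> query" where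
  "cover_query m g Qs H cls T a =
     (length Qs + bucket_count g Qs + bucket_count g Qs,
      cover_family Qs (bucket_count g Qs) (block_sets m g Qs H cls T a),
          (False, bucket_count g Qs + length T), ())"

lemma covers_blocks_query: "covers_blocks m g Qs H cls T a \<longleftrightarrow>
    set_cover_answer (cover_query m g Qs H cls T a)"
  by (simp add: covers_blocks_def set_cover_answer_def cover_query_def)

lemma cover_query_valid:
  assumes "triangle_classes Qs \<mu> M cls" "a \<in> set (assignments (choices m) (bucket_count g Qs))"
  shows "cover_query m g Qs H cls T a \<in> set_cover_queries (m + 2)"
proof -
  note distinct = triangle_classes.distinct_Qs[OF assms(1)]
  have "j < bucket_count g Qs \<and> length U \<le> m \<and> set U \<subseteq> set Qs"
      if "(U, j) \<in> set (block_sets m g Qs H cls T a)" for U j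
    using that assms(2) small_subsets_sound[OF distinct, of U m] unfolding block_sets_iff set_assignments
    by auto
  then show ?thesis
    using cover_family_instance[OF distinct] lists_family_cover_family
    by (simp add: cover_query_def set_cover_queries_def)
qed

type_synonym search_input = "nat \<times> nat list \<times> triangle_class list"

definition search_inputs :: "nat \<Rightarrow> nat \<Rightarrow> search_input set" where
  "search_inputs \<mu> M = {(t, Qs, cls). triangle_classes Qs \<mu> M cls}"

lemma computes_ostar_leaf:
  assumes solver: "computes_ostar (set_cover_queries (m + 2)) set_cover_answer (\<lambda>(u, _). W u)"
    and W: "\<And>u. 1 \<le> W u"
  shows "computes_ostar {(a, s, H, t, Qs, cls). triangle_classes Qs \<mu> M cls \<and>
      a \<in> set (assignments (choices m) (bucket_count g Qs))}
    (\<lambda>(a, s, H, t, Qs, cls). promising g t Qs H cls s a \<and> covers_blocks m g Qs H cls (fst s) a)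
    (\<lambda>(a, s, H, t, Qs, cls). W (length Qs + bucket_count g Qs + bucket_count g Qs))"
  unfolding case_prod_beta covers_blocks_query
proof (rule computes_ostar_conj)
  let ?D' = "{p. triangle_classes (fst (snd (snd (snd (snd p))))) \<mu> M (snd (snd (snd (snd (snd p))))) \<and>
      fst p \<in> set (assignments (choices m) (bucket_count g (fst (snd (snd (snd (snd p)))))))}"
  let ?Qs = "\<lambda>p. fst (snd (snd (snd (snd p))))" and ?cls = "\<lambda>p. snd (snd (snd (snd (snd p))))"
  let ?H = "\<lambda>p. fst (snd (snd p))" and ?s = "\<lambda>p. fst (snd p)" and ?t = "\<lambda>p. fst (snd (snd (snd p)))"
  show "polytime_on ?D' (\<lambda>p. promising g (?t p) (?Qs p) (?H p) (?cls p) (?s p) (fst p))"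
    unfolding promising_def
    by (intro polytime polytime_demand[where \<mu> = \<mu> and M = M]) auto
  have query: "polytime_on ?D' (\<lambda>p. cover_query m g (?Qs p) (?H p) (?cls p) (fst (?s p)) (fst p))"
    unfolding cover_query_def by (intro polytime polytime_block_sets[where \<mu> = \<mu> and M = M]) auto
  have valid: "cover_query m g (?Qs p) (?H p) (?cls p) (fst (?s p)) (fst p) \<in> set_cover_queries (m + 2)"
      if "p \<in> ?D'" for p
    using that cover_query_valid by blast
  have "computes_ostar ?D' (\<lambda>p. set_cover_answer
      (cover_query m g (?Qs p) (?H p) (?cls p) (fst (?s p)) (fst p)))
      (\<lambda>p. W (fst (cover_query m g (?Qs p) (?H p) (?cls p) (fst (?s p)) (fst p))))"
    using computes_ostar_comp[OF query solver valid] W by (simp add: case_prod_beta)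
  then show "computes_ostar {p \<in> ?D'. promising g (?t p) (?Qs p) (?H p) (?cls p) (?s p) (fst p)}
      (\<lambda>p. set_cover_answer (cover_query m g (?Qs p) (?H p) (?cls p) (fst (?s p)) (fst p)))
      (\<lambda>p. W (length (?Qs p) + bucket_count g (?Qs p) + bucket_count g (?Qs p)))"
    by (rule computes_ostar_mono) (auto simp: cover_query_def)
qed (rule W)

lemma computes_ostar_assignment_search:
  assumes gen: "computes_ostar {(os :: (nat \<times> nat) list, r). os \<noteq> []} (\<lambda>(os, r). assignments os r)
      (\<lambda>(os, r). (length os ^ r) ^ a)"
    and solver: "computes_ostar (set_cover_queries (m + 2)) set_cover_answer (\<lambda>(u, _). W u)"
    and W: "\<And>u. 1 \<le> W u"
  shows "computes_ostar {(s, H, X). X \<in> search_inputs \<mu> M}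
    (\<lambda>(s, H, t, Qs, cls). \<exists>a\<in>set (assignments (choices m) (bucket_count g Qs)).
      promising g t Qs H cls s a \<and> covers_blocks m g Qs H cls (fst s) a)
    (\<lambda>(s, H, t, Qs, cls). (length (choices m) ^ bucket_count g Qs) ^ Suc a * W
        (length Qs + bucket_count g Qs + bucket_count g Qs))"
  unfolding case_prod_beta
proof (rule computes_ostar_Bex)
  let ?D = "{p :: packing_state \<times> nat list \<times> search_input. snd (snd p) \<in> search_inputs \<mu> M}"
  let ?Qs = "\<lambda>p :: packing_state \<times> nat list \<times> search_input. fst (snd (snd (snd p)))"
  have pre: "polytime_on ?D (\<lambda>p. (choices m, bucket_count g (?Qs p)))" by (intro polytime)
  have choices: "choices m \<noteq> []" using length_choices[of m] by force
  show "computes_ostar ?D (\<lambda>p. assignments (choices m) (bucket_count g (?Qs p)))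
      (\<lambda>p. (length (choices m) ^ bucket_count g (?Qs p)) ^ a)"
    using computes_ostar_comp[OF pre gen] choices by (simp add: case_prod_beta Suc_le_eq)
  show "computes_ostar {p. snd p \<in> ?D \<and>
      fst p \<in> set (assignments (choices m) (bucket_count g (?Qs (snd p))))}
     (\<lambda>p. promising g (fst (snd (snd (snd p)))) (?Qs (snd p)) (fst (snd (snd p)))
         (snd (snd (snd (snd (snd p))))) (fst (snd p)) (fst p) \<and>
        covers_blocks m g (?Qs (snd p)) (fst (snd (snd p))) (snd (snd (snd (snd (snd p)))))
            (fst (fst (snd p))) (fst p))
     (\<lambda>p. W (length (?Qs (snd p)) + bucket_count g (?Qs (snd p)) + bucket_count g (?Qs (snd p))))"
    by (rule computes_ostar_mono[OF computes_ostar_leaf[OF solver W, of \<mu> M g]])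
      (auto simp: search_inputs_def case_prod_beta)
  let ?bound = "\<lambda>p. 2 + bucket_count g (?Qs p) * (2 * bucket_count g (?Qs p) + 2 + enc_size (choices m))"
  show "poly_bounded ?D (\<lambda>_. 1)" by (rule poly_bounded_const)
  show "poly_bounded ?D ?bound" by (intro poly_bounded_intros polytime_nat_bounded polytime)
  show "enc_size a \<le> ?bound p" if "a \<in> set (assignments (choices m) (bucket_count g (?Qs p)))" for a p
    using that by (rule enc_size_assignment)
  show "1 \<le> length (choices m) ^ bucket_count g (?Qs p)" for p using choices by (simp add: Suc_le_eq)
qed (simp_all add: length_assignments W[unfolded One_nat_def])

lemma computes_ostar_state_search:
  assumes gen: "computes_ostar (packing_domain \<mu> M) (\<lambda>(Qs, S, cs). packing_states Qs S cs)
      (\<lambda>(Qs, S, cs). (2 ^ length S) ^ a)"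
    and P: "computes_ostar {(s :: packing_state, H, X). X \<in> search_inputs \<mu> M} (\<lambda>(s, H, X). P s H X)
        (\<lambda>(s, H, X). W X)"
    and W: "\<And>X. X \<in> search_inputs \<mu> M \<Longrightarrow> 1 \<le> W X"
  shows "computes_ostar {(H, t, Qs, cls). (t, Qs, cls) \<in> search_inputs \<mu> M \<and> set H \<subseteq> set Qs}
    (\<lambda>(H, t, Qs, cls). \<exists>s\<in>set (packing_states Qs H (unanchored H cls)). P s H (t, Qs, cls))
    (\<lambda>(H, X). (2 ^ length H) ^ Suc a * W X)"
  unfolding case_prod_beta
proof (rule computes_ostar_Bex)
  let ?D = "{p :: nat list \<times> search_input. (fst (snd p), fst (snd (snd p)), snd (snd (snd p)))
      \<in> search_inputs \<mu> M \<and>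
      set (fst p) \<subseteq> set (fst (snd (snd p)))}"
  let ?Qs = "\<lambda>p :: nat list \<times> search_input. fst (snd (snd p))"
    and ?cls = "\<lambda>p :: nat list \<times> search_input. snd (snd (snd p))"
  let ?rest = "\<lambda>p. unanchored (fst p) (?cls p)"
  have pre: "polytime_on ?D (\<lambda>p. (?Qs p, fst p, ?rest p))" by (intro polytime)
  have dom: "(?Qs p, fst p, ?rest p) \<in> packing_domain \<mu> M" if "p \<in> ?D" for p
    using that by (intro in_packing_domain(2)) (auto simp: search_inputs_def)
  show "computes_ostar ?D (\<lambda>p. packing_states (?Qs p) (fst p) (?rest p)) (\<lambda>p. (2 ^ length (fst p)) ^ a)"
    using computes_ostar_comp[OF pre gen dom] by (simp add: case_prod_beta)
  show "computes_ostar {p. snd p \<in> ?D \<and>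
      fst p \<in> set (packing_states (?Qs (snd p)) (fst (snd p)) (?rest (snd p)))}
      (\<lambda>p. P (fst p) (fst (snd p)) (fst (snd (snd p)), ?Qs (snd p), ?cls (snd p))) (\<lambda>p. W (snd (snd p)))"
    by (rule computes_ostar_mono[OF P]) auto
  show "poly_bounded ?D (\<lambda>p. enc_size (?rest p) + 1)"
      "poly_bounded ?D (\<lambda>p. enc_size (fst p) + (2 * enc_size (?rest p) + 2))"
    by (intro poly_bounded_intros polytime_enc_size polytime)+
  show "length (packing_states (?Qs p) (fst p) (?rest p)) \<le>
      2 ^ length (fst p) * (enc_size (?rest p) + 1)" if "p \<in> ?D" for p
    using length_packing_states_le[OF dom[OF that]] .
  show "enc_size s \<le> enc_size (fst p) + (2 * enc_size (?rest p) + 2)"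
    if "p \<in> ?D" "s \<in> set (packing_states (?Qs p) (fst p) (?rest p))" for s p
    using enc_size_packing_state[OF dom[OF that(1)] that(2)] .
  show "1 \<le> W (snd p)" if "p \<in> ?D" for p using W that by simp
qed simp

lemma power_length_small_subset_le:
  assumes "distinct xs" "U \<in> set (small_subsets k xs)" "k \<le> length xs"
  shows "2 ^ length U \<le> binomial_sum (length xs) k"
proof -
  have "(2::nat) ^ length U \<le> 2 ^ k" using small_subsets_sound[OF assms(1,2)]
    by (intro power_increasing) simp_all
  also have "\<dots> \<le> binomial_sum (length xs) k" by (rule power_le_binomial_sum[OF assms(3)])
  finally show ?thesis .
qed

lemma computes_ostar_subset_search:
  fixes V :: "nat list \<Rightarrow> nat"
  assumes gen: "computes_ostar UNIV (\<lambda>(k, xs :: nat list). small_subsets k xs)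
      (\<lambda>(k, xs). binomial_sum (length xs) k ^ a)"
    and P: "computes_ostar {(H, t, Qs, cls). (t, Qs, cls) \<in> search_inputs \<mu> M \<and> set H \<subseteq> set Qs}
      (\<lambda>(H, t, Qs, cls). P H t Qs cls) (\<lambda>(H, t, Qs, cls). (2 ^ length H) ^ b * V Qs)"
    and V: "\<And>Qs. 1 \<le> V Qs"
  shows "computes_ostar (search_inputs \<mu> M)
    (\<lambda>(t, Qs, cls). \<exists>H\<in>set (small_subsets (length Qs div h) Qs). P H t Qs cls)
    (\<lambda>(t, Qs, cls). binomial_sum (length Qs) (length Qs div h) ^ Suc a *
        (binomial_sum (length Qs) (length Qs div h) ^ b * V Qs))"
  unfolding case_prod_beta
proof (rule computes_ostar_Bex)
  let ?D = "search_inputs \<mu> M" and ?Qs = "\<lambda>X :: search_input. fst (snd X)"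
  let ?B = "\<lambda>X. binomial_sum (length (?Qs X)) (length (?Qs X) div h)"
  have "polytime_on ?D (\<lambda>X. (length (?Qs X) div h, ?Qs X))" by (intro polytime)
  from computes_ostar_comp[OF this gen]
  show "computes_ostar ?D (\<lambda>X. small_subsets (length (?Qs X) div h) (?Qs X)) (\<lambda>X. ?B X ^ a)"
    using one_le_power[OF binomial_sum_pos] by (simp add: case_prod_beta)
  have sound: "set H \<subseteq> set (?Qs X)" "2 ^ length H \<le> ?B X"
    if "X \<in> ?D" "H \<in> set (small_subsets (length (?Qs X) div h) (?Qs X))" for H X
  proof -
    have Qs: "distinct (?Qs X)" using that(1) triangle_classes.distinct_Qs
      by (auto simp: search_inputs_def)
    show "set H \<subseteq> set (?Qs X)" using small_subsets_sound[OF Qs that(2)] by simp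
    show "2 ^ length H \<le> ?B X" by (rule power_length_small_subset_le[OF Qs that(2)]) simp
  qed
  show "computes_ostar {p. snd p \<in> ?D \<and>
      fst p \<in> set (small_subsets (length (?Qs (snd p)) div h) (?Qs (snd p)))}
      (\<lambda>p. P (fst p) (fst (snd p)) (?Qs (snd p)) (snd (snd (snd p))))
          (\<lambda>p. ?B (snd p) ^ b * V (?Qs (snd p)))"
  proof (rule computes_ostar_mono[OF P])
    let ?D' = "{p. snd p \<in> ?D \<and> fst p \<in> set (small_subsets (length (?Qs (snd p)) div h) (?Qs (snd p)))}"
    have "set (fst p) \<subseteq> set (?Qs (snd p))" if "p \<in> ?D'" for p
      using that by (intro sound(1)) simp_all
    then show "?D' \<subseteq> {(H, t, Qs, cls). (t, Qs, cls) \<in> ?D \<and> set H \<subseteq> set Qs}"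
      by (simp add: case_prod_beta subset_iff)
    fix p assume "p \<in> ?D'"
    then have p: "snd p \<in> ?D" "fst p \<in> set (small_subsets (length (?Qs (snd p)) div h) (?Qs (snd p)))"
      by auto
    show "(case p of (H, t, Qs, cls) \<Rightarrow> (2 ^ length H) ^ b * V Qs) \<le> ?B (snd p) ^ b * V (?Qs (snd p))"
      using sound(2)[OF p] by (simp add: case_prod_beta mult_le_mono1 power_mono)
  qed (simp add: case_prod_beta)
  show "poly_bounded ?D (\<lambda>_. 1)" "poly_bounded ?D (\<lambda>X. enc_size (?Qs X))"
    by (intro poly_bounded_const polytime_enc_size polytime)+
  show "1 \<le> ?B X ^ b * V (?Qs X)" for X
    using mult_le_mono[OF one_le_power[OF binomial_sum_pos] V] by simp
qed (simp_all add: length_small_subsets enc_size_small_subset binomial_sum_pos[unfolded One_nat_def])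

definition search_cost :: "nat \<Rightarrow> nat \<Rightarrow> nat \<Rightarrow> nat \<Rightarrow> (nat \<Rightarrow> nat) \<Rightarrow> nat \<Rightarrow> nat" where
  "search_cost a m g h W p = binomial_sum p (p div h) ^ a * ((length (choices m) ^ (p div g + 1)) ^ a *
     W (p + (p div g + 1) + (p div g + 1)))"

lemma search_cost_ge:
  fixes p m g h :: nat
  defines "B \<equiv> binomial_sum p (p div h)" and "N \<equiv> length (choices m) ^ (p div g + 1)"
  shows "B ^ Suc i * (B ^ Suc j * (N ^ Suc k * W (p + (p div g + 1) + (p div g + 1)))) \<le>
      search_cost (i + j + k + 2) m g h W p"
proof -
  have pos: "1 \<le> B" "1 \<le> N" by (simp_all add: B_def N_def binomial_sum_pos[unfolded One_nat_def]
      length_choices)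
  have "B ^ Suc i * (B ^ Suc j * (N ^ Suc k * w)) = B ^ (i + j + 2) * (N ^ Suc k * w)" for w
    by (simp add: power_add mult_ac)
  also have "B ^ (i + j + 2) * (N ^ Suc k * w) \<le> B ^ (i + j + k + 2) * (N ^ (i + j + k + 2) * w)" for w
    using pos by (intro mult_le_mono power_increasing) simp_all
  finally show ?thesis unfolding search_cost_def B_def N_def .
qed

theorem computes_ostar_search:
  "\<exists>a. \<forall>m g h W. computes_ostar (set_cover_queries (m + 2)) set_cover_answer (\<lambda>(u, _). W u) \<longrightarrow>
      (\<forall>u. 1 \<le> W u) \<longrightarrow>
    computes_ostar (search_inputs \<mu> M) (\<lambda>(t, Qs, cls). search m g h t Qs cls)
        (\<lambda>(t, Qs, cls). search_cost a m g h W (length Qs))"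
proof -
  obtain a1 where subsets: "computes_ostar UNIV (\<lambda>(k, xs :: nat list). small_subsets k xs)
      (\<lambda>(k, xs). binomial_sum (length xs) k ^ a1)"
    using computes_ostar_small_subsets by blast
  obtain a2 where states: "computes_ostar (packing_domain \<mu> M) (\<lambda>(Qs, S, cs). packing_states Qs S cs)
      (\<lambda>(Qs, S, cs). (2 ^ length S) ^ a2)"
    using computes_ostar_packing_states by blast
  obtain a3 where assigns: "computes_ostar {(os :: (nat \<times> nat) list, r). os \<noteq> []}
      (\<lambda>(os, r). assignments os r) (\<lambda>(os, r). (length os ^ r) ^ a3)"
    using computes_ostar_assignments by blast
  let ?a = "a1 + a2 + a3 + 2"
  show ?thesis
  proof (intro exI[of _ ?a] allI impI)
    fix m g h W
    assume solver: "computes_ostar (set_cover_queries (m + 2)) set_cover_answer (\<lambda>(u, _). W u)"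
      and W: "\<forall>u. 1 \<le> W u"
    let ?N = "\<lambda>Qs :: nat list. length (choices m) ^ bucket_count g Qs"
    define V where "V Qs = ?N Qs ^ Suc a3 * W (length Qs + bucket_count g Qs + bucket_count g Qs)" for Qs
    have "1 \<le> ?N Qs" for Qs using length_choices[of m] by simp
    then have V: "1 \<le> V Qs" for Qs
      unfolding V_def using mult_le_mono[OF one_le_power W[rule_format], of "?N Qs" "Suc a3"]
      by (simp del: power_Suc)
    let ?P = "\<lambda>s H X. \<exists>a\<in>set (assignments (choices m) (bucket_count g (fst (snd X)))).
      promising g (fst X) (fst (snd X)) H (snd (snd X)) s a \<and> covers_blocks m g (fst (snd X)) H
          (snd (snd X)) (fst s) a"
    have "computes_ostar {(s, H, X). X \<in> search_inputs \<mu> M} (\<lambda>(s, H, X). ?P s H X)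
        (\<lambda>(s, H, X). V (fst (snd X)))"
      using computes_ostar_assignment_search[OF assigns solver, of \<mu> M g] W
      by (simp add: V_def case_prod_beta')
    from computes_ostar_state_search[OF states this] V
    have "computes_ostar {(H, t, Qs, cls). (t, Qs, cls) \<in> search_inputs \<mu> M \<and> set H \<subseteq> set Qs}
      (\<lambda>(H, t, Qs, cls). \<exists>s\<in>set (packing_states Qs H (unanchored H cls)). ?P s H (t, Qs, cls))
      (\<lambda>(H, t, Qs, cls). (2 ^ length H) ^ Suc a2 * V Qs)" by (simp add: case_prod_beta')
    from computes_ostar_subset_search[OF subsets this V]
    show "computes_ostar (search_inputs \<mu> M) (\<lambda>(t, Qs, cls). search m g h t Qs cls)
        (\<lambda>(t, Qs, cls). search_cost ?a m g h W (length Qs))"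
      by (rule computes_ostar_mono)
        (use search_cost_ge[of _ h a1 a2 m g a3 W] in
            \<open>auto simp: search_def V_def bucket_count_def simp del: power_Suc\<close>)
  qed
qed

section \<open>From a graph with a hub to classes of triangles\<close>

definition expand :: "nat \<Rightarrow> (nat \<Rightarrow> nat \<Rightarrow> bool) \<Rightarrow> nat list \<Rightarrow> nat list" where
  "expand n R X = filter (\<lambda>u. u \<in> set X \<or> (\<exists>x\<in>set X. R x u)) [0..<n]"

text \<open>The final filter lists the reachable vertices in a canonical order.\<close>

definition reachable :: "nat \<Rightarrow> (nat \<Rightarrow> nat \<Rightarrow> bool) \<Rightarrow> nat list \<Rightarrow> nat list" where
  "reachable n R X = filter (\<lambda>u. u \<in> set (fold (\<lambda>_. expand n R) [0..<n * n] X)) [0..<n]"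

definition edge :: "nat list list \<Rightarrow> nat \<Rightarrow> nat \<Rightarrow> bool" where
  "edge Es a b \<longleftrightarrow> [a, b] \<in> set Es \<or> [b, a] \<in> set Es"

definition component_of :: "nat \<Rightarrow> nat list list \<Rightarrow> nat list \<Rightarrow> nat list \<Rightarrow> nat list" where
  "component_of n Es Qs t =
     reachable n (\<lambda>x y. edge Es x y \<and> x \<notin> set Qs \<and> y \<notin> set Qs) (filter (\<lambda>x. x \<notin> set Qs) t)"

definition key_of :: "nat list list \<Rightarrow> nat list \<Rightarrow> nat list \<Rightarrow> nat list \<Rightarrow> nat list" where
  "key_of Es Qs K t = filter (\<lambda>q. q \<in> set t \<or> (\<exists>x\<in>set K. edge Es q x)) Qs"

definition class_id :: "nat \<Rightarrow> nat list list \<Rightarrow> nat list \<Rightarrow> nat list \<Rightarrow> nat list \<times> nat list" where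
  "class_id n Es Qs t = (component_of n Es Qs t, key_of Es Qs (component_of n Es Qs t) t)"

definition triangle_lists :: "nat \<Rightarrow> nat list list \<Rightarrow> nat list list" where
  "triangle_lists n Es = remdups (concat (map (\<lambda>a. concat (map (\<lambda>b. map (\<lambda>c. [a, b, c])
     (filter (\<lambda>c. edge Es a b \<and> edge Es a c \<and> edge Es b c) [0..<b])) [0..<a])) [0..<n]))"

definition classes :: "nat \<Rightarrow> nat list list \<Rightarrow> nat list \<Rightarrow> triangle_class list" where
  "classes n Es Qs = map (\<lambda>i. (snd i, filter (\<lambda>t. class_id n Es Qs t = i) (triangle_lists n Es)))
     (remdups (map (class_id n Es Qs) (triangle_lists n Es)))"

lemma polytime_edge[polytime]:
  assumes "polytime_on D Es" "polytime_on D a" "polytime_on D b"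
  shows "polytime_on D (\<lambda>c. edge (Es c) (a c) (b c))"
  unfolding edge_def by (intro polytime assms)

lemma polytime_triangle_lists[polytime]:
  assumes "polytime_on D n" "polytime_on D Es"
  shows "polytime_on D (\<lambda>c. triangle_lists (n c) (Es c))"
  by (rule polytime_comp2[OF _ assms]) (unfold triangle_lists_def, intro polytime)

lemma polytime_component_of[polytime]:
  assumes "polytime_on D n" "polytime_on D Es" "polytime_on D Qs" "polytime_on D t"
  shows "polytime_on D (\<lambda>c. component_of (n c) (Es c) (Qs c) (t c))"
proof -
  let ?step = "\<lambda>x X (c :: nat \<times> nat list list \<times> nat list \<times> nat list).
    expand (fst c) (\<lambda>x y. edge (fst (snd c)) x y \<and> x \<notin> set (fst (snd (snd c))) \<and>
      y \<notin> set (fst (snd (snd c)))) X"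
  let ?start = "\<lambda>c :: nat \<times> nat list list \<times> nat list \<times> nat list.
    filter (\<lambda>x. x \<notin> set (fst (snd (snd c)))) (snd (snd (snd c)))"
  let ?size = "\<lambda>c :: nat \<times> nat list list \<times> nat list \<times> nat list.
    enc_size (snd (snd (snd c))) + enc_size [0..<fst c]"
  have size: "enc_size (fold (\<lambda>x X. ?step x X c) xs (?start c)) \<le> ?size c" for c and xs :: "nat list"
    by (cases xs rule: rev_cases)
      (simp_all add: expand_def enc_size_filter_le trans_le_add1 trans_le_add2)
  have step: "polytime_on UNIV (\<lambda>p. ?step (fst p) (fst (snd p)) (snd (snd p)))" unfolding expand_def
    by (intro polytime)
  have "polytime_on UNIV (\<lambda>c. fold (\<lambda>x X. ?step x X c) [0..<fst c * fst c] (?start c))"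
    by (rule polytime_fold[OF _ _ step, where S = ?size])
      (intro polytime poly_bounded_intros polytime_enc_size size UNIV_I)+
  then show ?thesis
    by (intro polytime_comp4[OF _ assms], unfold component_of_def reachable_def)
      (intro polytime polytime_in_context[of UNIV])
qed

lemma polytime_classes[polytime]:
  assumes "polytime_on D n" "polytime_on D Es" "polytime_on D Qs"
  shows "polytime_on D (\<lambda>c. classes (n c) (Es c) (Qs c))"
  by (rule polytime_comp3[OF _ assms]) (unfold classes_def class_id_def key_of_def, intro polytime)

lemma set_fold_expand:
  assumes "R \<subseteq> {..<n} \<times> {..<n}" "set X \<subseteq> {..<n}"
  shows "set (fold (\<lambda>_. expand n (\<lambda>x y. (x, y) \<in> R)) xs X) = (R\<^sup>= ^^ length xs) `` set X"
proof (induction xs rule: rev_induct)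
  case (snoc x xs)
  let ?Y = "fold (\<lambda>_. expand n (\<lambda>x y. (x, y) \<in> R)) xs X"
  have "set ?Y \<subseteq> {..<n}" using assms(2) by (cases xs rule: rev_cases) (auto simp: expand_def)
  then have "set (expand n (\<lambda>x y. (x, y) \<in> R) ?Y) = R\<^sup>= `` set ?Y" using assms(1)
    by (auto simp: expand_def)
  then show ?case using snoc.IH by (simp add: relcomp_Image del: relcomp_distrib)
qed simp

lemma relpow_reflcl_eq_rtrancl:
  assumes "finite R" "card R \<le> k"
  shows "R\<^sup>= ^^ k = R\<^sup>*"
proof
  show "R\<^sup>= ^^ k \<subseteq> R\<^sup>*" using relpow_imp_rtrancl[of _ k "R\<^sup>="] by auto
  show "R\<^sup>* \<subseteq> R\<^sup>= ^^ k"
  proof (rule subrelI)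
    fix x y assume "(x, y) \<in> R\<^sup>*"
    then obtain i where i: "i \<le> card R" "(x, y) \<in> R ^^ i" unfolding rtrancl_finite_eq_relpow[OF assms(1)]
      by blast
    have "(y, y) \<in> R\<^sup>= ^^ j" "R ^^ j \<subseteq> R\<^sup>= ^^ j" for j by (induction j) auto
    then have "(y, y) \<in> R\<^sup>= ^^ (k - i)" "(x, y) \<in> R\<^sup>= ^^ i" using i(2) by blast+
    then have "(x, y) \<in> R\<^sup>= ^^ (i + (k - i))" unfolding relpow_add by blast
    then show "(x, y) \<in> R\<^sup>= ^^ k" using i(1) assms(2) by simp
  qed
qed

lemma set_reachable:
  assumes "R \<subseteq> {..<n} \<times> {..<n}" "set X \<subseteq> {..<n}"
  shows "set (reachable n (\<lambda>x y. (x, y) \<in> R) X) = R\<^sup>* `` set X"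
proof -
  have "finite R" "card R \<le> n * n"
    using finite_subset[OF assms(1)] card_mono[OF _ assms(1)] by (simp_all add: card_cartesian_product)
  then have "set (fold (\<lambda>_. expand n (\<lambda>x y. (x, y) \<in> R)) [0..<n * n] X) = R\<^sup>* `` set X"
    unfolding set_fold_expand[OF assms] by (simp add: relpow_reflcl_eq_rtrancl)
  moreover have "R\<^sup>* `` set X \<subseteq> {..<n}" using assms by (auto elim: rtrancl.cases)
  ultimately show ?thesis unfolding reachable_def by auto
qed

lemma reachable_eqI: "set (reachable n R X) = set (reachable n R Y) \<Longrightarrow> reachable n R X = reachable n R Y"
  unfolding reachable_def set_filter by (intro filter_cong) auto

locale hub_instance =
  fixes \<sigma> \<delta> n :: nat and E :: "nat set set" and Q :: "nat set" and Es :: "nat list list"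
    and Qs :: "nat list"
  assumes graph: "simple_graph {..<n} E" and hub: "hub \<sigma> \<delta> {..<n} E Q"
    and Es: "lists_family Es E" and Qs: "lists_set Qs Q"
begin

lemma set_Qs: "set Qs = Q" and distinct_Qs: "distinct Qs" and Q_subset: "Q \<subseteq> {..<n}"
  using Qs hub by (auto simp: lists_set_def hub_def)

lemma length_Qs: "length Qs = card Q"
  using distinct_card[OF distinct_Qs] set_Qs by simp

lemma edge_list_cases:
  assumes "e \<in> set Es"
  obtains a b where "e = [a, b]" "a < n" "b < n" "a \<noteq> b"
proof -
  have "distinct e" "set e \<in> E" using Es assms by (auto simp: lists_family_def lists_set_def)
  then have e: "distinct e" "length e = 2" "set e \<subseteq> {..<n}" using graph distinct_card[of e]
    by (auto simp: simple_graph_def)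
  then obtain a b where "e = [a, b]" by (auto simp: numeral_2_eq_2 length_Suc_conv)
  then show ?thesis using e that by simp
qed

lemma edge_iff: "edge Es a b \<longleftrightarrow> {a, b} \<in> E"
proof
  assume "edge Es a b"
  then have "set [a, b] \<in> set ` set Es \<or> set [b, a] \<in> set ` set Es" unfolding edge_def by blast
  then show "{a, b} \<in> E" using Es by (auto simp: lists_family_def lists_set_def insert_commute)
next
  assume "{a, b} \<in> E"
  then obtain e where e: "e \<in> set Es" "set e = {a, b}" using Es
    by (auto simp: lists_family_def lists_set_def)
  then have "e = [a, b] \<or> e = [b, a]" by (elim edge_list_cases) (auto simp: doubleton_eq_iff)
  then show "edge Es a b" using e(1) by (auto simp: edge_def)
qed

lemma edge_bounds: "{a, b} \<in> E \<Longrightarrow> a < n \<and> b < n"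
  using graph unfolding simple_graph_def by blast

lemma set_triangle_lists:
  "set (triangle_lists n Es) = {[a, b, c] |a b c. c < b \<and> b < a \<and> a < n \<and> {a, b} \<in> E \<and> {a, c} \<in> E \<and>
      {b, c} \<in> E}"
  unfolding triangle_lists_def by (auto simp: edge_iff image_iff)

lemma triangle_list:
  assumes "t \<in> set (triangle_lists n Es)"
  shows "length t = 3" "distinct t" "set t \<subseteq> {..<n}" "sorted_wrt (>) t"
    and "x \<in> set t \<Longrightarrow> y \<in> set t \<Longrightarrow> x \<noteq> y \<Longrightarrow> {x, y} \<in> E"
  using assms unfolding set_triangle_lists by (auto simp: insert_commute)

lemma inj_triangle_lists: "inj_on set (set (triangle_lists n Es))"
proof (rule inj_onI)
  fix t t' assume "t \<in> set (triangle_lists n Es)" "t' \<in> set (triangle_lists n Es)" "set t = set t'"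
  then have "rev t = rev t'"
    using triangle_list(4) by (intro strict_sorted_equal) (auto simp: sorted_wrt_rev)
  then show "t = t'" by simp
qed

lemma triangles_eq: "triangles {..<n} E = set ` set (triangle_lists n Es)"
proof (intro equalityI subsetI)
  fix T assume "T \<in> set ` set (triangle_lists n Es)"
  then obtain t where t: "T = set t" "t \<in> set (triangle_lists n Es)" by blast
  then show "T \<in> triangles {..<n} E"
    using triangle_list[OF t(2)] distinct_card[of t] by (simp add: triangles_def)
next
  fix T assume "T \<in> triangles {..<n} E"
  then have T: "T \<subseteq> {..<n}" "card T = 3" "\<And>x y. x \<in> T \<Longrightarrow> y \<in> T \<Longrightarrow> x \<noteq> y \<Longrightarrow> {x, y} \<in> E"
    by (auto simp: triangles_def)
  define s where "s = sorted_list_of_set T"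
  have "length s = 3" using T(2) by (simp add: s_def)
  then obtain c b a where s: "s = [c, b, a]" by (auto simp: numeral_3_eq_3 length_Suc_conv)
  have "c < b" "b < a" using strict_sorted_list_of_set[of T] unfolding s_def[symmetric] s by simp_all
  moreover have "T = {c, b, a}"
    using set_sorted_list_of_set[OF finite_subset[OF T(1)]] unfolding s_def[symmetric] s by simp
  ultimately have "[a, b, c] \<in> set (triangle_lists n Es)" "set [a, b, c] = T"
    using T unfolding set_triangle_lists by auto
  then show "T \<in> set ` set (triangle_lists n Es)" by blast
qed

definition off_hub :: "(nat \<times> nat) set" where
  "off_hub = {(x, y). {x, y} \<in> {e \<in> E. e \<inter> Q = {}}}"

lemma sym_off_hub: "sym (off_hub\<^sup>*)"
  by (intro sym_rtrancl) (auto simp: off_hub_def sym_def insert_commute)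

lemma component_of_eq: "component_of n Es Qs t =
    reachable n (\<lambda>x y. (x, y) \<in> off_hub) (filter (\<lambda>x. x \<notin> set Qs) t)"
  unfolding component_of_def off_hub_def by (simp add: edge_iff set_Qs conj_commute)

lemma set_component_of:
  assumes "set t \<subseteq> {..<n}"
  shows "set (component_of n Es Qs t) = off_hub\<^sup>* `` (set t - Q)"
proof -
  have "off_hub \<subseteq> {..<n} \<times> {..<n}" unfolding off_hub_def using edge_bounds by auto
  from set_reachable[OF this, of "filter (\<lambda>x. x \<notin> set Qs) t"] show ?thesis
    using assms unfolding component_of_eq by (simp add: set_Qs set_diff_eq subset_iff)
qed

lemma component_of_vertex:
  assumes "t \<in> set (triangle_lists n Es)" "x \<in> set t" "x \<notin> Q"
  shows "set (component_of n Es Qs t) = off_hub\<^sup>* `` {x}"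
proof -
  have "(x, y) \<in> off_hub\<^sup>*" if "y \<in> set t - Q" for y
    using triangle_list(5)[OF assms(1,2), of y] assms(3) that by (cases "x = y") (auto simp: off_hub_def)
  then show ?thesis
    unfolding set_component_of[OF triangle_list(3)[OF assms(1)]] using assms(2,3) symD[OF sym_off_hub]
    by (auto intro: rtrancl_trans)
qed

lemma component_bounds:
  assumes "t \<in> set (triangle_lists n Es)" "x \<in> set t" "x \<notin> Q"
  shows "card (set (component_of n Es Qs t)) \<le> \<sigma>"
    "card {q \<in> Q. \<exists>x\<in>set (component_of n Es Qs t). {q, x} \<in> E} \<le> \<delta>"
proof -
  let ?K = "set (component_of n Es Qs t)"
  have x: "x \<in> {..<n} - Q" using assms triangle_list(3) by auto
  have "y \<in> {..<n} - Q" if "(x, y) \<in> off_hub\<^sup>*" for y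
    by (rule rtranclE[OF that]) (use x edge_bounds in \<open>auto simp: off_hub_def\<close>)
  then have "?K = connected_in ({..<n} - Q) {e \<in> E. e \<inter> Q = {}} `` {x}"
    using x unfolding component_of_vertex[OF assms] connected_in_def off_hub_def Image_singleton by blast
  then have "?K \<in> components ({..<n} - Q) {e \<in> E. e \<inter> Q = {}}"
    unfolding components_def using x by (auto intro: quotientI)
  then show "card ?K \<le> \<sigma>" "card {q \<in> Q. \<exists>x\<in>?K. {q, x} \<in> E} \<le> \<delta>"
    using hub unfolding hub_def by auto
qed

lemma key_of_vertex:
  assumes "t \<in> set (triangle_lists n Es)" "x \<in> set t" "x \<notin> Q"
  shows "key_of Es Qs (component_of n Es Qs t) t =
      filter (\<lambda>q. \<exists>x\<in>set (component_of n Es Qs t). edge Es q x) Qs"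
proof -
  have "x \<in> set (component_of n Es Qs t)" unfolding component_of_vertex[OF assms] by simp
  moreover have "edge Es q x" if "q \<in> set t" "q \<in> Q" for q
    using triangle_list(5)[OF assms(1) that(1) assms(2)] that(2) assms(3) by (auto simp: edge_iff)
  ultimately show ?thesis unfolding key_of_def by (intro filter_cong) (auto simp: set_Qs)
qed

lemma class_id_eq_if_common_vertex:
  assumes "t \<in> set (triangle_lists n Es)" "t' \<in> set (triangle_lists n Es)" "x \<in> set t"
      "x \<in> set t'" "x \<notin> Q"
  shows "class_id n Es Qs t = class_id n Es Qs t'"
proof -
  have "set (component_of n Es Qs t) = set (component_of n Es Qs t')"
    unfolding component_of_vertex[OF assms(1,3,5)] component_of_vertex[OF assms(2,4,5)] ..
  then have "component_of n Es Qs t = component_of n Es Qs t'" unfolding component_of_eq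
    by (rule reachable_eqI)
  then show ?thesis
    unfolding class_id_def using key_of_vertex[OF assms(1,3,5)] key_of_vertex[OF assms(2,4,5)] by simp
qed

lemma length_key_of:
  assumes t: "t \<in> set (triangle_lists n Es)"
  shows "length (key_of Es Qs (component_of n Es Qs t) t) \<le> \<delta> + 3"
proof -
  let ?k = "key_of Es Qs (component_of n Es Qs t) t"
  have len: "length ?k = card (set ?k)"
    unfolding key_of_def using distinct_Qs by (intro distinct_card[symmetric] distinct_filter)
  show ?thesis
  proof (cases "set t \<subseteq> Q")
    case True
    then have "set ?k \<subseteq> set t" using set_component_of[OF triangle_list(3)[OF t]]
      by (auto simp: key_of_def)
    then show ?thesis using len card_mono[of "set t" "set ?k"] card_length[of t] triangle_list(1)[OF t]
      by simp
  next
    case False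
    then obtain x where x: "x \<in> set t" "x \<notin> Q" by blast
    have "set ?k = {q \<in> Q. \<exists>x\<in>set (component_of n Es Qs t). {q, x} \<in> E}"
      unfolding key_of_vertex[OF t x] by (auto simp: edge_iff set_Qs)
    then show ?thesis using component_bounds(2)[OF t x] len by simp
  qed
qed

lemma card_component_of:
  assumes t: "t \<in> set (triangle_lists n Es)"
  shows "card (set (component_of n Es Qs t)) \<le> \<sigma>"
proof (cases "set t \<subseteq> Q")
  case True
  then have "set (component_of n Es Qs t) = {}" using set_component_of[OF triangle_list(3)[OF t]] by auto
  then show ?thesis by simp
next
  case False
  then show ?thesis using component_bounds(1)[OF t] by blast
qed

lemma triangle_subset_component_key:
  assumes t: "t \<in> set (triangle_lists n Es)"
  shows "set t \<subseteq> set (component_of n Es Qs t) \<union> set (key_of Es Qs (component_of n Es Qs t) t)"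
  using component_of_vertex[OF t] by (auto simp: key_of_def set_Qs)

lemma length_class_members:
  assumes t: "t \<in> set (triangle_lists n Es)"
  shows "length (filter (\<lambda>s. class_id n Es Qs s = class_id n Es Qs t) (triangle_lists n Es)) \<le>
      2 ^ (\<sigma> + \<delta> + 3)"
proof -
  let ?ms = "filter (\<lambda>s. class_id n Es Qs s = class_id n Es Qs t) (triangle_lists n Es)"
  let ?K = "component_of n Es Qs t"
  let ?A = "set ?K \<union> set (key_of Es Qs ?K t)"
  have "distinct ?ms" by (simp add: triangle_lists_def)
  then have "length ?ms = card (set ?ms)" by (rule distinct_card[symmetric])
  also have "\<dots> = card (set ` set ?ms)"
    by (rule card_image[symmetric], rule inj_on_subset[OF inj_triangle_lists]) auto
  also have "\<dots> \<le> card (Pow ?A)"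
    using triangle_subset_component_key by (intro card_mono) (force simp: class_id_def)+
  also have "\<dots> = 2 ^ card ?A" by (simp add: card_Pow)
  also have "\<dots> \<le> 2 ^ (\<sigma> + \<delta> + 3)"
    using card_Un_le[of "set ?K" "set (key_of Es Qs ?K t)"] card_component_of[OF t] length_key_of[OF t]
      card_length[of "key_of Es Qs ?K t"] by (intro power_increasing) linarith+
  finally show ?thesis .
qed

lemma classes_memberE:
  assumes "c \<in> set (classes n Es Qs)"
  obtains t where "t \<in> set (triangle_lists n Es)" "fst c = key_of Es Qs (component_of n Es Qs t) t"
    "snd c = filter (\<lambda>s. class_id n Es Qs s = class_id n Es Qs t) (triangle_lists n Es)"
  using assms unfolding classes_def by (auto simp: class_id_def)

lemma class_key: "c \<in> set (classes n Es Qs) \<Longrightarrow> t \<in> set (snd c) \<Longrightarrow> fst c =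
    key_of Es Qs (component_of n Es Qs t) t"
  by (auto simp: classes_def class_id_def)

lemma class_of_class_id:
  assumes "c \<in> set (classes n Es Qs)" "d \<in> set (classes n Es Qs)" "s \<in> set (snd c)" "t \<in> set (snd d)"
    "class_id n Es Qs s = class_id n Es Qs t"
  shows "c = d"
  using assms by (auto simp: classes_def)

lemma distinct_classes: "distinct (classes n Es Qs)"
  unfolding classes_def distinct_map
proof (intro conjI inj_onI)
  fix i j
  assume i: "i \<in> set (remdups (map (class_id n Es Qs) (triangle_lists n Es)))"
    and eq: "(snd i, filter (\<lambda>t. class_id n Es Qs t = i) (triangle_lists n Es)) =
      (snd j, filter (\<lambda>t. class_id n Es Qs t = j) (triangle_lists n Es))"
  obtain t where t: "t \<in> set (filter (\<lambda>t. class_id n Es Qs t = i) (triangle_lists n Es))" using i by auto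
  have "t \<in> set (filter (\<lambda>t. class_id n Es Qs t = j) (triangle_lists n Es))"
    using t arg_cong[OF eq, of snd] by (simp only: snd_conv)
  then show "i = j" using t by simp
qed simp

theorem triangle_classes: "triangle_classes Qs (\<delta> + 3) (2 ^ (\<sigma> + \<delta> + 3)) (classes n Es Qs)"
proof
  fix c d s t x
  assume c: "c \<in> set (classes n Es Qs)" and d: "d \<in> set (classes n Es Qs)" and t: "t \<in> set (snd c)"
  show "t \<in> set (snd d) \<Longrightarrow> c = d" by (rule class_of_class_id[OF c d t]) auto
  show "set t \<inter> set Qs \<subseteq> set (fst c)" unfolding class_key[OF c t] by (auto simp: key_of_def)
  show "t \<noteq> []" using c t triangle_list(1)[of t] by (auto elim: classes_memberE)
next
  fix c assume "c \<in> set (classes n Es Qs)"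
  then show "set (fst c) \<subseteq> set Qs" "length (fst c) \<le> \<delta> + 3" "length (snd c) \<le> 2 ^ (\<sigma> + \<delta> + 3)"
    by (auto elim!: classes_memberE simp: key_of_def length_key_of[unfolded key_of_def]
      length_class_members)
next
  fix c d s t x
  assume cd: "c \<in> set (classes n Es Qs)" "d \<in> set (classes n Es Qs)" "s \<in> set (snd c)" "t \<in> set (snd d)"
    and x: "x \<in> set s" "x \<in> set t" "x \<notin> set Qs"
  have st: "s \<in> set (triangle_lists n Es)" "t \<in> set (triangle_lists n Es)" using cd
    by (auto simp: classes_def)
  show "c = d"
    by (rule class_of_class_id[OF cd class_id_eq_if_common_vertex[OF st x(1,2)]])
      (use x(3) in \<open>simp add: set_Qs\<close>)
qed (simp_all add: distinct_Qs distinct_classes)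

lemma all_members_classes: "all_members (classes n Es Qs) = set (triangle_lists n Es)"
  unfolding all_members_def classes_def by auto

lemma card_vertex_disjoint_le_vertices:
  assumes "Y \<subseteq> set (triangle_lists n Es)" "vertex_disjoint Y"
  shows "card Y \<le> n"
proof -
  have "set t \<inter> {..<n} \<noteq> {}" if "t \<in> Y" for t
    using triangle_list(1,3)[OF subsetD[OF assms(1) that]] by (auto simp: Int_absorb2)
  then show ?thesis
    using card_vertex_disjoint_le[OF assms(2) finite_subset[OF assms(1)], of "{..<n}"] by simp
qed

lemma pairwise_disjnt_image_iff:
  assumes "Y \<subseteq> set (triangle_lists n Es)"
  shows "pairwise disjnt (set ` Y) \<longleftrightarrow> vertex_disjoint Y"
  unfolding vertex_disjoint_def pairwise_image
  using inj_on_eq_iff[OF inj_on_subset[OF inj_triangle_lists assms]] by (auto simp: pairwise_def)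

lemma has_triangle_packing_iff:
  "has_triangle_packing {..<n} E t \<longleftrightarrow>
      (\<exists>Y\<subseteq>set (triangle_lists n Es). vertex_disjoint Y \<and> t \<le> int (card Y))"
proof -
  have image: "pairwise disjnt (set ` Y) \<and> t \<le> int (card (set ` Y)) \<longleftrightarrow>
      vertex_disjoint Y \<and> t \<le> int (card Y)"
    if "Y \<subseteq> set (triangle_lists n Es)" for Y
    using pairwise_disjnt_image_iff[OF that] card_image[OF inj_on_subset[OF inj_triangle_lists that]]
    by simp
  have "has_triangle_packing {..<n} E t \<longleftrightarrow>
      (\<exists>Y\<subseteq>set (triangle_lists n Es). pairwise disjnt (set ` Y) \<and> t \<le> int (card (set ` Y)))"
    unfolding has_triangle_packing_def triangles_eq subset_image_iff by blast
  then show ?thesis using image by blast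
qed

lemma has_triangle_packing_truncated_iff:
  assumes "0 \<le> t"
  shows "has_triangle_packing {..<n} E t \<longleftrightarrow>
    (\<exists>Y\<subseteq>all_members (classes n Es Qs). vertex_disjoint Y \<and> min (nat t) (Suc n) \<le> card Y)"
proof -
  have "t \<le> int (card Y) \<longleftrightarrow> min (nat t) (Suc n) \<le> card Y"
    if "Y \<subseteq> set (triangle_lists n Es)" "vertex_disjoint Y" for Y
    using card_vertex_disjoint_le_vertices[OF that] assms by linarith
  then show ?thesis unfolding has_triangle_packing_iff all_members_classes by blast
qed

lemma length_Es: "length Es \<le> n * n"
proof -
  have "distinct Es" using Es by (simp add: lists_family_def lists_set_def distinct_map)
  then have "length Es = card (set Es)" by (simp add: distinct_card)
  also have "\<dots> \<le> card ((\<lambda>(a, b). [a, b]) ` ({..<n} \<times> {..<n}))"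
    by (rule card_mono) (auto elim: edge_list_cases)
  also have "\<dots> \<le> card ({..<n} \<times> {..<n})" by (rule card_image_le) simp
  finally show ?thesis by (simp add: card_cartesian_product)
qed

lemma enc_size_input:
  assumes "t \<le> Suc n"
  shows "enc_size (n, Es, t, Qs) \<le>
      (2 * n + 2) + ((2 + n * n * (4 * n + 6)) + ((2 * n + 4) + (2 + n * (2 * n + 2))))"
proof -
  have "enc_size Es \<le> 2 + length Es * (4 * n + 6)"
    by (rule enc_size_list_le) (auto elim: edge_list_cases)
  also have "\<dots> \<le> 2 + n * n * (4 * n + 6)" by (intro add_left_mono mult_le_mono1 length_Es)
  finally have Es: "enc_size Es \<le> 2 + n * n * (4 * n + 6)" .
  have "enc_size Qs \<le> 2 + length Qs * (2 * n + 2)"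
    by (rule enc_size_list_le) (use Q_subset set_Qs in auto)
  also have "\<dots> \<le> 2 + n * (2 * n + 2)"
    unfolding length_Qs using card_mono[OF _ Q_subset] by (intro add_left_mono mult_le_mono1) simp
  finally show ?thesis using Es assms by simp
qed

end

section \<open>The algorithm on encoded inputs\<close>

text \<open>
  A threshold may be arbitrarily larger than the graph, so it is cut off at one more than the
  number of vertices in time independent of its size.
\<close>

definition constant_time :: "('a::encodable \<Rightarrow> 'b::encodable) \<Rightarrow> bool" where
  "constant_time f \<longleftrightarrow> (\<exists>K. computes UNIV f (\<lambda>_. K))"

lemma constant_time_id: "constant_time (\<lambda>c. c)" and constant_time_const: "constant_time (\<lambda>_. k)"
  unfolding constant_time_def using computes_id computes_const by blast+

lemma constant_time_comp:
  assumes "constant_time g" "constant_time f"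
  shows "constant_time (\<lambda>c. g (f c))"
proof -
  obtain K1 K2 where K: "computes UNIV g (\<lambda>_. K1)" "computes UNIV f (\<lambda>_. K2)"
    using assms unfolding constant_time_def by auto
  have "computes UNIV (\<lambda>c. g (f c)) (\<lambda>_. K2 + K1 + 2)" using computes_comp[OF K(2,1)] by simp
  then show ?thesis unfolding constant_time_def by (rule exI)
qed

lemma constant_time_fst: "constant_time f \<Longrightarrow> constant_time (\<lambda>c. fst (f c))"
  and constant_time_snd: "constant_time f \<Longrightarrow> constant_time (\<lambda>c. snd (f c))"
  and constant_time_tl: "constant_time g \<Longrightarrow> constant_time (\<lambda>c. tl (g c))"
  and constant_time_null: "constant_time g \<Longrightarrow> constant_time (\<lambda>c. g c = [])"
  by (rule constant_time_comp[of fst] constant_time_comp[of snd] constant_time_comp[of tl]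
    constant_time_comp[of "\<lambda>xs. xs = []"];
      auto simp: constant_time_def intro: computes_fst computes_snd computes_tl computes_null)+

lemma constant_time_Pair:
  assumes "constant_time f" "constant_time g"
  shows "constant_time (\<lambda>c. (f c, g c))"
proof -
  obtain K1 K2 where K: "computes UNIV f (\<lambda>_. K1)" "computes UNIV g (\<lambda>_. K2)"
    using assms unfolding constant_time_def by auto
  have "computes UNIV (\<lambda>c. (f c, g c)) (\<lambda>_. K1 + K2 + 1)" using computes_Pair[OF K] by simp
  then show ?thesis unfolding constant_time_def by (rule exI)
qed

lemma constant_time_if:
  assumes "constant_time b" "constant_time f" "constant_time g"
  shows "constant_time (\<lambda>c. if b c then f c else g c)"
proof -
  obtain K1 K2 K3 where K: "computes UNIV b (\<lambda>_. K1)" "computes UNIV f (\<lambda>_. K2)"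
      "computes UNIV g (\<lambda>_. K3)"
    using assms unfolding constant_time_def by blast
  have "computes UNIV (\<lambda>c. if b c then f c else g c) (\<lambda>c. K1 + (if b c then K2 else K3) + 5)"
    by (rule computes_if[OF K(1) computes_mono[OF K(2)] computes_mono[OF K(3)]]) auto
  then have "computes UNIV (\<lambda>c. if b c then f c else g c) (\<lambda>_. K1 + (K2 + K3) + 5)"
    by (rule computes_mono) auto
  then show ?thesis unfolding constant_time_def by blast
qed

lemma constant_time_recode: "constant_time f \<Longrightarrow> (\<And>c. enc (f' c) = enc (f c)) \<Longrightarrow> constant_time f'"
  unfolding constant_time_def using computes_recode by blast

lemma constant_time_Suc: "constant_time f \<Longrightarrow> constant_time (\<lambda>c. Suc (f c))"
  by (rule constant_time_recode[of "\<lambda>c. ((), f c)"])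
    (auto intro: constant_time_Pair constant_time_const simp: enc_Suc enc_Pair enc_unit_def)

lemma constant_time_units: "constant_time f \<Longrightarrow> constant_time (\<lambda>c. replicate (f c) ())"
  by (erule constant_time_recode) (rule enc_replicate_unit)

lemmas constant_time_intros = constant_time_id constant_time_const constant_time_fst constant_time_snd
  constant_time_tl constant_time_null constant_time_Pair constant_time_if constant_time_Suc
      constant_time_units

lemma fold_transfer_units:
  "fold (\<lambda>_ s. if fst s = [] then s else (tl (fst s), Suc (snd s))) xs (replicate t (), a) =
    (replicate (t - length xs) (), a + min t (length xs))"
proof (induction xs arbitrary: t a)
  case (Cons x xs)
  then show ?case using Cons.IH[of 0] by (cases t) simp_all
qed simp

lemma computes_min:
  assumes "constant_time f" "constant_time k"
  shows "\<exists>K. computes UNIV (\<lambda>c. min (f c) (k c)) (\<lambda>c. (k c + 1) * K)"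
proof -
  let ?step = "\<lambda>p :: unit \<times> (unit list \<times> nat) \<times> 'a.
    if fst (fst (snd p)) = [] then fst (snd p) else (tl (fst (fst (snd p))), Suc (snd (fst (snd p))))"
  have "constant_time ?step" "constant_time (\<lambda>c. replicate (k c) ())"
      "constant_time (\<lambda>c. (replicate (f c) (), 0 :: nat))"
    by (intro constant_time_intros assms)+
  then obtain K1 K2 K3 where K: "computes UNIV ?step (\<lambda>_. K1)"
      "computes UNIV (\<lambda>c. replicate (k c) ()) (\<lambda>_. K2)"
      "computes UNIV (\<lambda>c. (replicate (f c) (), 0 :: nat)) (\<lambda>_. K3)"
    unfolding constant_time_def by blast
  have "computes UNIV (\<lambda>c. fold (\<lambda>x s. ?step (x, s, c)) (replicate (k c) ()) (replicate (f c) (), 0))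
      (\<lambda>c. K2 + K3 + (length (replicate (k c) ()) + 1) * (K1 + 30))"
    by (rule computes_fold[OF K(2,3,1)]) simp
  then have "computes UNIV (\<lambda>c. (replicate (f c - k c) (), min (f c) (k c)))
      (\<lambda>c. K2 + K3 + (k c + 1) * (K1 + 30))"
    by (simp only: fst_conv snd_conv fold_transfer_units length_replicate add_0)
  from computes_comp[OF this computes_snd UNIV_I]
  have "computes UNIV (\<lambda>c. min (f c) (k c)) (\<lambda>c. (k c + 1) * (K1 + K2 + K3 + 40))"
    by (elim computes_mono) (auto simp: algebra_simps)
  then show ?thesis by blast
qed

type_synonym hub_input = "nat \<times> nat list list \<times> (bool \<times> nat) \<times> nat list \<times> unit"

definition hub_input :: "nat \<Rightarrow> nat list list \<Rightarrow> int \<Rightarrow> nat list \<Rightarrow> hub_input" where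
  "hub_input n Es t Qs = (n, Es, (t < 0, nat \<bar>t\<bar>), Qs, ())"

lemma enc_nats_conv: "enc_nats xs = enc xs"
  by (simp add: enc_nats_def enc_list_conv enc_nat_conv[abs_def])

lemma enc_natss_conv: "enc_natss xss = enc xss"
  by (simp add: enc_natss_def enc_nats_conv[abs_def] enc_list_conv[of xss])

lemma enc_hub_input: "enc (hub_input n Es t Qs) =
    enc_list [enc_nat n, enc_natss Es, enc_int t, enc_nats Qs]"
  by (simp add: hub_input_def enc_Pair enc_unit_def enc_int_def enc_nat_conv enc_bool_conv enc_natss_conv
    enc_nats_conv)

lemma enc_query: "enc (u, Fs, (False, t), ()) = enc_list [enc_nat u, enc_natss Fs, enc_int (int t)]"
  by (simp add: enc_Pair enc_unit_def enc_int_def enc_nat_conv enc_bool_conv enc_natss_conv)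

lemma computes_set_cover:
  assumes "solves_set_cover d A T"
  shows "computes (set_cover_queries d) set_cover_answer (\<lambda>(u, _). nat \<lfloor>T u\<rfloor>)"
  unfolding computes_def
proof (intro exI[of _ A] ballI allI)
  fix z :: query and env assume z: "z \<in> set_cover_queries d"
  then obtain u Fs t where z': "z = (u, Fs, (False, t), ())"
    and inst: "set_cover_instance d {..<u} (set ` set Fs)" "lists_family Fs (set ` set Fs)"
    unfolding set_cover_queries_def by auto
  have "decides_within A (enc z) (set_cover_answer z) (T u)"
    using assms inst unfolding z' enc_query solves_set_cover_def set_cover_answer_def by simp
  then obtain k where k: "eval [enc z] A (enc (set_cover_answer z)) k" "real k \<le> T u"
    unfolding decides_within_def by (auto simp: enc_bool_conv)
  have "eval (enc z # env) A (enc (set_cover_answer z)) k"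
    by (rule eval_weaken[OF k(1) enc_data enc_data])
  moreover have "k \<le> (case z of (u, _) \<Rightarrow> nat \<lfloor>T u\<rfloor>)" using k(2) by (simp add: z' le_nat_floor)
  ultimately show "runs (enc z # env) A (enc (set_cover_answer z)) (case z of (u, _) \<Rightarrow> nat \<lfloor>T u\<rfloor>)"
    unfolding runs_def by blast
qed

type_synonym truncated_input = "nat \<times> nat list list \<times> nat \<times> nat list"

definition truncate :: "hub_input \<Rightarrow> truncated_input" where
  "truncate = (\<lambda>(n, Es, (_, t), Qs, _). (n, Es, min t (Suc n), Qs))"

lemma computes_truncate: "\<exists>K. computes UNIV truncate (\<lambda>c. (fst c + 2) * K)"
proof -
  have "constant_time (\<lambda>c :: hub_input. snd (fst (snd (snd c))))"
      "constant_time (\<lambda>c :: hub_input. Suc (fst c))"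
    by (intro constant_time_intros)+
  from computes_min[OF this] obtain K0
    where K0: "computes UNIV (\<lambda>c :: hub_input. min (snd (fst (snd (snd c)))) (Suc (fst c)))
        (\<lambda>c. (Suc (fst c) + 1) * K0)" by blast
  have "constant_time (\<lambda>c :: hub_input. fst c)" "constant_time (\<lambda>c :: hub_input. fst (snd c))"
    "constant_time (\<lambda>c :: hub_input. fst (snd (snd (snd c))))" by (intro constant_time_intros)+
  then obtain K1 K2 K3 where K: "computes UNIV (\<lambda>c :: hub_input. fst c) (\<lambda>_. K1)"
      "computes UNIV (\<lambda>c :: hub_input. fst (snd c)) (\<lambda>_. K2)"
          "computes UNIV (\<lambda>c :: hub_input. fst (snd (snd (snd c)))) (\<lambda>_. K3)"
    unfolding constant_time_def by blast
  have "computes UNIV truncate (\<lambda>c. K1 + (K2 + ((Suc (fst c) + 1) * K0 + K3 + 1) + 1) + 1)"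
    unfolding truncate_def case_prod_beta by (intro computes_Pair K K0)
  then have "computes UNIV truncate (\<lambda>c. (fst c + 2) * (K0 + K1 + K2 + K3 + 3))"
    by (rule computes_mono) (auto simp: algebra_simps)
  then show ?thesis by blast
qed

definition truncated_inputs :: "nat \<Rightarrow> nat \<Rightarrow> truncated_input set" where
  "truncated_inputs \<sigma> \<delta> = {(n, Es, t, Qs). (\<exists>E Q. hub_instance \<sigma> \<delta> n E Q Es Qs) \<and> t \<le> Suc n}"

lemma enc_size_truncated_le:
  "\<exists>a. \<forall>c\<in>truncated_inputs \<sigma> \<delta>. enc_size c \<le> enc_size (fst c) ^ a"
proof -
  let ?q = "\<lambda>n. (2 * n + 2) + ((2 + n * n * (4 * n + 6)) + ((2 * n + 4) + (2 + n * (2 * n + 2))))"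
  have "poly_bounded UNIV ?q" by (intro poly_bounded_intros polytime_nat_bounded polytime)
  then obtain a where "\<And>n. ?q n \<le> enc_size n ^ a" unfolding poly_bounded_def by blast
  then have "enc_size (n, Es, t, Qs) \<le> enc_size n ^ a" if "hub_instance \<sigma> \<delta> n E Q Es Qs" "t \<le> Suc n"
      for n E Q Es Qs t
    using hub_instance.enc_size_input[OF that] le_trans by blast
  then show ?thesis unfolding truncated_inputs_def
    by (intro exI[of _ a]) (auto simp del: enc_size_Pair enc_size_nat)
qed

definition packing_answer :: "nat \<Rightarrow> nat \<Rightarrow> nat \<Rightarrow> truncated_input \<Rightarrow> bool" where
  "packing_answer m g h = (\<lambda>(n, Es, t, Qs). search m g h t Qs (classes n Es Qs))"

definition hub_inputs :: "nat \<Rightarrow> nat \<Rightarrow> hub_input set" where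
  "hub_inputs \<sigma> \<delta> = {(n, Es, _, Qs, _). \<exists>E Q. hub_instance \<sigma> \<delta> n E Q Es Qs}"

lemma computes_packing_answer:
  assumes search: "computes_ostar (search_inputs (\<delta> + 3) (2 ^ (\<sigma> + \<delta> + 3)))
      (\<lambda>(t, Qs, cls). search m g h t Qs cls)
      (\<lambda>(t, Qs, cls). S (length Qs))" and S: "\<And>p. 1 \<le> S p"
  shows "\<exists>e. computes (truncated_inputs \<sigma> \<delta>) (packing_answer m g h)
      (\<lambda>(n, Es, t, Qs). enc_size n ^ e * S (length Qs))"
proof -
  let ?D = "truncated_inputs \<sigma> \<delta>" and ?input = "\<lambda>c :: truncated_input.
    (fst (snd (snd c)), snd (snd (snd c)), classes (fst c) (fst (snd c)) (snd (snd (snd c))))"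
  have input: "polytime_on ?D ?input" by (intro polytime)
  have "?input c \<in> search_inputs (\<delta> + 3) (2 ^ (\<sigma> + \<delta> + 3))" if "c \<in> ?D" for c
    using that hub_instance.triangle_classes by (auto simp: truncated_inputs_def search_inputs_def)
  from computes_ostar_comp[OF input search this]
  have "computes_ostar ?D (packing_answer m g h) (\<lambda>c. S (length (snd (snd (snd c)))))"
    using S by (simp add: packing_answer_def case_prod_beta')
  then obtain e where e: "computes ?D (packing_answer m g h)
      (\<lambda>c. enc_size c ^ e * S (length (snd (snd (snd c)))))"
    unfolding computes_ostar_def by blast
  obtain a where a: "\<And>c. c \<in> ?D \<Longrightarrow> enc_size c \<le> enc_size (fst c) ^ a" using enc_size_truncated_le by blast
  have "computes ?D (packing_answer m g h)
      (\<lambda>c. enc_size (fst c) ^ (a * e) * S (length (snd (snd (snd c)))))"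
    by (rule computes_mono[OF e]) (auto intro!: mult_le_mono1 power_mono a simp del: enc_size_nat
      simp: power_mult)
  then show ?thesis unfolding case_prod_beta by blast
qed

lemma computes_truncated_answer:
  assumes "computes_ostar (search_inputs (\<delta> + 3) (2 ^ (\<sigma> + \<delta> + 3)))
      (\<lambda>(t, Qs, cls). search m g h t Qs cls)
      (\<lambda>(t, Qs, cls). S (length Qs))" and S: "\<And>p. 1 \<le> S p"
  shows "\<exists>e. computes (hub_inputs \<sigma> \<delta>) (\<lambda>c. packing_answer m g h (truncate c))
      (\<lambda>(n, Es, t, Qs, _). enc_size n ^ e * S (length Qs))"
proof -
  let ?D = "hub_inputs \<sigma> \<delta>" and ?S = "\<lambda>c :: hub_input. S (length (fst (snd (snd (snd c)))))"
  obtain e where e: "computes (truncated_inputs \<sigma> \<delta>) (packing_answer m g h)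
      (\<lambda>(n, Es, t, Qs). enc_size n ^ e * S (length Qs))"
    using computes_packing_answer[OF assms] by blast
  obtain K where K: "computes UNIV truncate (\<lambda>c. (fst c + 2) * K)" using computes_truncate by blast
  have "truncate c \<in> truncated_inputs \<sigma> \<delta>" if "c \<in> ?D" for c
    using that by (auto simp: truncate_def hub_inputs_def truncated_inputs_def)
  from computes_comp[OF computes_mono[OF K] e this]
  have time: "computes ?D (\<lambda>c. packing_answer m g h (truncate c))
      (\<lambda>c. (fst c + 2) * K + enc_size (fst c) ^ e * ?S c + 2)"
    by (simp add: truncate_def case_prod_beta)
  have "poly_bounded UNIV (\<lambda>n. (n + 2) * K + 2 + enc_size n ^ e)"
    by (intro poly_bounded_intros polytime_nat_bounded polytime)
  then obtain a where a: "\<And>n. (n + 2) * K + 2 + enc_size n ^ e \<le> enc_size n ^ a"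
    unfolding poly_bounded_def by blast
  have "(fst c + 2) * K + enc_size (fst c) ^ e * ?S c + 2 \<le> enc_size (fst c) ^ a * ?S c" for c
  proof -
    have "((fst c + 2) * K + 2) * 1 + enc_size (fst c) ^ e * ?S c \<le> ((fst c + 2) * K + 2) * ?S c
        + enc_size (fst c) ^ e * ?S c"
      by (intro add_right_mono mult_le_mono2 S)
    also have "\<dots> \<le> enc_size (fst c) ^ a * ?S c" using mult_le_mono1[OF a[of "fst c"], of "?S c"]
      by (simp add: algebra_simps)
    finally show ?thesis by simp
  qed
  then show ?thesis by (intro exI[of _ a] computes_mono[OF time]) (auto simp only: case_prod_beta)
qed

lemma computes_hub_answer:
  assumes "computes_ostar (search_inputs (\<delta> + 3) (2 ^ (\<sigma> + \<delta> + 3)))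
      (\<lambda>(t, Qs, cls). search m g h t Qs cls)
      (\<lambda>(t, Qs, cls). S (length Qs))" and S: "\<And>p. 1 \<le> S p"
  shows "\<exists>e. computes (hub_inputs \<sigma> \<delta>)
      (\<lambda>c. if fst (fst (snd (snd c))) then True else packing_answer m g h (truncate c))
    (\<lambda>(n, Es, t, Qs, _). enc_size n ^ e * S (length Qs))"
proof -
  let ?D = "hub_inputs \<sigma> \<delta>" and ?neg = "\<lambda>c :: hub_input. fst (fst (snd (snd c)))"
  let ?W = "\<lambda>e (c :: hub_input). enc_size (fst c) ^ e * S (length (fst (snd (snd (snd c)))))"
  obtain e where e: "computes ?D (\<lambda>c. packing_answer m g h (truncate c)) (?W e)"
    using computes_truncated_answer[OF assms] unfolding case_prod_beta by blast
  have "constant_time ?neg" by (intro constant_time_intros)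
  then obtain K where K: "computes UNIV ?neg (\<lambda>_. K)" unfolding constant_time_def by blast
  have time: "computes ?D (\<lambda>c. if ?neg c then True else packing_answer m g h (truncate c))
      (\<lambda>c. K + (if ?neg c then enc_size True else ?W e c) + 5)"
    by (rule computes_if[OF computes_mono[OF K] computes_const computes_mono[OF e]]) auto
  have "poly_bounded UNIV (\<lambda>n :: nat. (K + 10) * enc_size n ^ e)" by (intro poly_bounded_intros)
  then obtain a where a: "\<And>n :: nat. (K + 10) * enc_size n ^ e \<le> enc_size n ^ a"
    unfolding poly_bounded_def by blast
  have "K + (if ?neg c then enc_size True else ?W e c) + 5 \<le> ?W a c" for c
  proof -
    have "K + (if b then enc_size True else w) + 5 \<le> (K + 10) * w" if "1 \<le> w" for w :: nat and b
      using that by (cases w) (simp_all add: algebra_simps)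
    moreover have "1 * 1 \<le> ?W e c" using enc_size_ge_2[of "fst c"]
      by (intro mult_le_mono one_le_power S) linarith
    ultimately have "K + (if ?neg c then enc_size True else ?W e c) + 5 \<le> (K + 10) * ?W e c"
      by (simp only: mult_1)
    also have "\<dots> \<le> ?W a c" using mult_le_mono1[OF a[of "fst c"]] by (simp only: mult.assoc)
    finally show ?thesis .
  qed
  then show ?thesis by (intro exI[of _ a] computes_mono[OF time]) (auto simp only: case_prod_beta)
qed

lemma (in hub_instance) hub_answer_correct:
  assumes "0 < g" "0 < h" "m = g * ((\<delta> + 3) * h) * (\<delta> + 3)"
  shows "(if t < 0 then True else packing_answer m g h (truncate (hub_input n Es t Qs))) \<longleftrightarrow>
      has_triangle_packing {..<n} E t"
proof (cases "t < 0")
  case True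
  have "has_triangle_packing {..<n} E t"
    unfolding has_triangle_packing_iff using True by (intro exI[of _ "{}"]) simp
  then show ?thesis using True by simp
next
  case False
  interpret triangle_classes Qs "\<delta> + 3" "2 ^ (\<sigma> + \<delta> + 3)" "classes n Es Qs" by (rule triangle_classes)
  show ?thesis
    using False assms search_sound[OF assms(1)] search_complete[of _ "min (nat t) (Suc n)" g h m]
      has_triangle_packing_truncated_iff[of t]
    by (auto simp: packing_answer_def truncate_def hub_input_def)
qed

theorem triangle_packing_algorithm:
  assumes "0 < g" "0 < h" "m = g * ((\<delta> + 3) * h) * (\<delta> + 3)"
    and "computes_ostar (search_inputs (\<delta> + 3) (2 ^ (\<sigma> + \<delta> + 3))) (\<lambda>(t, Qs, cls). search m g h t Qs cls)
      (\<lambda>(t, Qs, cls). S (length Qs))" "\<And>p. 1 \<le> S p"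
  shows "\<exists>A e. solves_triangle_packing_hub \<sigma> \<delta> A (\<lambda>n p. real ((2 * n + 2) ^ e * S p))"
proof -
  obtain e where "computes (hub_inputs \<sigma> \<delta>)
      (\<lambda>c. if fst (fst (snd (snd c))) then True else packing_answer m g h (truncate c))
      (\<lambda>(n, Es, t, Qs, _). enc_size n ^ e * S (length Qs))"
    using computes_hub_answer[OF assms(4,5)] by blast
  then obtain A where A: "\<And>c env. c \<in> hub_inputs \<sigma> \<delta> \<Longrightarrow> runs (enc c # env) A
      (enc (if fst (fst (snd (snd c))) then True else packing_answer m g h (truncate c)))
      (case c of (n, Es, t, Qs, _) \<Rightarrow> enc_size n ^ e * S (length Qs))"
    unfolding computes_def by blast
  have "decides_within A (enc_list [enc_nat n, enc_natss Es, enc_int t, enc_nats Qs])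
      (has_triangle_packing {..<n} E t) (real ((2 * n + 2) ^ e * S (card Q)))"
    if inst: "hub_instance \<sigma> \<delta> n E Q Es Qs" for n E t Q Es Qs
  proof -
    let ?c = "hub_input n Es t Qs"
    have "?c \<in> hub_inputs \<sigma> \<delta>" using inst by (auto simp: hub_inputs_def hub_input_def)
    from A[OF this, of "[]"]
    obtain k where "eval [enc ?c] A (enc (if t < 0 then True else packing_answer m g h (truncate ?c))) k"
        "k \<le> (2 * n + 2) ^ e * S (length Qs)"
      unfolding runs_def by (auto simp: hub_input_def)
    then show ?thesis
      unfolding decides_within_def enc_hub_input hub_instance.hub_answer_correct[OF inst assms(1-3)]
        enc_bool_conv
        hub_instance.length_Qs[OF inst]
      using of_nat_mono by blast
  qed
  then show ?thesis unfolding solves_triangle_packing_hub_def hub_instance_def by blast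
qed

section \<open>Running time\<close>

lemma binomial_sum_le_weighted:
  fixes x :: real
  assumes "0 < x" "x \<le> 1" "k \<le> n"
  shows "real (binomial_sum n k) \<le> (1 + x) ^ n * (1 / x) ^ k"
proof -
  have "real (binomial_sum n k) * x ^ k = (\<Sum>i\<le>k. real (n choose i) * x ^ k)"
    by (simp add: binomial_sum_def sum_distrib_right)
  also have "\<dots> \<le> (\<Sum>i\<le>k. real (n choose i) * x ^ i)"
    using assms by (intro sum_mono mult_left_mono power_decreasing) auto
  also have "\<dots> \<le> (\<Sum>i\<le>n. real (n choose i) * x ^ i)"
    using assms by (intro sum_mono2) auto
  also have "\<dots> = (1 + x) ^ n" using binomial_ring[of x 1 n] by (simp add: add.commute)
  finally show ?thesis using assms by (simp add: power_one_over field_simps)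
qed

lemma power_div_le:
  fixes u :: real
  assumes "1 \<le> u"
  shows "(u ^ h) ^ (n div h) \<le> u ^ n"
  unfolding power_mult[symmetric] using assms
  by (intro power_increasing) (simp_all add: times_div_less_eq_dividend)

lemma binomial_sum_le_exponential:
  fixes \<rho> :: real
  assumes "1 < \<rho>"
  shows "\<exists>h>0. \<forall>n. real (binomial_sum n (n div h)) ^ a \<le> \<rho> ^ n"
proof -
  define u where "u = root (2 * Suc a) \<rho>"
  have u: "1 < u" "u ^ (2 * Suc a) = \<rho>" using assms unfolding u_def
    by (subst real_root_gt_1_iff real_root_pow_pos2; simp)+
  define x where "x = min 1 (u - 1)"
  have x: "0 < x" "x \<le> 1" "1 + x \<le> u" using u(1) by (auto simp: x_def)
  obtain h where h: "1 / x < u ^ h" using real_arch_pow[OF u(1)] by blast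
  then have "0 < h" using x(1,2) by (cases h) (auto simp: field_simps)
  moreover have "real (binomial_sum n (n div h)) ^ a \<le> \<rho> ^ n" for n
  proof -
    have "real (binomial_sum n (n div h)) \<le> (1 + x) ^ n * (1 / x) ^ (n div h)"
      by (rule binomial_sum_le_weighted[OF x(1,2) div_le_dividend])
    also have "\<dots> \<le> u ^ n * (u ^ h) ^ (n div h)"
      using x h u(1) by (intro mult_mono power_mono) simp_all
    also have "\<dots> \<le> u ^ n * u ^ n" using power_div_le[of u h n] u(1) by (intro mult_left_mono) simp_all
    finally have le: "real (binomial_sum n (n div h)) \<le> u ^ (2 * n)" by (simp add: mult_2 power_add)
    have "real (binomial_sum n (n div h)) ^ a \<le> real (binomial_sum n (n div h)) ^ Suc a"
      using binomial_sum_pos[of n "n div h"] by (intro power_increasing) simp_all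
    also have "\<dots> \<le> (u ^ (2 * n)) ^ Suc a" by (rule power_mono[OF le]) simp
    also have "\<dots> = \<rho> ^ n" unfolding u(2)[symmetric] power_mult[symmetric] by (simp only: mult_ac)
    finally show ?thesis .
  qed
  ultimately show ?thesis by blast
qed

lemma polynomial_le_exponential:
  fixes \<rho> :: real
  assumes "1 < \<rho>"
  shows "\<exists>n>0. real (K * (c * n + 1) ^ N) \<le> \<rho> ^ n"
proof -
  define u where "u = root (Suc N) \<rho>"
  have u: "1 < u" "u ^ Suc N = \<rho>" using assms by (simp_all add: u_def del: power_Suc)
  define M where "M = Suc K * Suc c"
  have "0 < M" by (simp add: M_def)
  have "(\<lambda>n. real n / u ^ n) \<longlonglongrightarrow> 0" using lim_n_over_pown[of u] u(1) by simp
  then have "\<forall>\<^sub>F n in sequentially. real n / u ^ n < 1 / real M"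
    by (rule order_tendstoD) (simp add: \<open>0 < M\<close>)
  then have "\<forall>\<^sub>F n in sequentially. real n / u ^ n < 1 / real M \<and> 0 < n"
    by (intro eventually_conj eventually_gt_at_top)
  then obtain n where n: "real n / u ^ n < 1 / real M" "0 < n"
    using eventually_happens sequentially_bot by blast
  have "K * (c * n + 1) ^ N \<le> (M * n) * (M * n) ^ N"
    using n(2) by (intro mult_le_mono power_mono; cases n; simp add: M_def algebra_simps)
  then have "real (K * (c * n + 1) ^ N) \<le> real (M * n) ^ Suc N"
    by (metis of_nat_le_iff of_nat_power power_Suc)
  also have "\<dots> \<le> (u ^ n) ^ Suc N"
    using n(1) u(1) \<open>0 < M\<close> by (intro power_mono) (simp_all add: field_simps)
  also have "\<dots> = \<rho> ^ n" unfolding u(2)[symmetric] power_mult[symmetric] by (simp only: mult_ac)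
  finally show ?thesis using n(2) by blast
qed

lemma search_cost_le_exponential:
  fixes \<rho> b :: real
  assumes \<rho>: "1 < \<rho>" and b: "1 \<le> b" "b \<le> 2"
    and h: "\<And>p. real (binomial_sum p (p div h)) ^ a \<le> \<rho> ^ p"
    and g: "real (4 * length (choices m) ^ a) \<le> \<rho> ^ g"
    and W: "\<And>u. real (W u) \<le> b ^ u * (K * (real u + 1) ^ c)" and K: "0 \<le> K"
  shows "real (search_cost a m g h W p) \<le>
      (\<rho>\<^sup>2 * b) ^ p * (real (4 * length (choices m) ^ a) * K * 3 ^ c * (real p + 1) ^ c)"
proof -
  let ?r = "p div g + 1" and ?L = "real (length (choices m) ^ a)"
  have "real (W (p + ?r + ?r)) \<le> b ^ (p + ?r + ?r) * (K * (real (p + ?r + ?r) + 1) ^ c)" by (rule W)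
  also have "\<dots> \<le> b ^ (p + ?r + ?r) * (K * (3 * (real p + 1)) ^ c)"
    using b K div_le_dividend[of p g] by (intro mult_left_mono power_mono) simp_all
  also have "\<dots> = (b\<^sup>2) ^ ?r * (b ^ p * (K * 3 ^ c * (real p + 1) ^ c))"
    by (simp only: power_add power_mult_distrib power2_eq_square mult_ac)
  also have "\<dots> \<le> 4 ^ ?r * (b ^ p * (K * 3 ^ c * (real p + 1) ^ c))"
    using b K power_mono[of b 2 2] by (intro mult_right_mono power_mono) simp_all
  finally have W: "real (W (p + ?r + ?r)) \<le> 4 ^ ?r * (b ^ p * (K * 3 ^ c * (real p + 1) ^ c))" .
  have "(4 * ?L) ^ (p div g) \<le> (\<rho> ^ g) ^ (p div g)" using g by (intro power_mono) simp_all
  also have "\<dots> \<le> \<rho> ^ p" using \<rho> by (intro power_div_le) simp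
  finally have L: "(4 * ?L) ^ ?r \<le> 4 * ?L * \<rho> ^ p" by (simp add: mult_left_mono)
  have "real (search_cost a m g h W p) = real (binomial_sum p (p div h)) ^ a
      * (?L ^ ?r * real (W (p + ?r + ?r)))"
    by (simp only: search_cost_def of_nat_mult of_nat_power power_mult[symmetric] mult.commute[of _ a])
  also have "\<dots> \<le> \<rho> ^ p * (?L ^ ?r * (4 ^ ?r * (b ^ p * (K * 3 ^ c * (real p + 1) ^ c))))"
    using \<rho> by (intro mult_mono h mult_left_mono W) simp_all
  also have "\<dots> = \<rho> ^ p * ((4 * ?L) ^ ?r * (b ^ p * (K * 3 ^ c * (real p + 1) ^ c)))"
    by (simp only: power_mult_distrib mult_ac)
  also have "\<dots> \<le> \<rho> ^ p * ((4 * ?L * \<rho> ^ p) * (b ^ p * (K * 3 ^ c * (real p + 1) ^ c)))"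
    using \<rho> b K by (intro mult_left_mono mult_right_mono L) simp_all
  also have "\<dots> = (\<rho>\<^sup>2 * b) ^ p * (real (4 * length (choices m) ^ a) * K * 3 ^ c * (real p + 1) ^ c)"
    by (simp only: power_mult_distrib power2_eq_square of_nat_mult of_nat_numeral mult_ac)
  finally show ?thesis .
qed

lemma polynomial_search_cost_le:
  fixes \<rho> b :: real
  assumes "1 < \<rho>" "1 \<le> b" "b \<le> 2" "\<And>p. real (binomial_sum p (p div h)) ^ a \<le> \<rho> ^ p"
    "real (4 * length (choices m) ^ a) \<le> \<rho> ^ g" "\<And>u. real (W u) \<le> b ^ u * (K * (real u + 1) ^ c)" "0 \<le> K"
      and p: "p \<le> n"
  shows "real ((2 * n + 2) ^ e * search_cost a m g h W p) \<le>
    (\<rho>\<^sup>2 * b) ^ p * (2 ^ e * (real (4 * length (choices m) ^ a) * K * 3 ^ c) * (real n + 1) ^ (e + c))"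
proof -
  let ?K = "real (4 * length (choices m) ^ a) * K * 3 ^ c"
  have "real (search_cost a m g h W p) \<le> (\<rho>\<^sup>2 * b) ^ p * (?K * (real p + 1) ^ c)"
    using assms(1-7) by (rule search_cost_le_exponential)
  also have "\<dots> \<le> (\<rho>\<^sup>2 * b) ^ p * (?K * (real n + 1) ^ c)"
    using p assms(2,7) by (intro mult_left_mono power_mono) simp_all
  finally have "(2 * (real n + 1)) ^ e * real (search_cost a m g h W p) \<le>
      (2 * (real n + 1)) ^ e * ((\<rho>\<^sup>2 * b) ^ p * (?K * (real n + 1) ^ c))"
    by (intro mult_left_mono) simp_all
  also have "\<dots> = (\<rho>\<^sup>2 * b) ^ p * (2 ^ e * ?K * (real n + 1) ^ (e + c))"
    by (simp only: power_mult_distrib power_add mult_ac)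
  finally show ?thesis by (simp add: algebra_simps)
qed

lemma search_parameters:
  fixes \<rho> :: real
  assumes "1 < \<rho>"
  shows "\<exists>h>0. \<exists>g>0. (\<forall>p. real (binomial_sum p (p div h)) ^ a \<le> \<rho> ^ p) \<and>
    real (4 * length (choices (g * (\<mu> * h) * \<mu>)) ^ a) \<le> \<rho> ^ g"
proof -
  obtain h where h: "0 < h" "\<forall>p. real (binomial_sum p (p div h)) ^ a \<le> \<rho> ^ p"
    using binomial_sum_le_exponential[OF assms] by blast
  obtain g where g: "0 < g" "real (4 * (\<mu> * h * \<mu> * g + 1) ^ (2 * a)) \<le> \<rho> ^ g"
    using polynomial_le_exponential[OF assms] by blast
  have "length (choices (g * (\<mu> * h) * \<mu>)) ^ a = (\<mu> * h * \<mu> * g + 1) ^ (2 * a)"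
    unfolding length_choices power_mult by (simp only: mult_ac)
  then show ?thesis using h g by metis
qed

lemma decides_within_mono: "decides_within A x b T \<Longrightarrow> T \<le> T' \<Longrightarrow> decides_within A x b T'"
  unfolding decides_within_def using order_trans by blast

lemma solves_set_cover_mono: "solves_set_cover d A T \<Longrightarrow> (\<And>u. T u \<le> T' u) \<Longrightarrow> solves_set_cover d A T'"
  unfolding solves_set_cover_def using decides_within_mono by blast

lemma solves_triangle_packing_hub_mono:
  assumes "solves_triangle_packing_hub \<sigma> \<delta> A T" "\<And>n p. p \<le> n \<Longrightarrow> T n p \<le> T' n p"
  shows "solves_triangle_packing_hub \<sigma> \<delta> A T'"
proof -
  have "card Q \<le> n" if "hub \<sigma> \<delta> {..<n} E Q" for n E Q
    using that card_mono[of "{..<n}" Q] by (simp add: hub_def)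
  then show ?thesis
    using assms decides_within_mono unfolding solves_triangle_packing_hub_def by blast
qed

lemma eval_pos: "eval env e v k \<Longrightarrow> 0 < k"
  by (induction rule: eval.induct) auto

lemma solves_set_cover_pos:
  assumes "solves_set_cover d A T" "1 \<le> d"
  shows "0 < T u"
proof -
  have "set_cover_instance d {..<u} ((\<lambda>i. {i}) ` {..<u})"
      "lists_family (map (\<lambda>i. [i]) [0..<u]) ((\<lambda>i. {i}) ` {..<u})"
    using assms(2) by (auto simp: set_cover_instance_def lists_family_def lists_set_def
      distinct_map inj_on_def)
  then obtain x b where "decides_within A x b (T u)" using assms(1)
    unfolding solves_set_cover_def by blast
  then show ?thesis unfolding decides_within_def using eval_pos by fastforce
qed

lemma set_cover_algorithms_if_not_SCC:
  assumes "\<not> SCC"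
  shows "\<exists>b::real. 1 \<le> b \<and> b < 2 \<and>
    (\<forall>d\<ge>1. \<exists>A C c. 0 \<le> C \<and> solves_set_cover d A (\<lambda>u. b ^ u * (C * (real u + 1) ^ c)))"
proof -
  obtain \<epsilon> :: real where \<epsilon>: "0 < \<epsilon>"
    and fast: "\<And>d. 1 \<le> d \<Longrightarrow> \<exists>A C c. solves_set_cover d A (\<lambda>u. (2 - \<epsilon>) ^ u * (C * (real u + 1) ^ c))"
    using assms unfolding SCC_def by blast
  have "\<exists>A C c. 0 \<le> C \<and> solves_set_cover d A (\<lambda>u. max 1 (2 - \<epsilon>) ^ u * (C * (real u + 1) ^ c))"
      if d: "1 \<le> d" for d
  proof -
    obtain A C c where A: "solves_set_cover d A (\<lambda>u. (2 - \<epsilon>) ^ u * (C * (real u + 1) ^ c))"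
      using fast[OF d] by blast
    have C: "0 < C" using solves_set_cover_pos[OF A d, of 0] by simp
    then have \<epsilon>: "0 < 2 - \<epsilon>"
      using solves_set_cover_pos[OF A d, of 1] zero_less_mult_pos2[of "2 - \<epsilon>" "C * 2 ^ c"] by simp
    have "solves_set_cover d A (\<lambda>u. max 1 (2 - \<epsilon>) ^ u * (C * (real u + 1) ^ c))"
      using C \<epsilon> by (intro solves_set_cover_mono[OF A] mult_right_mono power_mono) simp_all
    then show ?thesis using C less_imp_le by blast
  qed
  then show ?thesis using \<epsilon> by (intro exI[of _ "max 1 (2 - \<epsilon>)"]) auto
qed

lemma computes_ostar_set_cover:
  fixes b C :: real
  assumes "solves_set_cover d A (\<lambda>u. b ^ u * (C * (real u + 1) ^ c))" "1 \<le> b" "0 \<le> C"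
  shows "\<exists>W. computes_ostar (set_cover_queries d) set_cover_answer (\<lambda>(u, _). W u) \<and> (\<forall>u. 1 \<le> W u) \<and>
    (\<forall>u. real (W u) \<le> b ^ u * ((C + 1) * (real u + 1) ^ c))"
proof (intro exI conjI allI)
  let ?W = "\<lambda>u. nat \<lfloor>b ^ u * (C * (real u + 1) ^ c)\<rfloor> + 1"
  show "computes_ostar (set_cover_queries d) set_cover_answer (\<lambda>(u, _). ?W u)"
    unfolding computes_ostar_def
    by (intro exI[of _ 0] computes_mono[OF computes_set_cover[OF assms(1)]]) auto
  fix u
  show "1 \<le> ?W u" by simp
  have "real (nat \<lfloor>b ^ u * (C * (real u + 1) ^ c)\<rfloor>) \<le> b ^ u * (C * (real u + 1) ^ c)"
    using assms by (intro of_nat_floor) simp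
  moreover have "1 * 1 \<le> b ^ u * (real u + 1) ^ c" using assms(2)
    by (intro mult_mono one_le_power) simp_all
  ultimately show "real (?W u) \<le> b ^ u * ((C + 1) * (real u + 1) ^ c)" by (simp add: algebra_simps)
qed

theorem triangle_packing_if_set_cover:
  fixes \<rho> b :: real
  assumes \<rho>: "1 < \<rho>" and b: "1 \<le> b" "b \<le> 2"
    and solver: "\<And>d. 1 \<le> d \<Longrightarrow> \<exists>A C c. 0 \<le> C \<and> solves_set_cover d A (\<lambda>u. b ^ u * (C * (real u + 1) ^ c))"
  shows "\<exists>A C c. solves_triangle_packing_hub \<sigma> \<delta> A (\<lambda>n p. (\<rho>\<^sup>2 * b) ^ p * (C * (real n + 1) ^ c))"
proof -
  let ?inputs = "search_inputs (\<delta> + 3) (2 ^ (\<sigma> + \<delta> + 3))"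
  obtain a where search: "\<And>m g h W. computes_ostar (set_cover_queries (m + 2)) set_cover_answer
      (\<lambda>(u, _). W u) \<Longrightarrow>
      \<forall>u. 1 \<le> W u \<Longrightarrow> computes_ostar ?inputs (\<lambda>(t, Qs, cls). search m g h t Qs cls)
          (\<lambda>(t, Qs, cls). search_cost a m g h W (length Qs))"
    using computes_ostar_search by blast
  define \<mu> where "\<mu> = \<delta> + 3"
  obtain h g where h: "0 < h" "\<And>p. real (binomial_sum p (p div h)) ^ a \<le> \<rho> ^ p"
    and g: "0 < g" "real (4 * length (choices (g * (\<mu> * h) * \<mu>)) ^ a) \<le> \<rho> ^ g"
    using search_parameters[OF \<rho>] by metis
  define m where "m = g * (\<mu> * h) * \<mu>"
  obtain A0 C c where C: "0 \<le> C"
    and A0: "solves_set_cover (m + 2) A0 (\<lambda>u. b ^ u * (C * (real u + 1) ^ c))"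
    using solver[of "m + 2"] by auto
  obtain W where W: "computes_ostar (set_cover_queries (m + 2)) set_cover_answer (\<lambda>(u, _). W u)"
      "\<forall>u. 1 \<le> W u"
      "\<And>u. real (W u) \<le> b ^ u * ((C + 1) * (real u + 1) ^ c)"
    using computes_ostar_set_cover[OF A0 b(1) C] by blast
  let ?cost = "search_cost a m g h W" and ?K = "real (4 * length (choices m) ^ a) * (C + 1) * 3 ^ c"
  have "1 \<le> ?cost p" for p
    unfolding search_cost_def using binomial_sum_pos[of p "p div h"]
      W(2)[rule_format, of "p + (p div g + 1) + (p div g + 1)"]
    by (simp add: Suc_le_eq length_choices)
  from triangle_packing_algorithm[OF g(1) h(1) m_def[unfolded \<mu>_def] search[OF W(1,2)] this]
  obtain A e where "solves_triangle_packing_hub \<sigma> \<delta> A (\<lambda>n p. real ((2 * n + 2) ^ e * ?cost p))" by blast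
  then have "solves_triangle_packing_hub \<sigma> \<delta> A
      (\<lambda>n p. (\<rho>\<^sup>2 * b) ^ p * (2 ^ e * ?K * (real n + 1) ^ (e + c)))"
    by (rule solves_triangle_packing_hub_mono)
      (use C in \<open>simp_all only: polynomial_search_cost_le \<rho> b h(2) g(2)[folded m_def] W(3)
          add_nonneg_nonneg zero_le_one\<close>)
  then show ?thesis by blast
qed

theorem theorem9p4:
  assumes "\<not> SCC"
  shows "\<exists>\<epsilon>::real > 0. \<forall>\<sigma> \<ge> 1. \<forall>\<delta> \<ge> 1. \<exists>A (C::real) (c::nat).
    solves_triangle_packing_hub \<sigma> \<delta> A (\<lambda>n p. (2 - \<epsilon>) ^ p * (C * (real n + 1) ^ c))"
proof -
  obtain b :: real where b: "1 \<le> b" "b < 2"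
    and solver: "\<And>d. 1 \<le> d \<Longrightarrow> \<exists>A C c. 0 \<le> C \<and> solves_set_cover d A (\<lambda>u. b ^ u * (C * (real u + 1) ^ c))"
    using set_cover_algorithms_if_not_SCC[OF assms] by blast
  define \<rho> where "\<rho> = sqrt ((b + 2) / 2 / b)"
  have \<rho>: "1 < \<rho>" using b by (simp add: \<rho>_def)
  have base: "\<rho>\<^sup>2 * b = 2 - (2 - b) / 2" using b by (simp add: \<rho>_def field_simps)
  have "\<exists>A C c. solves_triangle_packing_hub \<sigma> \<delta> A (\<lambda>n p. (2 - (2 - b) / 2) ^ p * (C * (real n + 1) ^ c))"
      for \<sigma> \<delta>
    using triangle_packing_if_set_cover[OF \<rho> b(1) less_imp_le[OF b(2)] solver] unfolding base .
  then show ?thesis using b(2) by (intro exI[of _ "(2 - b) / 2"]) simp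
qed

end
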